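(* Let $1\le p,q,t\le+\infty$, $0\le\vartheta\le1$, $0\le n,j<+\infty$ be such that $0\le \frac{1-\vartheta}{p}+\frac{\vartheta}{q}-\frac{\vartheta n-j}{d}\le 1$, and let $r\in[1,+\infty]$ be defined by $\frac1r=\frac{1-\vartheta}{p}+\frac{\vartheta}{q}-\frac{\vartheta n-j}{d}$. Consider the Gagliardo-Nirenberg inequality of order $(p,q;j,n,\vartheta)$, $$\text{(GN)}\quad \mathcal L^{p,q,n}\subset\mathcal L^{p,r,j}\ \text{ and }\ \|D^jf\|_{\mathcal L^r}\le G\,\|f\|_{\mathcal L^p}^{1-\vartheta}\|D^nf\|_{\mathcal L^q}^{\vartheta}\ \text{ for some } G\in[0,+\infty)\text{ and all } f\in\mathcal L^{p,q,n},$$ and the Sobolev inequality of order $(p,q;j,n,\vartheta|t)$, $$\text{(S)}\quad \mathcal L^{p,q,n}\subset\mathcal L^{p,r,j}\ \text{ and }\ \|D^jf\|_{\mathcal L^r}\le S\,\big(\|f\|_{\mathcal L^p}^{t}+\|D^nf\|_{\mathcal L^q}^{t}\big)^{1/t}\ \text{ for some } S\in[0,+\infty)\text{ and all } f\in\mathcal L^{p,q,n}.$$ Denote by $G(p,q;j,n,\vartheta)$ and $S(p,q;j,n,\vartheta|t)$ the sharp constants of these inequalities, whenever they hold. Then: (i) If (GN) holds, then (S) holds as well and $S(p,q;j,n,\vartheta|t)\le[(1-\vartheta)^{1-\vartheta}\vartheta^\vartheta]^{1/t}\,G(p,q;j,n,\vartheta)$. (ii) Assume in addition $\frac dp-\frac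 dq+n\neq0$. Then (GN) and (S) are equivalent, and whenever they hold, $S(p,q;j,n,\vartheta|t)=[(1-\vartheta)^{1-\vartheta}\vartheta^\vartheta]^{1/t}\,G(p,q;j,n,\vartheta)$. (iii) Assume $\frac dp-\frac dq+n\neq0$, and assume that (GN) holds and possesses a maximizer $f$. Consider the rescaled functions $f_\lambda$ ($\lambda>0$), $f_\lambda(x)=f(\lambda x)$. Then $f_\lambda$ is a maximizer for (S) if $$\lambda:=\Big(\Big(\frac{\vartheta}{1-\vartheta}\Big)^{1/t}\frac{\|f\|_{\mathcal L^p}}{\|D^nf\|_{\mathcal L^q}}\Big)^{1/(d/p-d/q+n)}.$$ In the cases $\vartheta=0,1$ with $t<+\infty$ (where this formula gives formally $\lambda=0$ or $\lambda=+\infty$), the statement is intended in this limit sense: the ratio $\|D^jf_\lambda\|_{\mathcal L^r}/(\|f_\lambda\|^t_{\mathcal L^p}+\|D^nf_\lambda\|^t_{\mathcal L^q})^{1/t}$ tends to the sharp constant $S(p,q;j,n,\vartheta|t)$ when $\lambda\to0^+$, respectively $\lambda\to+\infty$ (the limit being taken towards the formal value of $\lambda$). (iv) Assume $\frac dp-\frac dq+n\neq0$, and assume that (S) holds and possesses a maximizer $f$. Then $f$ is also a maximizer for (GN).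
   Context: Fix $d\in\{1,2,3,\dots\}$; functions are complex-valued on $\mathbb R^d$. $\mathcal S$ is the Schwartz space; the Fourier transform is $\mathcal F\varphi(k)=(2\pi)^{-d/2}\int_{\mathbb R^d}e^{-ik\cdot x}\varphi(x)\,dx$. $\Phi:=\{\phi\in\mathcal S:\int x_{i_1}\cdots x_{i_m}\phi(x)dx=0 \text{ for all } m\ge 0, i_1,\dots,i_m\}$ and $\Psi:=\{\psi\in\mathcal S: \partial_{i_1\cdots i_m}\psi(0)=0\text{ for all } m\ge0,i_1,\dots,i_m\}$ are closed subspaces of $\mathcal S$ with $\mathcal F\Phi=\Psi$; $\Phi',\Psi'$ are their topological duals. $\mathcal F:\Phi'\to\Psi'$ is the bijection $\langle\mathcal Ff,\psi\rangle:=\langle f,\mathcal F^{-1}\psi_R\rangle$, $\psi_R(k)=\psi(-k)$. For $s\in\mathbb R$ and $g\in\Psi'$, $|k|^sg\in\Psi'$ is $\langle|k|^sg,\psi\rangle:=\langle g,|k|^s\psi\rangle$, and $D^s:\Phi'\to\Phi'$ is the bijection $D^sf:=\mathcal F^{-1}(|k|^s\mathcal Ff)$ (so $D=\sqrt{-\Delta}$). $\mathcal L^p:=L^p(\mathbb R^d,\mathbb C)$ for $p\in[1,+\infty)$, while $\mathcal L^\infty:=C_0(\mathbb R^d,\mathbb C)$ is the space of continuous functions vanishing at infinity, with the sup norm. A function $f\in\mathcal L^p$ is identified with the element $\phi\mapsto\int f\phi$ of $\Phi'$ (this map is injective). For $p,q\in[1,+\infty]$, $n\ge0$: $\mathcal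 L^{p,q,n}:=\{f\in\mathcal L^p: D^nf\in\mathcal L^q\}$. Conventions: $0^0:=(+\infty)^0:=1$ (so $(\vartheta/(1-\vartheta))^{1/t}=1$ for $t=+\infty$, even if $\vartheta=0,1$); $(a^t+b^t)^{1/t}:=\max(a,b)$ for $t=+\infty$. The sharp constant of an inequality is the smallest constant for which it holds; a maximizer is a nonzero $f$ in the space considered for which the inequality, written with its sharp constant, is an equality. *)

theory Defs
  imports "HOL-Analysis.Analysis"
begin

subsection \<open>Schwartz functions and the Lizorkin space\<close>

text \<open>Euclidean space of dimension \<open>d \<ge> 1\<close> is an arbitrary type of class \<open>euclidean_space\<close>, with
  \<open>d = DIM('a)\<close>; the directions are those of the orthonormal basis \<open>Basis\<close>.\<close>

definition partials :: "'a::euclidean_space list \<Rightarrow> ('a \<Rightarrow> complex) \<Rightarrow> 'a \<Rightarrow> complex" where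
  "partials bs f = foldr (\<lambda>b g x. frechet_derivative g (at x) b) bs f"

definition smooth :: "('a::euclidean_space \<Rightarrow> complex) \<Rightarrow> bool" where
  "smooth f \<longleftrightarrow> (\<forall>bs x. set bs \<subseteq> Basis \<longrightarrow> partials bs f differentiable (at x))"

definition schwartz :: "('a::euclidean_space \<Rightarrow> complex) set" where
  "schwartz = {f. smooth f \<and>
     (\<forall>bs (m::nat). set bs \<subseteq> Basis \<longrightarrow> (\<exists>C. \<forall>x. norm x ^ m * norm (partials bs f x) \<le> C))}"

definition Phi :: "('a::euclidean_space \<Rightarrow> complex) set" where
  "Phi = {\<phi> \<in> schwartz. \<forall>bs. set bs \<subseteq> Basis \<longrightarrow>
     (LINT x|lborel. of_real (prod_list (map (\<lambda>b. x \<bullet> b) bs)) * \<phi> x) = 0}"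

subsection \<open>Fourier transform on functions and on functionals\<close>

definition fourier :: "('a::euclidean_space \<Rightarrow> complex) \<Rightarrow> 'a \<Rightarrow> complex" where
  "fourier \<phi> k = of_real ((2 * pi) powr (- real DIM('a) / 2)) *
     (LINT x|lborel. exp (- (\<i> * of_real (k \<bullet> x))) * \<phi> x)"

definition inv_fourier :: "('a::euclidean_space \<Rightarrow> complex) \<Rightarrow> 'a \<Rightarrow> complex" where
  "inv_fourier \<psi> x = of_real ((2 * pi) powr (- real DIM('a) / 2)) *
     (LINT k|lborel. exp (\<i> * of_real (k \<bullet> x)) * \<psi> k)"

definition reflect :: "('a::euclidean_space \<Rightarrow> complex) \<Rightarrow> 'a \<Rightarrow> complex" where
  "reflect \<psi> k = \<psi> (- k)"

text \<open>An element of \<open>\<Phi>'\<close> or of \<open>\<Psi>'\<close> (where \<open>\<Psi> = \<F> \<Phi>\<close> is the space of Schwartz functions all of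
  whose derivatives vanish at \<open>0\<close>) is represented by a total function on test functions, of which only
  the values on \<open>\<Phi>\<close>, respectively on \<open>\<Psi>\<close>, matter: equality in \<open>\<Phi>'\<close> is equality on \<open>\<Phi>\<close>. The operators
  below are applied only to functionals coming from \<open>L\<^sup>p\<close> functions; they act by transposition of
  continuous operators on test functions, so linearity and continuity are preserved and need not be
  carried along.\<close>

type_synonym 'a functional = "('a \<Rightarrow> complex) \<Rightarrow> complex"

definition fourier_dual :: "'a::euclidean_space functional \<Rightarrow> 'a functional" where
  "fourier_dual u \<psi> = u (inv_fourier (reflect \<psi>))"

text \<open>The inverse of \<open>fourier_dual\<close> as a map \<open>\<Psi>' \<rightarrow> \<Phi>'\<close>: solving \<open>u (\<F>\<^sup>-\<^sup>1 \<psi>\<^sub>R) = g \<psi>\<close> for \<open>u\<close> with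
  \<open>\<psi> = (\<F> \<phi>)\<^sub>R\<close> gives \<open>u \<phi> = g ((\<F> \<phi>)\<^sub>R)\<close>.\<close>

definition inv_fourier_dual :: "'a::euclidean_space functional \<Rightarrow> 'a functional" where
  "inv_fourier_dual g \<phi> = g (reflect (fourier \<phi>))"

text \<open>The value of \<open>norm k powr s\<close> at \<open>k = 0\<close>, which is \<open>0\<close> in HOL, is irrelevant here because
  \<open>\<psi> 0 = 0\<close> for \<open>\<psi> \<in> \<Psi>\<close>.\<close>

definition mult_abs :: "real \<Rightarrow> 'a::euclidean_space functional \<Rightarrow> 'a functional" where
  "mult_abs s g \<psi> = g (\<lambda>k. of_real (norm k powr s) * \<psi> k)"

definition Dpow :: "real \<Rightarrow> 'a::euclidean_space functional \<Rightarrow> 'a functional" where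
  "Dpow s u = inv_fourier_dual (mult_abs s (fourier_dual u))"

definition functional_of :: "('a::euclidean_space \<Rightarrow> complex) \<Rightarrow> 'a functional" where
  "functional_of f \<phi> = (LINT x|lborel. f x * \<phi> x)"

subsection \<open>Lebesgue spaces, with the continuous functions vanishing at infinity for exponent infinity\<close>

definition recip :: "ennreal \<Rightarrow> real" where
  "recip p = enn2real (inverse p)"

text \<open>Elements are functions, not classes modulo null sets; for finite \<open>p\<close> each class is
  represented by its Borel members.\<close>

definition Lsp :: "ennreal \<Rightarrow> ('a::euclidean_space \<Rightarrow> complex) set" where
  "Lsp p = (if p = top then {f. continuous_on UNIV f \<and> (f \<longlongrightarrow> 0) at_infinity}
     else {f \<in> borel_measurable lborel. integrable lborel (\<lambda>x. norm (f x) powr enn2real p)})"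

definition Lnorm :: "ennreal \<Rightarrow> ('a::euclidean_space \<Rightarrow> complex) \<Rightarrow> real" where
  "Lnorm p f = (if p = top then (SUP x. norm (f x))
     else (LINT x|lborel. norm (f x) powr enn2real p) powr recip p)"

definition represents :: "('a::euclidean_space \<Rightarrow> complex) \<Rightarrow> 'a functional \<Rightarrow> bool" where
  "represents g u \<longleftrightarrow> (\<forall>\<phi>\<in>Phi. u \<phi> = functional_of g \<phi>)"

definition in_Lsp :: "ennreal \<Rightarrow> 'a::euclidean_space functional \<Rightarrow> bool" where
  "in_Lsp q u \<longleftrightarrow> (\<exists>g\<in>Lsp q. represents g u)"

text \<open>Since \<open>L\<^sup>q\<close> embeds injectively in \<open>\<Phi>'\<close>, the representative chosen here is unique up to null
  sets, and the norm does not depend on the choice.\<close>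

definition Lnorm_dual :: "ennreal \<Rightarrow> 'a::euclidean_space functional \<Rightarrow> real" where
  "Lnorm_dual q u = Lnorm q (SOME g. g \<in> Lsp q \<and> represents g u)"

definition Lsp_D :: "ennreal \<Rightarrow> ennreal \<Rightarrow> real \<Rightarrow> ('a::euclidean_space \<Rightarrow> complex) set" where
  "Lsp_D p q n = {f \<in> Lsp p. in_Lsp q (Dpow n (functional_of f))}"

definition Dnorm :: "ennreal \<Rightarrow> real \<Rightarrow> ('a::euclidean_space \<Rightarrow> complex) \<Rightarrow> real" where
  "Dnorm q n f = Lnorm_dual q (Dpow n (functional_of f))"

subsection \<open>The two inequalities\<close>

text \<open>Power with the convention \<open>0\<^sup>0 = 1\<close>; in HOL, \<open>0 powr 0 = 0\<close>.\<close>

definition rpow :: "real \<Rightarrow> real \<Rightarrow> real" where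
  "rpow a b = (if b = 0 then 1 else a powr b)"

definition tsum :: "ennreal \<Rightarrow> real \<Rightarrow> real \<Rightarrow> real" where
  "tsum t a b = (if t = top then max a b
     else (a powr enn2real t + b powr enn2real t) powr recip t)"

definition GN_rhs ::
  "ennreal \<Rightarrow> ennreal \<Rightarrow> real \<Rightarrow> real \<Rightarrow> ('a::euclidean_space \<Rightarrow> complex) \<Rightarrow> real" where
  "GN_rhs p q n \<theta> f = rpow (Lnorm p f) (1 - \<theta>) * rpow (Dnorm q n f) \<theta>"

definition S_rhs ::
  "ennreal \<Rightarrow> ennreal \<Rightarrow> real \<Rightarrow> ennreal \<Rightarrow> ('a::euclidean_space \<Rightarrow> complex) \<Rightarrow> real" where
  "S_rhs p q n t f = tsum t (Lnorm p f) (Dnorm q n f)"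

text \<open>The exponent \<open>r\<close> is passed explicitly; the \<open>itself\<close> argument fixes the underlying space.\<close>

definition GN_bound :: "'a::euclidean_space itself \<Rightarrow> ennreal \<Rightarrow> ennreal \<Rightarrow> ennreal \<Rightarrow>
    real \<Rightarrow> real \<Rightarrow> real \<Rightarrow> real \<Rightarrow> bool" where
  "GN_bound T p q r j n \<theta> G \<longleftrightarrow>
     0 \<le> G \<and> (\<forall>f::'a \<Rightarrow> complex. f \<in> Lsp_D p q n \<longrightarrow> Dnorm r j f \<le> G * GN_rhs p q n \<theta> f)"

definition GN :: "'a::euclidean_space itself \<Rightarrow> ennreal \<Rightarrow> ennreal \<Rightarrow> ennreal \<Rightarrow>
    real \<Rightarrow> real \<Rightarrow> real \<Rightarrow> bool" where
  "GN T p q r j n \<theta> \<longleftrightarrow>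
     (Lsp_D p q n :: ('a \<Rightarrow> complex) set) \<subseteq> Lsp_D p r j \<and> (\<exists>G. GN_bound T p q r j n \<theta> G)"

definition GN_const :: "'a::euclidean_space itself \<Rightarrow> ennreal \<Rightarrow> ennreal \<Rightarrow> ennreal \<Rightarrow>
    real \<Rightarrow> real \<Rightarrow> real \<Rightarrow> real" where
  "GN_const T p q r j n \<theta> = (LEAST G. GN_bound T p q r j n \<theta> G)"

definition GN_maximizer :: "ennreal \<Rightarrow> ennreal \<Rightarrow> ennreal \<Rightarrow> real \<Rightarrow> real \<Rightarrow> real \<Rightarrow>
    ('a::euclidean_space \<Rightarrow> complex) \<Rightarrow> bool" where
  "GN_maximizer p q r j n \<theta> f \<longleftrightarrow> f \<in> Lsp_D p q n \<and> \<not> (AE x in lborel. f x = 0) \<and>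
     Dnorm r j f = GN_const TYPE('a) p q r j n \<theta> * GN_rhs p q n \<theta> f"

definition S_bound :: "'a::euclidean_space itself \<Rightarrow> ennreal \<Rightarrow> ennreal \<Rightarrow> ennreal \<Rightarrow>
    real \<Rightarrow> real \<Rightarrow> ennreal \<Rightarrow> real \<Rightarrow> bool" where
  "S_bound T p q r j n t S \<longleftrightarrow>
     0 \<le> S \<and> (\<forall>f::'a \<Rightarrow> complex. f \<in> Lsp_D p q n \<longrightarrow> Dnorm r j f \<le> S * S_rhs p q n t f)"

text \<open>The parameter \<open>\<theta>\<close> enters the Sobolev inequality only through \<open>r\<close>.\<close>

definition Sob :: "'a::euclidean_space itself \<Rightarrow> ennreal \<Rightarrow> ennreal \<Rightarrow> ennreal \<Rightarrow>
    real \<Rightarrow> real \<Rightarrow> ennreal \<Rightarrow> bool" where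
  "Sob T p q r j n t \<longleftrightarrow>
     (Lsp_D p q n :: ('a \<Rightarrow> complex) set) \<subseteq> Lsp_D p r j \<and> (\<exists>S. S_bound T p q r j n t S)"

definition S_const :: "'a::euclidean_space itself \<Rightarrow> ennreal \<Rightarrow> ennreal \<Rightarrow> ennreal \<Rightarrow>
    real \<Rightarrow> real \<Rightarrow> ennreal \<Rightarrow> real" where
  "S_const T p q r j n t = (LEAST S. S_bound T p q r j n t S)"

definition S_maximizer :: "ennreal \<Rightarrow> ennreal \<Rightarrow> ennreal \<Rightarrow> real \<Rightarrow> real \<Rightarrow> ennreal \<Rightarrow>
    ('a::euclidean_space \<Rightarrow> complex) \<Rightarrow> bool" where
  "S_maximizer p q r j n t f \<longleftrightarrow> f \<in> Lsp_D p q n \<and> \<not> (AE x in lborel. f x = 0) \<and>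
     Dnorm r j f = S_const TYPE('a) p q r j n t * S_rhs p q n t f"

definition rescale :: "real \<Rightarrow> ('a::euclidean_space \<Rightarrow> complex) \<Rightarrow> 'a \<Rightarrow> complex" where
  "rescale l f x = f (l *\<^sub>R x)"

definition conv_factor :: "real \<Rightarrow> ennreal \<Rightarrow> real" where
  "conv_factor \<theta> t = rpow (rpow (1 - \<theta>) (1 - \<theta>) * rpow \<theta> \<theta>) (recip t)"

definition scaling_exponent :: "'a::euclidean_space itself \<Rightarrow> ennreal \<Rightarrow> ennreal \<Rightarrow> real \<Rightarrow> real" where
  "scaling_exponent T p q n = real DIM('a) * recip p - real DIM('a) * recip q + n"

text \<open>For \<open>t = \<infinity>\<close> the factor \<open>rpow (\<theta> / (1 - \<theta>)) (recip t)\<close> is \<open>1\<close>, also for \<open>\<theta> = 0\<close> and \<open>\<theta> = 1\<close>.\<close>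

definition opt_scale :: "ennreal \<Rightarrow> ennreal \<Rightarrow> real \<Rightarrow> real \<Rightarrow> ennreal \<Rightarrow>
    ('a::euclidean_space \<Rightarrow> complex) \<Rightarrow> real" where
  "opt_scale p q n \<theta> t f =
     (rpow (\<theta> / (1 - \<theta>)) (recip t) * (Lnorm p f / Dnorm q n f))
       powr (1 / scaling_exponent TYPE('a) p q n)"

text \<open>For \<open>t < \<infinity>\<close> and \<open>\<theta> \<in> {0, 1}\<close>, the base of the power in \<open>opt_scale\<close> is formally \<open>0\<close> (\<open>\<theta> = 0\<close>) or
  \<open>\<infinity>\<close> (\<open>\<theta> = 1\<close>), so the formal value of \<open>\<lambda>\<close> also depends on the sign of the scaling exponent \<open>e\<close>.\<close>

definition formal_limit :: "real \<Rightarrow> real \<Rightarrow> real filter" where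
  "formal_limit \<theta> e = (if (\<theta> = 0 \<and> e > 0) \<or> (\<theta> = 1 \<and> e < 0) then at_right 0 else at_top)"

end

theory Submission
  imports Defs "HOL-Probability.Characteristic_Functions" "HOL-Probability.Sinc_Integral"
begin

text \<open>
  Write \<open>a = \<parallel>f\<parallel>\<^sub>p\<close>, \<open>b = \<parallel>D\<^sup>n f\<parallel>\<^sub>q\<close> and \<open>c = \<parallel>D\<^sup>j f\<parallel>\<^sub>r\<close>. Under the dilation \<open>f \<mapsto> f (\<lambda> \<cdot>)\<close> these three
  numbers are multiplied by powers of \<open>\<lambda>\<close>; the relation that defines \<open>r\<close> says that the exponent of \<open>c\<close>
  is the convex combination, with weights \<open>1 - \<theta>\<close> and \<open>\<theta>\<close>, of the exponents of \<open>a\<close> and \<open>b\<close>, so that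
  the product inequality \<open>c \<le> G a\<^sup>1\<^sup>-\<^sup>\<theta> b\<^sup>\<theta>\<close> is dilation invariant. The weighted inequality between the
  arithmetic and the geometric mean gives \<open>a\<^sup>1\<^sup>-\<^sup>\<theta> b\<^sup>\<theta> \<le> \<kappa> (a\<^sup>t + b\<^sup>t)\<^sup>1\<^sup>/\<^sup>t\<close> with the sharp factor
  \<open>\<kappa> = ((1 - \<theta>)\<^sup>1\<^sup>-\<^sup>\<theta> \<theta>\<^sup>\<theta>)\<^sup>1\<^sup>/\<^sup>t\<close> (\<open>rpow_mult_le_tsum\<close>), hence the Sobolev inequality. Conversely, if
  \<open>d/p - d/q + n \<noteq> 0\<close>, then dilations move the ratio \<open>a/b\<close> through all of \<open>(0, \<infinity>)\<close>; the dilation that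
  minimizes the sum makes the mean inequality an equality (\<open>rpow_mult_eq_tsum\<close>) and turns a Sobolev
  inequality into a product inequality with the constant divided by \<open>\<kappa>\<close>
  (\<open>scaling_family_imp_product_bound\<close>). For finite \<open>t\<close> and \<open>\<theta>\<close> equal to \<open>0\<close> or \<open>1\<close>, and for functions with \<open>a = 0\<close>
  or \<open>b = 0\<close>, the optimal dilation degenerates and a limit takes its place. The statements on
  maximizers follow by inspecting the cases of equality.

  The analytic content is hidden in the norms. The norm of \<open>D\<^sup>n f\<close> is that of some function that
  represents a functional on the Lizorkin space \<open>\<Phi>\<close>, so even its behaviour under dilations presupposes
  that representatives are unique; and the optimal dilation only makes sense if \<open>b \<noteq> 0\<close> for
  \<open>f \<noteq> 0\<close>, that is, if \<open>D\<^sup>n\<close> is injective. Both facts are consequences of one theorem,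
  \<open>orthogonal_imp_AE_zero\<close>: a function of \<open>L\<^sup>p\<close> or \<open>C\<^sub>0\<close> that is orthogonal to the Fourier transforms of
  all test functions supported away from the origin vanishes almost everywhere. These transforms lie in
  \<open>\<Phi>\<close> by Fourier inversion, and they form a set that \<open>D\<^sup>n\<close> maps onto itself, because multiplication by
  \<open>|k|\<^sup>n\<close> is invertible on test functions supported away from \<open>0\<close>.

  For the theorem, let \<open>K\<close> be the Fourier transform of a cutoff that equals \<open>1\<close> near \<open>0\<close>, and let
  \<open>K\<^sub>s (x) = s\<^sup>-\<^sup>d K (x / s)\<close>. The difference \<open>K\<^sub>s - K\<^sub>R\<close> is the transform of a test function that vanishes
  near \<open>0\<close>; hence the convolution \<open>f * K\<^sub>s\<close> agrees with \<open>f * K\<^sub>R\<close>, and the latter tends to zero as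
  \<open>R \<rightarrow> \<infinity>\<close>, since \<open>f\<close> is, up to an arbitrarily small bounded error, integrable. Thus
  \<open>f * K\<^sub>s = 0\<close> for every \<open>s\<close>, and \<open>s \<rightarrow> 0\<close> gives \<open>f = 0\<close>.
\<close>

section \<open>Sharp constants, means of products and sums\<close>

text \<open>The admissible constants form a closed half-line: the only constraint imposed by an element with
  \<open>m f > 0\<close> is \<open>G \<ge> c f / m f\<close>, and an element with \<open>m f = 0\<close> imposes a condition that does not involve
  \<open>G\<close>. Hence the infimum is attained.\<close>
lemma LEAST_sharp_constant:
  fixes c m :: "'f \<Rightarrow> real" and A :: "'f set"
  defines "P \<equiv> \<lambda>G. 0 \<le> G \<and> (\<forall>f. f \<in> A \<longrightarrow> c f \<le> G * m f)"
  assumes "P G\<^sub>0" and m: "\<And>f. f \<in> A \<Longrightarrow> 0 \<le> m f"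
  shows "P (Least P)" and "P G \<Longrightarrow> Least P \<le> G"
proof -
  have bdd: "bdd_below (Collect P)"
    unfolding P_def by (rule bdd_belowI[of _ 0]) auto
  have ne: "Collect P \<noteq> {}"
    using assms(2) by auto
  have low: "Inf (Collect P) \<le> G" if "P G" for G
    using that by (intro cInf_lower bdd) auto
  have ge0: "0 \<le> Inf (Collect P)"
    by (rule cInf_greatest[OF ne]) (auto simp: P_def)
  have "c f \<le> Inf (Collect P) * m f" if f: "f \<in> A" for f
  proof (cases "m f = 0")
    case True
    then show ?thesis using assms(2) f by (auto simp: P_def)
  next
    case False
    with m[OF f] have pos: "0 < m f" by simp
    have "c f / m f \<le> Inf (Collect P)"
      by (rule cInf_greatest[OF ne]) (use f pos in \<open>auto simp: P_def field_simps\<close>)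
    then show ?thesis using pos by (simp add: field_simps)
  qed
  then have PI: "P (Inf (Collect P))"
    using ge0 by (auto simp: P_def)
  have eq: "Least P = Inf (Collect P)"
    by (rule Least_equality) (use PI low in auto)
  show "P (Least P)" using PI eq by simp
  show "Least P \<le> G" if "P G" using low[OF that] eq by simp
qed

lemma recip_top [simp]: "recip top = 0"
  by (simp add: recip_def)

lemma enn2real_ge_1: "1 \<le> t \<Longrightarrow> t < top \<Longrightarrow> 1 \<le> enn2real t"
  by (metis enn2real_1 enn2real_mono)

lemma recip_finite: "1 \<le> t \<Longrightarrow> t < top \<Longrightarrow> recip t = 1 / enn2real t"
  by (cases t) (auto simp: recip_def inverse_ennreal divide_inverse simp flip: ennreal_1)

lemma tsum_nonneg: "0 \<le> a \<Longrightarrow> 0 \<le> tsum t a b"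
  by (simp add: tsum_def le_max_iff_disj)

lemma tsum_mult_left:
  assumes "0 < s" "0 \<le> a" "0 \<le> b" "1 \<le> t"
  shows "tsum t (s * a) (s * b) = s * tsum t a b"
proof (cases "t = top")
  case True
  then show ?thesis using assms by (simp add: tsum_def max_mult_distrib_left)
next
  case False
  then have t: "t < top" by (simp add: top.not_eq_extremum)
  note t1 = enn2real_ge_1[OF assms(4) t]
  have "(s * a) powr enn2real t + (s * b) powr enn2real t
      = s powr enn2real t * (a powr enn2real t + b powr enn2real t)"
    using assms by (simp add: powr_mult algebra_simps)
  then show ?thesis
    using assms False t1 by (simp add: tsum_def recip_finite[OF assms(4) t] powr_mult powr_powr)
qed

lemma tsum_le_add:
  assumes "0 \<le> a" "0 \<le> b" "1 \<le> t"
  shows "tsum t a b \<le> a + b"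
proof (cases "t = top")
  case True
  then show ?thesis using assms by (simp add: tsum_def)
next
  case False
  then have t: "t < top" by (simp add: top.not_eq_extremum)
  define \<tau> where "\<tau> = enn2real t"
  have t1: "1 \<le> \<tau>" using enn2real_ge_1[OF assms(3) t] by (simp add: \<tau>_def)
  have split: "x powr \<tau> = x * x powr (\<tau> - 1)" if "0 \<le> x" for x
    using that t1 by (cases "x = 0") (auto simp: powr_diff)
  have "a powr \<tau> + b powr \<tau> = a * a powr (\<tau> - 1) + b * b powr (\<tau> - 1)"
    using assms by (simp add: split)
  also have "\<dots> \<le> a * (a + b) powr (\<tau> - 1) + b * (a + b) powr (\<tau> - 1)"
    using assms t1 by (intro add_mono mult_left_mono powr_mono2) auto
  also have "\<dots> = (a + b) powr \<tau>"
    using assms split[of "a + b"] by (simp add: algebra_simps)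
  finally have "(a powr \<tau> + b powr \<tau>) powr (1 / \<tau>) \<le> ((a + b) powr \<tau>) powr (1 / \<tau>)"
    using t1 by (intro powr_mono2) auto
  then show ?thesis
    using assms t1 False by (simp add: tsum_def recip_finite[OF assms(3) t] powr_powr flip: \<tau>_def)
qed

lemma tsum_ge_max:
  assumes "0 \<le> a" "0 \<le> b" "1 \<le> t"
  shows "max a b \<le> tsum t a b"
proof (cases "t = top")
  case True
  then show ?thesis using assms by (simp add: tsum_def)
next
  case False
  then have t: "t < top" by (simp add: top.not_eq_extremum)
  define \<tau> where "\<tau> = enn2real t"
  have t1: "1 \<le> \<tau>" using enn2real_ge_1[OF assms(3) t] by (simp add: \<tau>_def)
  have "x \<le> (a powr \<tau> + b powr \<tau>) powr (1 / \<tau>)" if "x = a \<or> x = b" for x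
  proof -
    have "(x powr \<tau>) powr (1 / \<tau>) \<le> (a powr \<tau> + b powr \<tau>) powr (1 / \<tau>)"
      using t1 that by (intro powr_mono2) auto
    moreover have "0 \<le> x" using that assms by auto
    ultimately show ?thesis using t1 by (simp add: powr_powr)
  qed
  then show ?thesis
    using False by (simp add: tsum_def recip_finite[OF assms(3) t] flip: \<tau>_def)
qed

lemma conv_factor_endpoint: "\<theta> = 0 \<or> \<theta> = 1 \<Longrightarrow> conv_factor \<theta> t = 1"
  by (auto simp: conv_factor_def rpow_def)

lemma conv_factor_top: "conv_factor \<theta> top = 1"
  by (simp add: conv_factor_def rpow_def)

lemma conv_factor_finite:
  assumes "0 < \<theta>" "\<theta> < 1" "1 \<le> t" "t < top"
  shows "conv_factor \<theta> t = ((1 - \<theta>) powr (1 - \<theta>) * \<theta> powr \<theta>) powr (1 / enn2real t)"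
  using assms enn2real_ge_1[of t] by (simp add: conv_factor_def rpow_def recip_finite)

lemma conv_factor_pos:
  assumes "0 \<le> \<theta>" "\<theta> \<le> 1" "1 \<le> t"
  shows "0 < conv_factor \<theta> t"
proof (cases "\<theta> = 0 \<or> \<theta> = 1 \<or> t = top")
  case True
  then show ?thesis by (auto simp: conv_factor_endpoint conv_factor_top)
next
  case False
  then show ?thesis using assms
    by (subst conv_factor_finite) (auto simp: top.not_eq_extremum)
qed

lemma rpow_nonneg: "0 \<le> rpow a b"
  by (simp add: rpow_def)

text \<open>For finite \<open>t\<close> this is Young's inequality with weights \<open>1 - \<theta>\<close>, \<open>\<theta>\<close>, applied to
  \<open>a\<^sup>t / (1 - \<theta>)\<close> and \<open>b\<^sup>t / \<theta>\<close>.\<close>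
lemma rpow_mult_le_tsum:
  assumes "0 \<le> a" "0 \<le> b" "0 \<le> \<theta>" "\<theta> \<le> 1" "1 \<le> t"
  shows "rpow a (1 - \<theta>) * rpow b \<theta> \<le> conv_factor \<theta> t * tsum t a b"
proof -
  consider "\<theta> = 0" | "\<theta> = 1" | "0 < \<theta>" "\<theta> < 1" "a = 0 \<or> b = 0"
    | "0 < \<theta>" "\<theta> < 1" "0 < a" "0 < b" "t = top"
    | "0 < \<theta>" "\<theta> < 1" "0 < a" "0 < b" "t < top"
    using assms by (force simp: top.not_eq_extremum)
  then show ?thesis
  proof cases
    case 1
    then show ?thesis using tsum_ge_max[of a b t] assms
      by (simp add: conv_factor_endpoint) (simp add: rpow_def)
  next
    case 2
    then show ?thesis using tsum_ge_max[of a b t] assms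
      by (simp add: conv_factor_endpoint) (simp add: rpow_def)
  next
    case 3
    then have "rpow a (1 - \<theta>) * rpow b \<theta> = 0" by (auto simp: rpow_def)
    then show ?thesis using assms conv_factor_pos[of \<theta> t] tsum_nonneg[of a t b]
      by (metis mult_nonneg_nonneg less_imp_le)
  next
    case 4
    have "a powr (1 - \<theta>) * b powr \<theta> \<le> max a b powr (1 - \<theta>) * max a b powr \<theta>"
      using 4 by (intro mult_mono powr_mono2) auto
    also have "\<dots> = max a b" using 4 by (simp flip: powr_add)
    finally show ?thesis using 4 by (simp add: conv_factor_top rpow_def tsum_def)
  next
    case 5
    define \<tau> where "\<tau> = enn2real t"
    have t1: "1 \<le> \<tau>" using enn2real_ge_1[OF assms(5) 5(5)] by (simp add: \<tau>_def)
    let ?k = "(1 - \<theta>) powr (1 - \<theta>) * \<theta> powr \<theta>"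
    have "(a powr \<tau> / (1 - \<theta>)) powr (1 - \<theta>) * (b powr \<tau> / \<theta>) powr \<theta>
        \<le> (1 - \<theta>) * (a powr \<tau> / (1 - \<theta>)) + \<theta> * (b powr \<tau> / \<theta>)"
      using 5 by (intro Youngs_inequality_0) auto
    moreover have "(a powr \<tau> / (1 - \<theta>)) powr (1 - \<theta>) * (b powr \<tau> / \<theta>) powr \<theta>
        = (a powr (1 - \<theta>) * b powr \<theta>) powr \<tau> / ?k"
      using 5 by (simp add: powr_divide powr_mult powr_powr mult.commute)
    moreover have "0 < ?k" using 5 by simp
    ultimately have "(a powr (1 - \<theta>) * b powr \<theta>) powr \<tau> \<le> ?k * (a powr \<tau> + b powr \<tau>)"
      using 5 by (simp add: pos_divide_le_eq mult.commute)
    then have "((a powr (1 - \<theta>) * b powr \<theta>) powr \<tau>) powr (1 / \<tau>)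
        \<le> (?k * (a powr \<tau> + b powr \<tau>)) powr (1 / \<tau>)"
      using t1 by (intro powr_mono2) auto
    also have "\<dots> = ?k powr (1 / \<tau>) * (a powr \<tau> + b powr \<tau>) powr (1 / \<tau>)"
      using 5 by (simp add: powr_mult)
    finally show ?thesis
      using 5 t1 assms less_imp_neq[OF 5(5)] by (simp add: conv_factor_finite rpow_def tsum_def recip_finite powr_powr flip: \<tau>_def)
  qed
qed

text \<open>Equality in Young's inequality requires \<open>a\<^sup>t / (1 - \<theta>) = b\<^sup>t / \<theta>\<close>. The number \<open>\<mu>\<close> is the one for which
  \<open>\<mu>\<^sup>-\<^sup>\<theta> a\<close> and \<open>\<mu>\<^sup>1\<^sup>-\<^sup>\<theta> b\<close>, whose weighted product does not depend on \<open>\<mu>\<close>, satisfy this condition.\<close>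
lemma rpow_mult_eq_tsum:
  assumes "0 < a" "0 < b" "0 \<le> \<theta>" "\<theta> \<le> 1" "1 \<le> t" "0 < \<theta> \<and> \<theta> < 1 \<or> t = top"
  defines "\<mu> \<equiv> rpow (\<theta> / (1 - \<theta>)) (recip t) * (a / b)"
  shows "0 < \<mu>"
    and "conv_factor \<theta> t * tsum t (\<mu> powr - \<theta> * a) (\<mu> powr (1 - \<theta>) * b)
      = a powr (1 - \<theta>) * b powr \<theta>"
proof -
  show mu: "0 < \<mu>"
    using assms by (cases "t = top") (auto simp: \<mu>_def rpow_def)
  show "conv_factor \<theta> t * tsum t (\<mu> powr - \<theta> * a) (\<mu> powr (1 - \<theta>) * b)
      = a powr (1 - \<theta>) * b powr \<theta>"
  proof (cases "t = top")
    case True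
    \<comment> \<open>Here \<open>\<mu> = a / b\<close>, so that both arguments of the maximum are equal.\<close>
    have ab: "a = \<mu> * b" using True assms(2) by (simp add: \<mu>_def rpow_def)
    have "a powr (1 - \<theta>) * b powr \<theta> = \<mu> powr (1 - \<theta>) * (b powr (1 - \<theta>) * b powr \<theta>)"
      using mu assms(2) by (simp add: ab powr_mult)
    also have "\<dots> = \<mu> powr (1 - \<theta>) * b"
      using assms(2) by (simp flip: powr_add)
    finally have B: "\<mu> powr (1 - \<theta>) * b = a powr (1 - \<theta>) * b powr \<theta>" by simp
    have "\<mu> powr - \<theta> * a = \<mu> powr (1 - \<theta>) * b"
      using mu by (simp add: ab powr_diff powr_minus field_simps)
    with B have "\<mu> powr - \<theta> * a = a powr (1 - \<theta>) * b powr \<theta>"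
      "\<mu> powr (1 - \<theta>) * b = a powr (1 - \<theta>) * b powr \<theta>"
      by auto
    then show ?thesis using True by (simp add: conv_factor_top tsum_def)
  next
    case False
    then have t: "t < top" and th: "0 < \<theta>" "\<theta> < 1" using assms by (auto simp: top.not_eq_extremum)
    define \<tau> where "\<tau> = enn2real t"
    have t1: "1 \<le> \<tau>" using enn2real_ge_1[OF assms(5) t] by (simp add: \<tau>_def)
    let ?A = "\<mu> powr - \<theta> * a" and ?B = "\<mu> powr (1 - \<theta>) * b"
    have mu_eq: "\<mu> = (\<theta> / (1 - \<theta>)) powr (1 / \<tau>) * (a / b)"
      using t t1 assms(5) by (simp add: \<mu>_def rpow_def recip_finite \<tau>_def)
    have B: "?B = (\<theta> / (1 - \<theta>)) powr (1 / \<tau>) * ?A"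
      using mu assms(1,2) by (simp add: mu_eq powr_diff powr_minus field_simps)
    have pos: "0 < ?A" using mu assms(1) by simp
    have "?A powr \<tau> + ?B powr \<tau> = ?A powr \<tau> * (1 / (1 - \<theta>))"
      unfolding B using pos th t1 by (subst powr_mult) (auto simp: powr_powr field_simps)
    then have "tsum t ?A ?B = (?A powr \<tau> * (1 / (1 - \<theta>))) powr (1 / \<tau>)"
      using False t assms(5) by (simp add: tsum_def recip_finite flip: \<tau>_def)
    also have "\<dots> = ?A * (1 / (1 - \<theta>)) powr (1 / \<tau>)"
      using pos th t1 by (subst powr_mult) (auto simp: powr_powr)
    finally have ts: "tsum t ?A ?B = ?A * (1 / (1 - \<theta>)) powr (1 / \<tau>)" .
    have cf: "conv_factor \<theta> t = ((1 - \<theta>) powr (1 - \<theta>) * \<theta> powr \<theta>) powr (1 / \<tau>)"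
      using conv_factor_finite[OF th assms(5) t] by (simp add: \<tau>_def)
    have "ln (conv_factor \<theta> t * tsum t ?A ?B) = ln (a powr (1 - \<theta>) * b powr \<theta>)"
      unfolding ts cf unfolding mu_eq using th t1 assms(1,2)
      by (simp add: ln_mult ln_div ln_powr powr_mult powr_powr field_simps)
    moreover have "0 < conv_factor \<theta> t * tsum t ?A ?B"
      using conv_factor_pos[of \<theta> t] th assms(5) pos by (simp add: ts)
    ultimately show ?thesis
      using assms(1,2) by (metis exp_ln mult_pos_pos powr_gt_zero less_irrefl)
  qed
qed

text \<open>The right-hand side of the hypothesis is minimized over \<open>\<mu>\<close>. For \<open>0 < \<theta> < 1\<close> and positive \<open>a\<close>, \<open>b\<close>, the
  minimum is computed in \<open>rpow_mult_eq_tsum\<close>; in the other cases the infimum is a limit at \<open>0\<close> or at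
  \<open>\<infinity>\<close>, where \<open>tsum_le_add\<close> is sharp enough.\<close>
lemma scaling_family_imp_product_bound:
  assumes c: "\<And>\<mu>. 0 < \<mu> \<Longrightarrow> c \<le> S * tsum t (\<mu> powr - \<theta> * a) (\<mu> powr (1 - \<theta>) * b)"
    and "0 \<le> S" "0 \<le> a" "0 \<le> b" "0 \<le> \<theta>" "\<theta> \<le> 1" "1 \<le> t"
  shows "conv_factor \<theta> t * c \<le> S * (rpow a (1 - \<theta>) * rpow b \<theta>)"
proof -
  have c': "c \<le> S * (\<mu> powr - \<theta> * a + \<mu> powr (1 - \<theta>) * b)" if "0 < \<mu>" for \<mu>
    using c[OF that] tsum_le_add[of "\<mu> powr - \<theta> * a" "\<mu> powr (1 - \<theta>) * b" t] assms that
    by (meson mult_left_mono mult_nonneg_nonneg order_trans powr_ge_zero)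
  have lim0: "((\<lambda>\<mu>. \<mu> powr s) \<longlongrightarrow> 0) (at_right 0)" if "0 < s" for s :: real
    using that by (intro tendsto_eq_intros | force simp: eventually_at_filter)+
  have limt: "((\<lambda>\<mu>. \<mu> powr - s) \<longlongrightarrow> 0) at_top" if "0 < s" for s :: real
    using that by (intro tendsto_neg_powr filterlim_ident) simp
  have ev0: "\<forall>\<^sub>F \<mu>::real in at_right 0. 0 < \<mu>" by (simp add: eventually_at_filter)
  have evt: "\<forall>\<^sub>F \<mu>::real in at_top. 0 < \<mu>" by (rule eventually_gt_at_top)
  consider "\<theta> = 0" | "\<theta> = 1" | "0 < \<theta>" "\<theta> < 1" "a = 0" | "0 < \<theta>" "\<theta> < 1" "b = 0"
    | "0 < \<theta>" "\<theta> < 1" "0 < a" "0 < b"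
    using assms by force
  then show ?thesis
  proof cases
    case 1
    have "c \<le> S * (a + 0 * b)"
    proof (rule tendsto_lowerbound)
      show "((\<lambda>\<mu>. S * (a + \<mu> powr 1 * b)) \<longlongrightarrow> S * (a + 0 * b)) (at_right 0)"
        by (intro tendsto_intros lim0) auto
      show "\<forall>\<^sub>F \<mu> in at_right 0. c \<le> S * (a + \<mu> powr 1 * b)"
        using ev0 by eventually_elim (use c' 1 in force)
    qed auto
    then show ?thesis using 1 assms by (simp add: conv_factor_endpoint) (simp add: rpow_def)
  next
    case 2
    have "c \<le> S * (0 * a + b)"
    proof (rule tendsto_lowerbound)
      show "((\<lambda>\<mu>. S * (\<mu> powr - 1 * a + b)) \<longlongrightarrow> S * (0 * a + b)) at_top"
        by (intro tendsto_intros limt) auto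
      show "\<forall>\<^sub>F \<mu> in at_top. c \<le> S * (\<mu> powr - 1 * a + b)"
        using evt by eventually_elim (use c' 2 in force)
    qed auto
    then show ?thesis using 2 assms by (simp add: conv_factor_endpoint) (simp add: rpow_def)
  next
    case 3
    have "c \<le> S * (0 * b)"
    proof (rule tendsto_lowerbound)
      show "((\<lambda>\<mu>. S * (\<mu> powr (1 - \<theta>) * b)) \<longlongrightarrow> S * (0 * b)) (at_right 0)"
        using 3 by (intro tendsto_intros lim0) auto
      show "\<forall>\<^sub>F \<mu> in at_right 0. c \<le> S * (\<mu> powr (1 - \<theta>) * b)"
        using ev0 by eventually_elim (use c' 3 in force)
    qed auto
    then show ?thesis using 3 assms conv_factor_pos[of \<theta> t]
      by (simp add: rpow_def mult_nonneg_nonpos)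
  next
    case 4
    have "c \<le> S * (0 * a)"
    proof (rule tendsto_lowerbound)
      show "((\<lambda>\<mu>. S * (\<mu> powr - \<theta> * a)) \<longlongrightarrow> S * (0 * a)) at_top"
        using 4 by (intro tendsto_intros limt) auto
      show "\<forall>\<^sub>F \<mu> in at_top. c \<le> S * (\<mu> powr - \<theta> * a)"
        using evt by eventually_elim (use c' 4 in force)
    qed auto
    then show ?thesis using 4 assms conv_factor_pos[of \<theta> t]
      by (simp add: rpow_def mult_nonneg_nonpos)
  next
    case 5
    define \<mu> where "\<mu> = rpow (\<theta> / (1 - \<theta>)) (recip t) * (a / b)"
    have opt: "0 < \<mu>" "conv_factor \<theta> t * tsum t (\<mu> powr - \<theta> * a) (\<mu> powr (1 - \<theta>) * b)
        = a powr (1 - \<theta>) * b powr \<theta>"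
      unfolding \<mu>_def by (rule rpow_mult_eq_tsum; use 5 assms in simp)+
    have "conv_factor \<theta> t * c
        \<le> conv_factor \<theta> t * (S * tsum t (\<mu> powr - \<theta> * a) (\<mu> powr (1 - \<theta>) * b))"
      using c[OF opt(1)] conv_factor_pos[of \<theta> t] assms by (intro mult_left_mono) auto
    also have "\<dots> = S * (a powr (1 - \<theta>) * b powr \<theta>)"
      using opt(2) by (simp add: algebra_simps)
    finally show ?thesis using 5 by (simp add: rpow_def)
  qed
qed

section \<open>Affine changes of variables\<close>

text \<open>If \<open>f\<close> is not measurable, then neither is its composition with the affine map, and both integrals are
  \<open>0\<close>. Thus dilations of Fourier transforms of arbitrary functions can be computed without side
  conditions.\<close>
lemma lborel_integral_affine_euclidean:
  fixes f :: "'a::euclidean_space \<Rightarrow> 'b::{banach, second_countable_topology}"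
  assumes "c \<noteq> 0"
  shows "(LINT x|lborel. f (t + c *\<^sub>R x)) = (LINT x|lborel. f x) /\<^sub>R \<bar>c\<bar> ^ DIM('a)"
    and "integrable lborel (\<lambda>x. f (t + c *\<^sub>R x)) \<longleftrightarrow> integrable lborel f"
proof -
  have "(LINT x|lborel. f (t + c *\<^sub>R x)) = (LINT x|lborel. f x) /\<^sub>R \<bar>c\<bar> ^ DIM('a) \<and>
    (integrable lborel (\<lambda>x. f (t + c *\<^sub>R x)) \<longleftrightarrow> integrable lborel f)"
  proof (cases "f \<in> borel_measurable borel")
    case True
    note [measurable] = True
    let ?D = "density (distr lborel borel (\<lambda>x. t + c *\<^sub>R x)) (\<lambda>_. ennreal (\<bar>c\<bar> ^ DIM('a)))"
    have eq: "lborel = ?D"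
      using lborel_affine[OF assms, of t] by simp
    have "(LINT x|lborel. f x) = (LINT x|?D. f x)"
      using eq by simp
    also have "\<dots> = \<bar>c\<bar> ^ DIM('a) *\<^sub>R (LINT x|lborel. f (t + c *\<^sub>R x))"
      by (simp add: integral_density integral_distr)
    finally have 1: "(LINT x|lborel. f x) = \<bar>c\<bar> ^ DIM('a) *\<^sub>R (LINT x|lborel. f (t + c *\<^sub>R x))" .
    have "integrable lborel f \<longleftrightarrow> integrable ?D f"
      using eq by simp
    also have "\<dots> \<longleftrightarrow> integrable lborel (\<lambda>x. f (t + c *\<^sub>R x))"
      using assms integrable_scaleR_right[of "1 / \<bar>c\<bar> ^ DIM('a)" lborel "\<lambda>x. \<bar>c\<bar> ^ DIM('a) *\<^sub>R f (t + c *\<^sub>R x)"]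
      by (auto simp: integrable_density integrable_distr_eq)
    finally show ?thesis using 1 assms by simp
  next
    case False
    have "(\<lambda>x. f (t + c *\<^sub>R x)) \<notin> borel_measurable borel"
    proof
      assume [measurable]: "(\<lambda>x. f (t + c *\<^sub>R x)) \<in> borel_measurable borel"
      have "(\<lambda>y. (\<lambda>x. f (t + c *\<^sub>R x)) ((y - t) /\<^sub>R c)) \<in> borel_measurable borel"
        by measurable
      then show False using False assms by simp
    qed
    then have "\<not> integrable lborel f" "\<not> integrable lborel (\<lambda>x. f (t + c *\<^sub>R x))"
      using False by auto
    then show ?thesis by (simp add: not_integrable_integral_eq)
  qed
  then show "(LINT x|lborel. f (t + c *\<^sub>R x)) = (LINT x|lborel. f x) /\<^sub>R \<bar>c\<bar> ^ DIM('a)"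
    and "integrable lborel (\<lambda>x. f (t + c *\<^sub>R x)) \<longleftrightarrow> integrable lborel f" by auto
qed

lemma lborel_integral_scale:
  fixes f :: "'a::euclidean_space \<Rightarrow> 'b::{banach, second_countable_topology}"
  assumes "0 < l"
  shows "(LINT x|lborel. f (l *\<^sub>R x)) = (LINT x|lborel. f x) /\<^sub>R l ^ DIM('a)"
    and "integrable lborel (\<lambda>x. f (l *\<^sub>R x)) \<longleftrightarrow> integrable lborel f"
  using lborel_integral_affine_euclidean[of l f 0] assms by auto

section \<open>Smooth functions\<close>

text \<open>A coinduction principle for smoothness: a set of functions that is closed under partial derivatives
  consists of smooth functions. The second argument leaves room for derivatives that fall into a larger
  set, for instance by the product rule into the set of sums of elements.\<close>
definition deriv_closed :: "('a::euclidean_space \<Rightarrow> complex) set \<Rightarrow> ('a \<Rightarrow> complex) set \<Rightarrow> bool" where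
  "deriv_closed X Y \<longleftrightarrow> (\<forall>f\<in>X. \<exists>f'. (\<forall>x. (f has_derivative f' x) (at x)) \<and> (\<forall>b\<in>Basis. (\<lambda>x. f' x b) \<in> Y))"

inductive_set sums_of :: "('a \<Rightarrow> complex) set \<Rightarrow> ('a \<Rightarrow> complex) set" for X where
  base: "f \<in> X \<Longrightarrow> f \<in> sums_of X"
| add: "f \<in> sums_of X \<Longrightarrow> g \<in> sums_of X \<Longrightarrow> (\<lambda>x. f x + g x) \<in> sums_of X"

lemma partials_Nil [simp]: "partials [] f = f"
  and partials_Cons [simp]: "partials (b # bs) f = (\<lambda>x. frechet_derivative (partials bs f) (at x) b)"
  and partials_snoc: "partials (bs @ [b]) f = partials bs (\<lambda>x. frechet_derivative f (at x) b)"
  by (simp_all add: partials_def)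

lemma deriv_closed_partials:
  assumes "deriv_closed X X" "f \<in> X" "set bs \<subseteq> Basis"
  shows "partials bs f \<in> X"
  using assms(3)
proof (induction bs)
  case (Cons b bs)
  then have "partials bs f \<in> X" and b: "b \<in> Basis" by auto
  then obtain f' where f': "\<And>x. (partials bs f has_derivative f' x) (at x)"
    "\<And>b. b \<in> Basis \<Longrightarrow> (\<lambda>x. f' x b) \<in> X"
    using assms(1) unfolding deriv_closed_def by metis
  then have "partials (b # bs) f = (\<lambda>x. f' x b)"
    by (simp flip: frechet_derivative_at[OF f'(1)])
  then show ?case using f'(2)[OF b] by simp
qed (use assms in simp)

lemma deriv_closed_imp_smooth:
  assumes "deriv_closed X X" "f \<in> X"
  shows "smooth f"
  using assms deriv_closed_partials[OF assms]
  unfolding smooth_def deriv_closed_def differentiable_def by metis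

lemma deriv_closed_sums_imp_smooth:
  assumes "deriv_closed X (sums_of X)" "f \<in> sums_of X"
  shows "smooth f"
proof (rule deriv_closed_imp_smooth)
  show "f \<in> sums_of X" by fact
  have "\<exists>f'. (\<forall>x. (f has_derivative f' x) (at x)) \<and> (\<forall>b\<in>Basis. (\<lambda>x. f' x b) \<in> sums_of X)"
    if "f \<in> sums_of X" for f
    using that
  proof induction
    case (base f)
    then show ?case using assms(1) by (auto simp: deriv_closed_def)
  next
    case (add f g)
    then obtain f' g' where
      "\<And>x. (f has_derivative f' x) (at x)" "\<And>b. b \<in> Basis \<Longrightarrow> (\<lambda>x. f' x b) \<in> sums_of X"
      "\<And>x. (g has_derivative g' x) (at x)" "\<And>b. b \<in> Basis \<Longrightarrow> (\<lambda>x. g' x b) \<in> sums_of X"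
      by meson
    then show ?case
      by (intro exI[of _ "\<lambda>x v. f' x v + g' x v"])
        (auto intro: has_derivative_add sums_of.add)
  qed
  then show "deriv_closed (sums_of X) (sums_of X)" by (auto simp: deriv_closed_def)
qed

lemma smooth_frechet_derivative:
  assumes "smooth f" "b \<in> Basis"
  shows "smooth (\<lambda>x. frechet_derivative f (at x) b)"
  using assms by (fastforce simp: smooth_def simp flip: partials_snoc)

lemma smooth_has_derivative:
  assumes "smooth f"
  shows "(f has_derivative frechet_derivative f (at x)) (at x)"
  using assms unfolding smooth_def
  by (metis empty_set empty_subsetI frechet_derivative_works partials_Nil)

lemma smooth_continuous: "smooth f \<Longrightarrow> continuous_on UNIV f"
  by (meson continuous_at_imp_continuous_on has_derivative_continuous smooth_has_derivative)

lemma smooth_measurable [measurable_dest]: "smooth f \<Longrightarrow> f \<in> borel_measurable borel"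
  by (intro borel_measurable_continuous_onI smooth_continuous)

lemma smooth_partials: "smooth f \<Longrightarrow> set bs \<subseteq> Basis \<Longrightarrow> smooth (partials bs f)"
  by (induction bs) (auto intro: smooth_frechet_derivative)

lemma smooth_const [intro, simp]: "smooth (\<lambda>x. c)"
  by (rule deriv_closed_imp_smooth[where X = "range (\<lambda>c x. c)"])
    (auto simp: deriv_closed_def intro!: exI[of _ "\<lambda>_ _. 0"])

lemma smooth_add [intro]:
  assumes "smooth f" "smooth g"
  shows "smooth (\<lambda>x. f x + g x)"
proof (rule deriv_closed_sums_imp_smooth)
  show "deriv_closed (Collect smooth) (sums_of (Collect smooth))"
    unfolding deriv_closed_def
    by (auto intro!: exI[of _ "\<lambda>x. frechet_derivative f (at x)" for f] sums_of.base
        intro: smooth_has_derivative smooth_frechet_derivative)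
  show "(\<lambda>x. f x + g x) \<in> sums_of (Collect smooth)"
    using assms by (intro sums_of.add sums_of.base) auto
qed

lemma smooth_mult [intro]:
  fixes f g :: "'a::euclidean_space \<Rightarrow> complex"
  assumes "smooth f" "smooth g"
  shows "smooth (\<lambda>x. f x * g x)"
proof (rule deriv_closed_sums_imp_smooth)
  let ?X = "{\<lambda>x::'a. f x * g x |f g. smooth f \<and> smooth g}"
  show "(\<lambda>x. f x * g x) \<in> sums_of ?X" using assms by (intro sums_of.base) auto
  show "deriv_closed ?X (sums_of ?X)"
    unfolding deriv_closed_def
  proof safe
    fix f g :: "'a \<Rightarrow> complex" assume fg: "smooth f" "smooth g"
    show "\<exists>h'. (\<forall>x. ((\<lambda>x. f x * g x) has_derivative h' x) (at x)) \<and>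
        (\<forall>b\<in>Basis. (\<lambda>x. h' x b) \<in> sums_of ?X)"
    proof (intro exI conjI allI ballI)
      show "((\<lambda>x. f x * g x) has_derivative
        (\<lambda>v. f x * frechet_derivative g (at x) v + frechet_derivative f (at x) v * g x)) (at x)" for x
        by (intro has_derivative_mult smooth_has_derivative fg)
      fix b :: 'a assume "b \<in> Basis"
      then have g': "smooth (\<lambda>x. frechet_derivative g (at x) b)" and f': "smooth (\<lambda>x. frechet_derivative f (at x) b)"
        using fg by (auto intro: smooth_frechet_derivative)
      have X: "(\<lambda>x. h x * k x) \<in> sums_of ?X" if "smooth h" "smooth k" for h k
        using that by (intro sums_of.base) blast
      show "(\<lambda>x. f x * frechet_derivative g (at x) b + frechet_derivative f (at x) b * g x) \<in> sums_of ?X"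
        by (intro sums_of.add X fg f' g')
    qed
  qed
qed

lemma smooth_sum [intro]: "(\<And>i. i \<in> I \<Longrightarrow> smooth (f i)) \<Longrightarrow> smooth (\<lambda>x. \<Sum>i\<in>I. f i x)"
  by (induction I rule: infinite_finite_induct) auto

lemma smooth_inner [intro]: "smooth (\<lambda>x. of_real (x \<bullet> a))"
proof (rule deriv_closed_imp_smooth)
  let ?X = "insert (\<lambda>x. of_real (x \<bullet> a)) (range (\<lambda>c x. c))"
  have "((\<lambda>x. of_real (x \<bullet> a)) has_derivative (\<lambda>v. of_real (v \<bullet> a))) (at x)" for x
    by (intro has_derivative_of_real has_derivative_inner_left has_derivative_ident)
  moreover have "((\<lambda>x. c) has_derivative (\<lambda>v. 0)) (at x)" for c :: complex and x :: 'a
    by simp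
  moreover have "(\<lambda>x. of_real (b \<bullet> a)) \<in> ?X" for b by blast
  moreover have "(\<lambda>x. 0) \<in> ?X" by blast
  ultimately show "deriv_closed ?X ?X"
    unfolding deriv_closed_def
    by (intro ballI) (erule insertE; (erule imageE)?; hypsubst; fast)
qed auto

lemma norm_power2_eq_sum: "of_real ((norm k)\<^sup>2) = (\<Sum>b\<in>Basis. of_real (k \<bullet> b) * of_real (k \<bullet> b) :: complex)"
  by (subst power2_norm_eq_inner, subst euclidean_inner) simp

text \<open>The plane wave with frequency \<open>y\<close>; by symmetry, also the Fourier kernel.\<close>
definition character :: "'a::euclidean_space \<Rightarrow> 'a \<Rightarrow> complex" where
  "character y k = exp (\<i> * of_real (k \<bullet> y))"

lemma norm_character [simp]: "norm (character y k) = 1"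
  by (simp add: character_def)

lemma has_derivative_character:
  "(character y has_derivative (\<lambda>v. character y x * (\<i> * of_real (v \<bullet> y)))) (at x)"
proof -
  have "((\<lambda>k. \<i> * of_real (k \<bullet> y)) has_derivative (\<lambda>v. \<i> * of_real (v \<bullet> y))) (at x)"
    by (intro has_derivative_mult_right has_derivative_of_real has_derivative_inner_left has_derivative_ident)
  from DERIV_exp[THEN has_field_derivative_imp_has_derivative, THEN has_derivative_compose[OF this]]
  show ?thesis by (simp add: character_def[abs_def])
qed

lemma smooth_character [intro]: "smooth (character y)"
proof (rule deriv_closed_imp_smooth)
  let ?X = "range (\<lambda>c k. c * character y k)"
  show "character y \<in> ?X" by (rule image_eqI[of _ _ 1]) auto
  show "deriv_closed ?X ?X"
    unfolding deriv_closed_def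
  proof safe
    fix c
    show "\<exists>f'. (\<forall>x. ((\<lambda>k. c * character y k) has_derivative f' x) (at x)) \<and> (\<forall>b\<in>Basis. (\<lambda>x. f' x b) \<in> ?X)"
    proof (intro exI conjI allI ballI)
      show "((\<lambda>k. c * character y k) has_derivative (\<lambda>v. (c * \<i> * of_real (v \<bullet> y)) * character y x)) (at x)" for x
        by (rule has_derivative_eq_rhs[OF has_derivative_mult_right[OF has_derivative_character]])
          (auto simp: algebra_simps)
      show "(\<lambda>x. (c * \<i> * of_real (b \<bullet> y)) * character y x) \<in> ?X" for b by auto
    qed
  qed
qed

text \<open>Quotients with powers of \<open>g\<close> in the denominator are closed under differentiation, quotients by \<open>g\<close>
  itself are not.\<close>
lemma smooth_divide [intro]:
  assumes "smooth f" "smooth g" and nz: "\<And>x. g x \<noteq> 0"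
  shows "smooth (\<lambda>x. f x / g x)"
proof (rule deriv_closed_imp_smooth)
  let ?X = "{\<lambda>x. f x / g x ^ m |f m. smooth f}"
  show "(\<lambda>x. f x / g x) \<in> ?X"
    using assms(1) by (auto intro!: exI[of _ f] exI[of _ 1])
  show "deriv_closed ?X ?X"
    unfolding deriv_closed_def
  proof safe
    fix f :: "'a \<Rightarrow> complex" and m assume f: "smooth f"
    let ?f' = "\<lambda>x. frechet_derivative f (at x)" and ?g' = "\<lambda>x. frechet_derivative g (at x)"
    show "\<exists>h'. (\<forall>x. ((\<lambda>x. f x / g x ^ m) has_derivative h' x) (at x)) \<and> (\<forall>b\<in>Basis. (\<lambda>x. h' x b) \<in> ?X)"
    proof (intro exI conjI allI ballI)
      fix x
      have "g x ^ m = g x ^ (m - 1) * g x" if "m \<noteq> 0"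
        using that by (metis mult.commute power_eq_if)
      then show "((\<lambda>x. f x / g x ^ m) has_derivative
          (\<lambda>v. (?f' x v * g x + (- of_nat m) * (f x * ?g' x v)) / g x ^ Suc m)) (at x)"
        using nz[of x]
        by (cases "m = 0")
          (auto intro!: derivative_eq_intros smooth_has_derivative[OF f] smooth_has_derivative[OF assms(2)]
            simp: field_simps)
    next
      fix b :: 'a assume "b \<in> Basis"
      then show "(\<lambda>x. (?f' x b * g x + (- of_nat m) * (f x * ?g' x b)) / g x ^ Suc m) \<in> ?X"
        using f assms(2)
        by (intro CollectI exI[of _ "Suc m"] exI[of _ "\<lambda>x. ?f' x b * g x + (- of_nat m) * (f x * ?g' x b)"])
          (intro conjI refl smooth_add smooth_mult smooth_frechet_derivative smooth_const)
    qed
  qed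
qed

text \<open>The functions \<open>u\<^sup>-\<^sup>m exp (-1/u)\<close>, extended by \<open>0\<close> to \<open>u \<le> 0\<close>: linear combinations of them are closed
  under differentiation, so that all members are smooth and flat at \<open>0\<close>.\<close>
definition flat_exp :: "nat \<Rightarrow> real \<Rightarrow> real" where
  "flat_exp m u = (if u \<le> 0 then 0 else exp (- (1 / u)) / u ^ m)"

lemma flat_exp_tendsto_0: "((\<lambda>u. exp (- (1 / u)) / u ^ m) \<longlongrightarrow> (0::real)) (at_right 0)"
proof -
  have "((\<lambda>u::real. inverse u ^ m / exp (inverse u)) \<longlongrightarrow> 0) (at_right 0)"
    by (rule filterlim_compose[OF tendsto_power_div_exp_0 filterlim_inverse_at_top_right])
  then show ?thesis
    by (simp add: exp_minus field_simps power_inverse)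
qed

lemma DERIV_flat_exp:
  "(flat_exp m has_real_derivative flat_exp (m + 2) u - real m * flat_exp (m + 1) u) (at u)"
proof -
  consider "u < 0" | "u = 0" | "0 < u" by linarith
  then show ?thesis
  proof cases
    case 1
    have "((\<lambda>_. 0) has_real_derivative 0) (at u)" by simp
    then have "(flat_exp m has_real_derivative 0) (at u)"
      by (rule has_field_derivative_transform_within_open[where S = "{..<0}"])
        (use 1 in \<open>auto simp: flat_exp_def\<close>)
    then show ?thesis using 1 by (simp add: flat_exp_def)
  next
    case 2
    have "((\<lambda>h. flat_exp m h / h) \<longlongrightarrow> 0) (at_right 0)"
    proof (rule Lim_transform_eventually)
      show "((\<lambda>u. exp (- (1 / u)) / u ^ Suc m) \<longlongrightarrow> (0::real)) (at_right 0)"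
        by (rule flat_exp_tendsto_0)
      show "\<forall>\<^sub>F h in at_right 0. exp (- (1 / h)) / h ^ Suc m = flat_exp m h / h"
        by (auto simp: eventually_at_filter flat_exp_def field_simps)
    qed
    moreover have "((\<lambda>h. flat_exp m h / h) \<longlongrightarrow> 0) (at_left 0)"
      by (rule tendsto_eventually) (auto simp: eventually_at_filter flat_exp_def)
    ultimately have "((\<lambda>h. flat_exp m h / h) \<longlongrightarrow> 0) (at 0)"
      by (rule filterlim_split_at_real[rotated])
    then show ?thesis using 2 by (simp add: DERIV_def flat_exp_def)
  next
    case 3
    have "((\<lambda>u. exp (- (1 / u))) has_real_derivative exp (- (1 / u)) / u\<^sup>2) (at u)"
      using 3 by (auto intro!: derivative_eq_intros simp: field_simps power2_eq_square)
    moreover have "((\<lambda>u. u ^ m) has_real_derivative real m * u ^ (m - 1)) (at u)"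
      by (auto intro!: derivative_eq_intros)
    ultimately have "((\<lambda>u. exp (- (1 / u)) / u ^ m) has_real_derivative
        (exp (- (1 / u)) / u\<^sup>2 * u ^ m - exp (- (1 / u)) * (real m * u ^ (m - 1))) / (u ^ m * u ^ m)) (at u)"
      using 3 by (intro DERIV_divide) auto
    also have "(exp (- (1 / u)) / u\<^sup>2 * u ^ m - exp (- (1 / u)) * (real m * u ^ (m - 1))) / (u ^ m * u ^ m)
        = flat_exp (m + 2) u - real m * flat_exp (m + 1) u"
      using 3 by (cases m) (auto simp: flat_exp_def field_simps power2_eq_square)
    finally have "((\<lambda>u. exp (- (1 / u)) / u ^ m) has_real_derivative
        flat_exp (m + 2) u - real m * flat_exp (m + 1) u) (at u)" .
    then show ?thesis
      by (rule has_field_derivative_transform_within_open[where S = "{0<..}"])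
        (use 3 in \<open>auto simp: flat_exp_def\<close>)
  qed
qed

lemma smooth_flat_exp_norm:
  fixes c \<sigma> :: real
  shows "smooth (\<lambda>k. of_real (flat_exp m (c + \<sigma> * (norm k)\<^sup>2)))"
proof (rule deriv_closed_sums_imp_smooth)
  let ?w = "\<lambda>k::'a. c + \<sigma> * (norm k)\<^sup>2"
  let ?X = "{\<lambda>k. g k * of_real (flat_exp m (?w k)) |g m. smooth g}"
  show "(\<lambda>k. of_real (flat_exp m (?w k))) \<in> sums_of ?X"
    by (intro sums_of.base CollectI exI[of _ "\<lambda>_. 1"] exI[of _ m]) auto
  show "deriv_closed ?X (sums_of ?X)"
    unfolding deriv_closed_def
  proof safe
    fix g :: "'a \<Rightarrow> complex" and m assume g: "smooth g"
    let ?g' = "\<lambda>x. frechet_derivative g (at x)"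
    let ?f' = "\<lambda>x v. ?g' x v * of_real (flat_exp m (?w x)) +
      ((g x * of_real (2 * \<sigma>) * of_real (x \<bullet> v)) * of_real (flat_exp (m + 2) (?w x)) +
       (g x * of_real (- 2 * \<sigma> * real m) * of_real (x \<bullet> v)) * of_real (flat_exp (m + 1) (?w x)))"
    show "\<exists>h'. (\<forall>x. ((\<lambda>k. g k * of_real (flat_exp m (?w k))) has_derivative h' x) (at x)) \<and>
        (\<forall>b\<in>Basis. (\<lambda>x. h' x b) \<in> sums_of ?X)"
    proof (intro exI[of _ ?f'] conjI allI ballI)
      fix x
      have "(?w has_derivative (\<lambda>v. \<sigma> * (2 * (x \<bullet> v)))) (at x)"
        unfolding power2_norm_eq_inner
        by (auto intro!: derivative_eq_intros simp: inner_commute)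
      from DERIV_flat_exp[THEN has_field_derivative_imp_has_derivative, THEN has_derivative_compose[OF this]]
      have "((\<lambda>k. flat_exp m (?w k)) has_derivative
          (\<lambda>v. (flat_exp (m + 2) (?w x) - real m * flat_exp (m + 1) (?w x)) * (\<sigma> * (2 * (x \<bullet> v))))) (at x)" .
      from has_derivative_mult[OF smooth_has_derivative[OF g] has_derivative_of_real[OF this]]
      show "((\<lambda>k. g k * of_real (flat_exp m (?w k))) has_derivative ?f' x) (at x)"
        by (rule has_derivative_eq_rhs) (auto simp: algebra_simps)
    next
      fix b :: 'a assume "b \<in> Basis"
      then have g': "smooth (\<lambda>x. ?g' x b)" using g by (intro smooth_frechet_derivative)
      have g1: "smooth (\<lambda>x. g x * of_real r * of_real (x \<bullet> b))" for r
        using g by (intro smooth_mult smooth_const smooth_inner)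
      have X: "(\<lambda>x. h x * of_real (flat_exp l (?w x))) \<in> sums_of ?X" if "smooth h" for h l
        using that by (intro sums_of.base) blast
      show "(\<lambda>x. ?f' x b) \<in> sums_of ?X"
        by (intro sums_of.add X g' g1)
    qed
  qed
qed

lemma frechet_derivative_eq_0_open:
  assumes "open S" "x \<in> S" "\<And>y. y \<in> S \<Longrightarrow> f y = 0"
  shows "(f has_derivative (\<lambda>_. 0)) (at x)" "frechet_derivative f (at x) = (\<lambda>_. 0)"
proof -
  show 1: "(f has_derivative (\<lambda>_. 0)) (at x)"
    by (rule has_derivative_transform_within_open[of "\<lambda>_. 0" _ x UNIV S]) (use assms in auto)
  show "frechet_derivative f (at x) = (\<lambda>_. 0)"
    using frechet_derivative_at[OF 1] by simp
qed

text \<open>Although \<open>|k|\<^sup>s\<close> is singular at the origin, its product with a function that vanishes near the origin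
  is smooth. This is what makes \<open>D\<^sup>s\<close> invertible on the relevant test functions.\<close>
lemma smooth_norm_powr_mult:
  fixes g :: "'a::euclidean_space \<Rightarrow> complex"
  assumes "smooth g" "0 < a" "\<And>k. norm k < a \<Longrightarrow> g k = 0"
  shows "smooth (\<lambda>k. of_real (norm k powr s) * g k)"
proof (rule deriv_closed_sums_imp_smooth)
  let ?X = "{\<lambda>k::'a. of_real (norm k powr s) * g k |g s. smooth g \<and> (\<forall>k. norm k < a \<longrightarrow> g k = 0)}"
  show "(\<lambda>k. of_real (norm k powr s) * g k) \<in> sums_of ?X"
    using assms by (intro sums_of.base) blast
  show "deriv_closed ?X (sums_of ?X)"
    unfolding deriv_closed_def
  proof
    fix h :: "'a \<Rightarrow> complex" assume "h \<in> ?X"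
    then obtain g s where h: "h = (\<lambda>k. of_real (norm k powr s) * g k)" and g: "smooth g"
      and g0: "\<forall>k. norm k < a \<longrightarrow> g k = 0" by auto
    let ?g' = "\<lambda>x. frechet_derivative g (at x)"
    let ?f' = "\<lambda>x v. of_real (norm x powr s) * ?g' x v +
      of_real (norm x powr (s - 2)) * (of_real s * of_real (x \<bullet> v) * g x)"
    have g'0: "?g' x v = 0" if "norm x < a" for x v
      using frechet_derivative_eq_0_open(2)[of "ball 0 a" x g] that g0 by auto
    show "\<exists>h'. (\<forall>x. (h has_derivative h' x) (at x)) \<and> (\<forall>b\<in>Basis. (\<lambda>x. h' x b) \<in> sums_of ?X)"
      unfolding h
    proof (intro exI[of _ ?f'] conjI allI ballI)
      fix x
      show "((\<lambda>k. of_real (norm k powr s) * g k) has_derivative ?f' x) (at x)"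
      proof (cases "norm x < a")
        case True
        then have "?f' x = (\<lambda>_. 0)" using g0 g'0 by auto
        then show ?thesis
          using frechet_derivative_eq_0_open(1)[of "ball 0 a" x "\<lambda>k. of_real (norm k powr s) * g k"]
            True g0 by auto
      next
        case False
        then have x: "x \<noteq> 0" using assms(2) by auto
        have "((\<lambda>k. norm k powr s) has_derivative (\<lambda>v. norm x powr (s - 2) * (s * (x \<bullet> v)))) (at x)"
          by (rule derivative_eq_intros has_derivative_norm[THEN has_derivative_eq_rhs] refl x)+
            (use x in \<open>auto simp: sgn_div_norm inner_commute powr_diff power2_eq_square field_simps\<close>)
        from has_derivative_mult[OF has_derivative_of_real[OF this] smooth_has_derivative[OF g]]
        show ?thesis
          by (rule has_derivative_eq_rhs) (auto simp: algebra_simps)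
      qed
    next
      fix b :: 'a assume b: "b \<in> Basis"
      have s: "smooth (\<lambda>x. ?g' x b)" "smooth (\<lambda>x. of_real s * of_real (x \<bullet> b) * g x)"
        using g b by (auto intro!: smooth_frechet_derivative smooth_mult)
      have X: "(\<lambda>k. of_real (norm k powr s) * g k) \<in> sums_of ?X"
        if "smooth g" "\<And>k. norm k < a \<Longrightarrow> g k = 0" for g s
        using that by (intro sums_of.base) blast
      show "(\<lambda>x. ?f' x b) \<in> sums_of ?X"
        using s g0 g'0 by (intro sums_of.add X) auto
    qed
  qed
qed

section \<open>Test functions\<close>

definition test_functions :: "('a::euclidean_space \<Rightarrow> complex) set" where
  "test_functions = {f. smooth f \<and> (\<exists>R. \<forall>x. R \<le> norm x \<longrightarrow> f x = 0)}"

lemma test_functions_smooth: "f \<in> test_functions \<Longrightarrow> smooth f"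
  by (simp add: test_functions_def)

lemma test_functions_mult: "smooth g \<Longrightarrow> f \<in> test_functions \<Longrightarrow> (\<lambda>x. g x * f x) \<in> test_functions"
  unfolding test_functions_def by (auto simp: smooth_mult)

lemma test_functions_add:
  assumes "f \<in> test_functions" "g \<in> test_functions"
  shows "(\<lambda>x. f x + g x) \<in> test_functions"
proof -
  obtain R Q where "smooth f" "smooth g"
    "\<forall>x. R \<le> norm x \<longrightarrow> f x = 0" "\<forall>x. Q \<le> norm x \<longrightarrow> g x = 0"
    using assms by (auto simp: test_functions_def)
  then show ?thesis
    unfolding test_functions_def by (auto intro!: exI[of _ "max R Q"] smooth_add)
qed

lemma test_functions_deriv:
  assumes "f \<in> test_functions" "b \<in> Basis"
  shows "(\<lambda>x. frechet_derivative f (at x) b) \<in> test_functions"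
proof -
  obtain R where "smooth f" and R: "\<forall>x. R \<le> norm x \<longrightarrow> f x = 0"
    using assms by (auto simp: test_functions_def)
  have "frechet_derivative f (at x) b = 0" if "R + 1 \<le> norm x" for x
  proof -
    have "open {x::'a. R < norm x}" by (intro open_Collect_less continuous_intros)
    then show ?thesis
      using frechet_derivative_eq_0_open(2)[of "{x. R < norm x}" x f] that R by auto
  qed
  then show ?thesis
    using \<open>smooth f\<close> assms(2) by (auto simp: test_functions_def intro: smooth_frechet_derivative)
qed

lemma test_functions_norm_powr:
  assumes "f \<in> test_functions" "0 < a" "\<And>k. norm k < a \<Longrightarrow> f k = 0"
  shows "(\<lambda>k. of_real (norm k powr s) * f k) \<in> test_functions"
  using assms smooth_norm_powr_mult[of f a s] by (auto simp: test_functions_def)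

lemma partials_rescale:
  assumes "smooth f" "set bs \<subseteq> Basis"
  shows "partials bs (rescale l f) x = of_real l ^ length bs * partials bs f (l *\<^sub>R x)"
  using assms(2)
proof (induction bs arbitrary: x)
  case (Cons b bs)
  let ?g = "partials bs f"
  have g: "smooth ?g" using Cons.prems assms(1) by (intro smooth_partials) auto
  note der = smooth_has_derivative[OF g]
  have "((\<lambda>x. of_real l ^ length bs * ?g (l *\<^sub>R x)) has_derivative
      (\<lambda>v. of_real l ^ length bs * frechet_derivative ?g (at (l *\<^sub>R x)) (l *\<^sub>R v))) (at x)"
    by (intro has_derivative_mult_right has_derivative_compose[OF _ der] has_derivative_scaleR_right
        has_derivative_ident)
  moreover have "partials bs (rescale l f) = (\<lambda>x. of_real l ^ length bs * ?g (l *\<^sub>R x))"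
    using Cons by auto
  ultimately have "frechet_derivative (partials bs (rescale l f)) (at x) b =
      of_real l ^ length bs * frechet_derivative ?g (at (l *\<^sub>R x)) (l *\<^sub>R b)"
    by (metis frechet_derivative_at)
  also have "frechet_derivative ?g (at (l *\<^sub>R x)) (l *\<^sub>R b) = l *\<^sub>R frechet_derivative ?g (at (l *\<^sub>R x)) b"
    using der has_derivative_linear linear_cmul by blast
  finally show ?case by (simp add: scaleR_conv_of_real)
qed (simp add: rescale_def)

lemma smooth_rescale:
  assumes "smooth f"
  shows "smooth (rescale l f)"
  unfolding smooth_def
proof (intro allI impI)
  fix bs :: "'a list" and x :: 'a assume bs: "set bs \<subseteq> Basis"
  let ?g = "partials bs f"
  have "partials bs (rescale l f) = (\<lambda>x. of_real l ^ length bs * ?g (l *\<^sub>R x))"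
    using partials_rescale[OF assms bs] by auto
  moreover have "((\<lambda>x. of_real l ^ length bs * ?g (l *\<^sub>R x)) has_derivative
      (\<lambda>v. of_real l ^ length bs * frechet_derivative ?g (at (l *\<^sub>R x)) (l *\<^sub>R v))) (at x)"
    using smooth_partials[OF assms bs]
    by (intro has_derivative_mult_right has_derivative_compose[OF _ smooth_has_derivative]
        has_derivative_scaleR_right has_derivative_ident)
  ultimately show "partials bs (rescale l f) differentiable at x"
    by (auto simp: differentiable_def)
qed

lemma test_functions_rescale:
  assumes "f \<in> test_functions" "0 < l"
  shows "rescale l f \<in> test_functions"
proof -
  obtain R where "smooth f" and R: "\<forall>x. R \<le> norm x \<longrightarrow> f x = 0"
    using assms by (auto simp: test_functions_def)
  then show ?thesis
    using assms(2) unfolding test_functions_def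
    by (auto intro!: smooth_rescale exI[of _ "R / l"] simp: rescale_def field_simps)
qed

text \<open>A quotient \<open>u / (u + v)\<close> of flat functions, where \<open>u\<close> is positive for \<open>|k|\<^sup>2 < 2\<close> only and \<open>v\<close> for
  \<open>|k|\<^sup>2 > 1\<close> only.\<close>
definition cutoff :: "'a::euclidean_space \<Rightarrow> complex" where
  "cutoff k = of_real (flat_exp 0 (2 + (- 1) * (norm k)\<^sup>2)) /
     (of_real (flat_exp 0 (2 + (- 1) * (norm k)\<^sup>2)) + of_real (flat_exp 0 (- 1 + 1 * (norm k)\<^sup>2)))"

lemma cutoff_in_test_functions: "cutoff \<in> test_functions"
proof -
  have pos: "0 < flat_exp 0 (2 + (- 1) * (norm k)\<^sup>2) + flat_exp 0 (- 1 + 1 * (norm k)\<^sup>2)" for k :: 'a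
    by (auto simp: flat_exp_def add_pos_pos)
  have "smooth (cutoff :: 'a \<Rightarrow> complex)"
    unfolding cutoff_def
    by (intro smooth_divide smooth_add smooth_flat_exp_norm) (metis pos less_irrefl of_real_add of_real_eq_0_iff)
  moreover have "cutoff k = 0" if "2 \<le> norm k" for k :: 'a
  proof -
    have "2 * 2 \<le> norm k * norm k" using that by (intro mult_mono) auto
    then show ?thesis by (auto simp: cutoff_def flat_exp_def power2_eq_square)
  qed
  ultimately show ?thesis by (auto simp: test_functions_def)
qed

lemma cutoff_eq_1: "norm k \<le> 1 \<Longrightarrow> cutoff k = 1"
  using power_le_one[of "norm k" 2] by (auto simp: cutoff_def flat_exp_def)

section \<open>The Fourier transform of a test function\<close>

text \<open>The transform with kernel \<open>exp (i k x)\<close> and without the factor \<open>(2\<pi>)\<^sup>-\<^sup>d\<^sup>/\<^sup>2\<close>: the transforms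
  \<open>fourier\<close> and \<open>inv_fourier\<close> are both obtained from it.\<close>
definition ft :: "('a::euclidean_space \<Rightarrow> complex) \<Rightarrow> 'a \<Rightarrow> complex" where
  "ft f x = (LINT k|lborel. character x k * f k)"

lemma character_measurable [measurable]: "character y \<in> borel_measurable borel"
  by (intro smooth_measurable smooth_character)

lemma character_commute: "character y k = character k y"
  by (simp add: character_def inner_commute)

lemma character_add: "character (y + z) k = character y k * character z k"
  by (simp add: character_def inner_add_right distrib_left exp_add)

lemma character_0 [simp]: "character 0 k = 1"
  by (simp add: character_def)

lemma norm_ft_le: "norm (ft f x) \<le> (LINT k|lborel. norm (f k))"
  unfolding ft_def using integral_norm_bound[of lborel "\<lambda>k. character x k * f k"]
  by (simp add: norm_mult)

lemma test_functions_integrable: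
  assumes "f \<in> test_functions"
  shows "integrable lborel f"
proof -
  obtain R where f: "smooth f" and R: "\<forall>x. R \<le> norm x \<longrightarrow> f x = 0"
    using assms by (auto simp: test_functions_def)
  have "integrable lborel (\<lambda>x. indicator (cball 0 R) x *\<^sub>R f x)"
    using smooth_continuous[OF f] by (intro borel_integrable_compact) (auto intro: continuous_on_subset)
  also have "(\<lambda>x. indicator (cball 0 R) x *\<^sub>R f x) = f"
    using R by (auto simp: indicator_def)
  finally show ?thesis .
qed

lemma test_functions_bounded:
  assumes "f \<in> test_functions"
  obtains M where "\<And>x. norm (f x) \<le> M" "0 \<le> M"
proof -
  obtain R where f: "smooth f" and R: "\<forall>x. R \<le> norm x \<longrightarrow> f x = 0"
    using assms by (auto simp: test_functions_def)
  have "bounded (f ` cball 0 R)"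
    using smooth_continuous[OF f]
    by (intro compact_imp_bounded compact_continuous_image) (auto intro: continuous_on_subset)
  then obtain M where "\<forall>y\<in>f ` cball 0 R. norm y \<le> M"
    unfolding bounded_iff by blast
  then have M: "norm (f x) \<le> M" if "norm x \<le> R" for x
    using that by simp
  have "norm (f x) \<le> max M 0" for x
    using M[of x] R by (cases "norm x \<le> R") (auto simp: le_max_iff_disj)
  then show ?thesis using that[of "max M 0"] by auto
qed

lemma integrable_character_mult:
  "integrable lborel f \<Longrightarrow> integrable lborel (\<lambda>k. character y k * f k)"
  by (rule Bochner_Integration.integrable_bound[where f = f]) (auto simp: norm_mult)

lemma test_functions_integrable_norm_mult:
  assumes "f \<in> test_functions"
  shows "integrable lborel (\<lambda>k. norm k ^ m * norm (f k))"
proof -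
  obtain R where f: "smooth f" and R: "\<forall>x. R \<le> norm x \<longrightarrow> f x = 0"
    using assms by (auto simp: test_functions_def)
  note [measurable] = smooth_measurable[OF f]
  have le: "norm k ^ m * norm (f k) \<le> \<bar>R\<bar> ^ m * norm (f k)" for k
    using R by (cases "R \<le> norm k") (auto intro!: mult_right_mono power_mono)
  show ?thesis
    by (rule Bochner_Integration.integrable_bound[where f = "\<lambda>k. \<bar>R\<bar> ^ m * norm (f k)"])
      (use le test_functions_integrable[OF assms] in \<open>auto simp: abs_mult intro: order_trans[OF le]\<close>)
qed

text \<open>Differentiation under the integral sign; the remainder is quadratic in the increment, uniformly in
  the point, by Taylor's formula for the exponential, since \<open>|k|\<^sup>2 f\<close> is integrable.\<close>
lemma ft_has_derivative:
  fixes f :: "'a::euclidean_space \<Rightarrow> complex"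
  assumes "f \<in> test_functions"
  shows "(ft f has_derivative (\<lambda>v. ft (\<lambda>k. \<i> * of_real (k \<bullet> v) * f k) x)) (at x)"
proof -
  let ?L = "\<lambda>v. ft (\<lambda>k. \<i> * of_real (k \<bullet> v) * f k) x"
  note [measurable] = smooth_measurable[OF test_functions_smooth[OF assms]]
  note int1 = test_functions_integrable_norm_mult[OF assms, of 1]
  note int2 = test_functions_integrable_norm_mult[OF assms, of 2]
  have CS: "\<bar>k \<bullet> v\<bar> * norm (f k) \<le> norm v * (norm k * norm (f k))" for k v
    using mult_right_mono[OF Cauchy_Schwarz_ineq2[of k v], of "norm (f k)"] by (simp add: mult_ac)
  have intL: "integrable lborel (\<lambda>k. character x k * (\<i> * of_real (k \<bullet> v) * f k))" for v
  proof (rule Bochner_Integration.integrable_bound[where f = "\<lambda>k. norm v * (norm k * norm (f k))"])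
    show "integrable lborel (\<lambda>k. norm v * (norm k * norm (f k)))" using int1 by simp
    show "AE k in lborel. norm (character x k * (\<i> * of_real (k \<bullet> v) * f k)) \<le> norm (norm v * (norm k * norm (f k)))"
      using CS by (auto simp: norm_mult abs_mult)
  qed measurable
  have lin: "bounded_linear ?L"
  proof (rule bounded_linear_intro[where K = "LINT k|lborel. norm k * norm (f k)"])
    fix u v :: 'a
    show "?L (u + v) = ?L u + ?L v"
      unfolding ft_def using intL
      by (subst Bochner_Integration.integral_add[symmetric]) (auto simp: inner_add_right algebra_simps)
    fix r :: real
    show "?L (r *\<^sub>R u) = r *\<^sub>R ?L u"
      unfolding ft_def by (subst integral_scaleR_right[symmetric])
        (auto simp: scaleR_conv_of_real algebra_simps)
    have "norm (?L u) \<le> (LINT k|lborel. norm (\<i> * of_real (k \<bullet> u) * f k))"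
      by (rule norm_ft_le)
    also have "\<dots> \<le> (LINT k|lborel. norm u * (norm k * norm (f k)))"
    proof (rule integral_mono)
      show "integrable lborel (\<lambda>k. norm u * (norm k * norm (f k)))" using int1 by simp
      show "integrable lborel (\<lambda>k. norm (\<i> * of_real (k \<bullet> u) * f k))"
        using integrable_norm[OF intL[of u]] by (simp add: norm_mult)
      show "norm (\<i> * of_real (k \<bullet> u) * f k) \<le> norm u * (norm k * norm (f k))" for k
        using CS by (auto simp: norm_mult)
    qed
    finally show "norm (?L u) \<le> norm u * (LINT k|lborel. norm k * norm (f k))" by simp
  qed
  define C where "C = (LINT k|lborel. norm k ^ 2 * norm (f k)) / 2"
  have C0: "0 \<le> C" unfolding C_def by simp
  have bound: "norm (ft f y - ft f x - ?L (y - x)) \<le> C * norm (y - x) ^ 2" for y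
  proof -
    have eq: "ft f y - ft f x - ?L (y - x)
        = (LINT k|lborel. character x k * (character (y - x) k - 1 - \<i> * of_real (k \<bullet> (y - x))) * f k)"
      unfolding ft_def
      using integrable_character_mult[OF test_functions_integrable[OF assms]] intL
      by (subst Bochner_Integration.integral_diff[symmetric], simp, simp,
          subst Bochner_Integration.integral_diff[symmetric], simp, simp)
        (auto simp: algebra_simps simp flip: character_add intro!: Bochner_Integration.integral_cong)
    have "norm (LINT k|lborel. character x k * (character (y - x) k - 1 - \<i> * of_real (k \<bullet> (y - x))) * f k)
       \<le> (LINT k|lborel. norm (y - x) ^ 2 / 2 * (norm k ^ 2 * norm (f k)))"
    proof (intro order_trans[OF integral_norm_bound] integral_mono integrable_norm)
      show "integrable lborel (\<lambda>k. norm (y - x) ^ 2 / 2 * (norm k ^ 2 * norm (f k)))"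
        using int2 by simp
      have le: "norm (character x k * (character (y - x) k - 1 - \<i> * of_real (k \<bullet> (y - x))) * f k)
          \<le> norm (y - x) ^ 2 / 2 * (norm k ^ 2 * norm (f k))" for k
      proof -
        have "norm (character (y - x) k - 1 - \<i> * of_real (k \<bullet> (y - x))) \<le> \<bar>k \<bullet> (y - x)\<bar> ^ 2 / 2"
          using iexp_approx1[of "k \<bullet> (y - x)" 1]
          by (simp add: character_def power2_eq_square diff_diff_eq)
        also have "\<dots> \<le> (norm k * norm (y - x)) ^ 2 / 2"
          using Cauchy_Schwarz_ineq2[of k "y - x"] by (intro divide_right_mono power_mono) auto
        finally show ?thesis
          by (auto simp: norm_mult power_mult_distrib mult_ac dest: mult_right_mono[where c = "norm (f k)"])
      qed
      then show "norm (character x k * (character (y - x) k - 1 - \<i> * of_real (k \<bullet> (y - x))) * f k)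
          \<le> norm (y - x) ^ 2 / 2 * (norm k ^ 2 * norm (f k))" for k .
      show "integrable lborel (\<lambda>k. character x k * (character (y - x) k - 1 - \<i> * of_real (k \<bullet> (y - x))) * f k)"
        by (rule Bochner_Integration.integrable_bound[where f = "\<lambda>k. norm (y - x) ^ 2 / 2 * (norm k ^ 2 * norm (f k))"])
          (use int2 le in \<open>auto simp: abs_mult\<close>)
    qed
    then show ?thesis unfolding eq by (simp add: C_def mult.commute)
  qed
  show ?thesis
    unfolding has_derivative_at_alt
  proof (intro conjI lin allI impI)
    fix e :: real assume e: "0 < e"
    \<comment> \<open>\<open>C + 1\<close> instead of \<open>C\<close>, since \<open>C\<close> may be \<open>0\<close>.\<close>
    show "\<exists>d>0. \<forall>y. norm (y - x) < d \<longrightarrow> norm (ft f y - ft f x - ?L (y - x)) \<le> e * norm (y - x)"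
    proof (intro exI[of _ "e / (C + 1)"] conjI allI impI)
      show "0 < e / (C + 1)" using e C0 by simp
      fix y assume "norm (y - x) < e / (C + 1)"
      then have "(C + 1) * norm (y - x) \<le> e" using C0 by (simp add: field_simps)
      then have "C * norm (y - x) \<le> e"
        by (smt (verit) mult_right_mono norm_ge_zero)
      then have "C * norm (y - x) ^ 2 \<le> e * norm (y - x)"
        by (simp add: power2_eq_square mult_right_mono flip: mult.assoc)
      then show "norm (ft f y - ft f x - ?L (y - x)) \<le> e * norm (y - x)"
        using bound[of y] by linarith
    qed
  qed
qed

text \<open>The difference quotients of \<open>u\<close> in the direction \<open>b\<close> have integral \<open>0\<close> by translation invariance.
  They are bounded, with supports in one ball, and converge to the derivative.\<close>
lemma integral_deriv_test_function:
  fixes u :: "'a::euclidean_space \<Rightarrow> complex"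
  assumes u: "u \<in> test_functions" and b: "b \<in> Basis"
  shows "(LINT k|lborel. frechet_derivative u (at k) b) = 0"
proof -
  let ?u' = "\<lambda>k. frechet_derivative u (at k) b"
  note sm = test_functions_smooth[OF u]
  note [measurable] = smooth_measurable[OF sm]
    smooth_measurable[OF test_functions_smooth[OF test_functions_deriv[OF u b]]]
  \<comment> \<open>\<open>u\<close> and its translates by at most one unit are supported in the ball of radius \<open>R + 1\<close>.\<close>
  obtain R where R: "\<And>x. R \<le> norm x \<Longrightarrow> u x = 0"
    using u by (auto simp: test_functions_def)
  obtain M where M: "\<And>x. norm (?u' x) \<le> M" "0 \<le> M"
    using test_functions_bounded[OF test_functions_deriv[OF u b]] by blast
  define q where "q n k = of_real (real (Suc n)) * (u (k + (1 / real (Suc n)) *\<^sub>R b) - u k)" for n :: nat and k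
  have line: "((\<lambda>s. u (k + s *\<^sub>R b)) has_derivative (\<lambda>h. h *\<^sub>R ?u' (k + s *\<^sub>R b))) (at s)" for k s
  proof -
    have "((\<lambda>s. k + s *\<^sub>R b) has_derivative (\<lambda>h. h *\<^sub>R b)) (at s)"
      by (auto intro!: derivative_eq_intros)
    from has_derivative_compose[OF this smooth_has_derivative[OF sm]]
    show ?thesis
      by (rule has_derivative_eq_rhs)
        (simp add: linear_cmul[OF has_derivative_linear[OF smooth_has_derivative[OF sm]]])
  qed
  have qM: "norm (q n k) \<le> M" for n k
  proof -
    have "\<exists>s\<in>{0<..<1 / real (Suc n)}. norm (u (k + (1 / real (Suc n)) *\<^sub>R b) - u (k + 0 *\<^sub>R b))
        \<le> norm ((1 / real (Suc n) - 0) *\<^sub>R ?u' (k + s *\<^sub>R b))"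
      by (rule mvt_general[where f = "\<lambda>s. u (k + s *\<^sub>R b)"])
        (auto intro!: line continuous_at_imp_continuous_on has_derivative_continuous[OF line])
    then obtain s where "norm (u (k + (1 / real (Suc n)) *\<^sub>R b) - u k) \<le> (1 / real (Suc n)) * norm (?u' (k + s *\<^sub>R b))"
      by auto
    also have "\<dots> \<le> (1 / real (Suc n)) * M" by (intro mult_left_mono M) auto
    finally have "real (Suc n) * norm (u (k + (1 / real (Suc n)) *\<^sub>R b) - u k) \<le> real (Suc n) * ((1 / real (Suc n)) * M)"
      by (intro mult_left_mono) auto
    also have "\<dots> = M" by simp
    finally show ?thesis unfolding q_def norm_mult norm_of_real by simp
  qed
  have q0: "q n k = 0" if "R + 1 \<le> norm k" for n k
  proof -
    have "norm ((1 / real (Suc n)) *\<^sub>R b) \<le> 1" using b by simp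
    moreover have "norm k - norm w \<le> norm (k + w)" for w
      using norm_triangle_ineq2[of k "- w"] by simp
    from this[of "(1 / real (Suc n)) *\<^sub>R b"]
    have "norm k - norm ((1 / real (Suc n)) *\<^sub>R b) \<le> norm (k + (1 / real (Suc n)) *\<^sub>R b)" .
    ultimately have "R \<le> norm (k + (1 / real (Suc n)) *\<^sub>R b)" using that by linarith
    then show ?thesis using R that by (simp add: q_def)
  qed
  have "(\<lambda>n. LINT k|lborel. q n k) \<longlonglongrightarrow> (LINT k|lborel. ?u' k)"
  proof (rule integral_dominated_convergence[where w = "\<lambda>k. M * indicator (cball 0 (R + 1)) k"])
    show "integrable lborel (\<lambda>k. M * indicator (cball 0 (R + 1)) k :: real)"
      by (intro integrable_mult_right integrable_real_indicator emeasure_lborel_cball_finite) simp_all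
    show "AE k in lborel. norm (q n k) \<le> M * indicator (cball 0 (R + 1)) k" for n
      using qM q0 by (auto simp: indicator_def)
    show "AE k in lborel. (\<lambda>n. q n k) \<longlonglongrightarrow> ?u' k"
    proof (intro AE_I2)
      fix k
      let ?h = "\<lambda>n. 1 / real (Suc n)"
      have "filterlim ?h (at 0) sequentially"
        using lim_1_over_n[THEN LIMSEQ_Suc] by (auto simp: filterlim_at)
      moreover have "(\<lambda>h. norm (u (k + h *\<^sub>R b) - u k - h *\<^sub>R ?u' k) / norm h) \<midarrow>0\<rightarrow> 0"
        using line[of k 0] by (simp add: has_derivative_at)
      ultimately have "(\<lambda>n. norm (u (k + ?h n *\<^sub>R b) - u k - ?h n *\<^sub>R ?u' k) / norm (?h n)) \<longlonglongrightarrow> 0"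
        by (rule filterlim_compose[rotated])
      moreover have "norm (u (k + ?h n *\<^sub>R b) - u k - ?h n *\<^sub>R ?u' k) / norm (?h n) = norm (q n k - ?u' k)" for n
      proof -
        have "q n k - ?u' k = of_real (real (Suc n)) * (u (k + ?h n *\<^sub>R b) - u k - ?h n *\<^sub>R ?u' k)"
          using of_nat_neq_0[of n, where 'a = complex] unfolding q_def scaleR_conv_of_real right_diff_distrib by simp
        then show ?thesis by (simp only: norm_mult norm_of_real) (simp add: field_simps)
      qed
      ultimately have "(\<lambda>n. norm (q n k - ?u' k)) \<longlonglongrightarrow> 0" by simp
      then show "(\<lambda>n. q n k) \<longlonglongrightarrow> ?u' k"
        by (simp add: tendsto_norm_zero_iff LIM_zero_iff)
    qed
  qed (auto simp: q_def[abs_def])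
  moreover have "(LINT k|lborel. q n k) = 0" for n
  proof -
    have 1: "integrable lborel (\<lambda>k. u (k + (1 / real (Suc n)) *\<^sub>R b))"
      and 2: "(LINT k|lborel. u (k + (1 / real (Suc n)) *\<^sub>R b)) = (LINT k|lborel. u k)"
      using lborel_integral_affine_euclidean[of 1 u "(1 / real (Suc n)) *\<^sub>R b"] test_functions_integrable[OF u]
      by (auto simp: add.commute)
    show ?thesis
      unfolding q_def using 1 2 test_functions_integrable[OF u] by simp
  qed
  ultimately show ?thesis by (simp add: LIMSEQ_const_iff)
qed

text \<open>Integration by parts. It exchanges growth of the transform for derivatives of \<open>f\<close> and is the source
  of the decay of \<open>ft f\<close>.\<close>
lemma inner_mult_ft:
  assumes f: "f \<in> test_functions" and b: "b \<in> Basis"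
  shows "of_real (x \<bullet> b) * ft f x = ft (\<lambda>k. \<i> * frechet_derivative f (at k) b) x"
proof -
  let ?f' = "\<lambda>k. frechet_derivative f (at k) b"
  have u: "(\<lambda>k. character x k * f k) \<in> test_functions"
    using f by (intro test_functions_mult smooth_character)
  have der: "((\<lambda>k. character x k * f k) has_derivative
      (\<lambda>v. character x k * frechet_derivative f (at k) v + character x k * (\<i> * of_real (v \<bullet> x)) * f k)) (at k)" for k
    by (intro has_derivative_mult has_derivative_character smooth_has_derivative test_functions_smooth f)
  have "frechet_derivative (\<lambda>k. character x k * f k) (at k) b
      = character x k * ?f' k + \<i> * of_real (x \<bullet> b) * (character x k * f k)" for k
    using fun_cong[OF frechet_derivative_at[OF der[of k]], of b] by (simp add: inner_commute mult_ac)
  then have "(LINT k|lborel. character x k * ?f' k + \<i> * of_real (x \<bullet> b) * (character x k * f k)) = 0"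
    using integral_deriv_test_function[OF u b] by simp
  then have "ft ?f' x + \<i> * of_real (x \<bullet> b) * ft f x = 0"
    using integrable_character_mult[OF test_functions_integrable[OF test_functions_deriv[OF f b]]]
      integrable_character_mult[OF test_functions_integrable[OF f]]
    by (subst (asm) Bochner_Integration.integral_add) (auto simp: ft_def)
  then have "\<i> * (ft ?f' x + \<i> * of_real (x \<bullet> b) * ft f x) = 0" by simp
  then have "of_real (x \<bullet> b) * ft f x = \<i> * ft ?f' x" by (simp add: algebra_simps)
  also have "\<i> * ft ?f' x = ft (\<lambda>k. \<i> * ?f' k) x"
    unfolding ft_def by (subst integral_mult_right_zero[symmetric]) (simp add: mult_ac)
  finally show ?thesis .
qed

section \<open>Decay of the transforms\<close>

text \<open>Both cases are of interest: for \<open>a > 0\<close> the transforms lie in the Lizorkin space, whereas for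
  \<open>a = 0\<close> all test functions are admitted, so that the closure properties of the two classes of
  transforms can be proved at once.\<close>
definition flat_tests :: "real \<Rightarrow> ('a::euclidean_space \<Rightarrow> complex) set" where
  "flat_tests a = {f \<in> test_functions. \<forall>k. norm k < a \<longrightarrow> f k = 0}"

lemma flat_tests_nonpos: "a \<le> 0 \<Longrightarrow> flat_tests a = test_functions"
  by (auto simp: flat_tests_def dest: order.strict_trans1[OF norm_ge_zero])

lemma flat_tests_mult: "smooth g \<Longrightarrow> f \<in> flat_tests a \<Longrightarrow> (\<lambda>x. g x * f x) \<in> flat_tests a"
  by (auto simp: flat_tests_def intro: test_functions_mult)

lemma flat_tests_add: "f \<in> flat_tests a \<Longrightarrow> g \<in> flat_tests a \<Longrightarrow> (\<lambda>x. f x + g x) \<in> flat_tests a"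
  by (auto simp: flat_tests_def intro: test_functions_add)

lemma flat_tests_deriv:
  assumes "f \<in> flat_tests a" "b \<in> Basis"
  shows "(\<lambda>x. frechet_derivative f (at x) b) \<in> flat_tests a"
  using assms frechet_derivative_eq_0_open(2)[of "ball 0 a" _ f]
  by (auto simp: flat_tests_def intro: test_functions_deriv)

lemma flat_tests_subset: "f \<in> flat_tests a \<Longrightarrow> f \<in> test_functions"
  by (simp add: flat_tests_def)

lemma ft_add:
  assumes "f \<in> test_functions" "g \<in> test_functions"
  shows "ft (\<lambda>k. f k + g k) x = ft f x + ft g x"
  unfolding ft_def
  using integrable_character_mult[OF test_functions_integrable[OF assms(1)]]
    integrable_character_mult[OF test_functions_integrable[OF assms(2)]]
  by (simp add: distrib_left)

lemma deriv_closed_ft_flat_tests: "deriv_closed (ft ` flat_tests a) (ft ` flat_tests a)"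
  unfolding deriv_closed_def
proof safe
  fix f :: "'a \<Rightarrow> complex" assume f: "f \<in> flat_tests a"
  have "(\<lambda>k. (\<i> * of_real (k \<bullet> b)) * f k) \<in> flat_tests a" for b
    using f by (intro flat_tests_mult smooth_mult smooth_const smooth_inner)
  then show "\<exists>f'. (\<forall>x. (ft f has_derivative f' x) (at x)) \<and> (\<forall>b\<in>Basis. (\<lambda>x. f' x b) \<in> ft ` flat_tests a)"
    using ft_has_derivative[OF flat_tests_subset[OF f]]
    by (intro exI[of _ "\<lambda>x v. ft (\<lambda>k. \<i> * of_real (k \<bullet> v) * f k) x"]) blast
qed

lemma ft_flat_tests_inner:
  assumes "g \<in> ft ` flat_tests a" "b \<in> Basis"
  shows "(\<lambda>x. of_real (x \<bullet> b) * g x) \<in> ft ` flat_tests a"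
proof -
  obtain f where f: "f \<in> flat_tests a" "g = ft f" using assms by auto
  have "(\<lambda>x. of_real (x \<bullet> b) * g x) = ft (\<lambda>k. \<i> * frechet_derivative f (at k) b)"
    using inner_mult_ft[OF flat_tests_subset[OF f(1)] assms(2)] f(2) by auto
  moreover have "(\<lambda>k. \<i> * frechet_derivative f (at k) b) \<in> flat_tests a"
    using f assms by (intro flat_tests_mult flat_tests_deriv) auto
  ultimately show ?thesis by auto
qed

lemma ft_flat_tests_add:
  assumes "g \<in> ft ` flat_tests a" "h \<in> ft ` flat_tests a"
  shows "(\<lambda>x. g x + h x) \<in> ft ` flat_tests a"
proof -
  obtain u v where u: "u \<in> flat_tests a" "g = ft u" and v: "v \<in> flat_tests a" "h = ft v" using assms by auto
  then have "(\<lambda>x. g x + h x) = ft (\<lambda>k. u k + v k)"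
    using ft_add flat_tests_subset by fastforce
  then show ?thesis using flat_tests_add[OF u(1) v(1)] by auto
qed

lemma ft_flat_tests_monomial:
  assumes "g \<in> ft ` flat_tests a" "set bs \<subseteq> Basis"
  shows "(\<lambda>x. of_real (prod_list (map (\<lambda>b. x \<bullet> b) bs)) * g x) \<in> ft ` flat_tests a"
  using assms(2)
proof (induction bs)
  case Nil
  then show ?case using assms(1) by simp
next
  case (Cons b bs)
  then show ?case
    using ft_flat_tests_inner[of "\<lambda>x. of_real (prod_list (map (\<lambda>b. x \<bullet> b) bs)) * g x" a b]
    by (simp add: mult.assoc)
qed

lemma ft_flat_tests_sum:
  assumes "finite I" "I \<noteq> {}" "\<And>i. i \<in> I \<Longrightarrow> g i \<in> ft ` flat_tests a"
  shows "(\<lambda>x. \<Sum>i\<in>I. g i x) \<in> ft ` flat_tests a"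
  using assms
proof (induction rule: finite_ne_induct)
  case (insert i I)
  then show ?case using ft_flat_tests_add[of "g i" a "\<lambda>x. \<Sum>i\<in>I. g i x"] by simp
qed simp

lemma ft_flat_tests_norm_power:
  assumes "g \<in> ft ` flat_tests a"
  shows "(\<lambda>x. of_real (norm x ^ (2 * m)) * g x) \<in> ft ` flat_tests a"
proof (induction m)
  case (Suc m)
  let ?g = "\<lambda>x. of_real (norm x ^ (2 * m)) * g x"
  have "(\<lambda>x. \<Sum>b\<in>Basis. of_real (x \<bullet> b) * (of_real (x \<bullet> b) * ?g x)) \<in> ft ` flat_tests a"
    by (intro ft_flat_tests_sum ft_flat_tests_inner Suc) auto
  also have "(\<lambda>x. \<Sum>b\<in>Basis. of_real (x \<bullet> b) * (of_real (x \<bullet> b) * ?g x)) = (\<lambda>x. of_real ((norm x)\<^sup>2) * ?g x)"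
    by (subst norm_power2_eq_sum) (simp only: sum_distrib_right mult.assoc)
  finally show ?case by (simp add: power_add power2_eq_square mult.assoc)
qed (use assms in simp)

lemma ft_test_bounded:
  assumes "g \<in> ft ` flat_tests a"
  obtains C where "\<And>x. norm (g x) \<le> C"
  using assms norm_ft_le by blast

text \<open>Transforms of test functions are bounded, and the set of these transforms is closed under
  derivatives and under multiplication by coordinates.\<close>
lemma ft_in_schwartz:
  assumes "g \<in> ft ` flat_tests a"
  shows "g \<in> schwartz"
  unfolding schwartz_def
proof (intro CollectI conjI allI impI)
  show "smooth g" by (rule deriv_closed_imp_smooth[OF deriv_closed_ft_flat_tests assms])
  fix bs :: "'a list" and m :: nat assume "set bs \<subseteq> Basis"
  then have p: "partials bs g \<in> ft ` flat_tests a"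
    by (rule deriv_closed_partials[OF deriv_closed_ft_flat_tests assms])
  obtain C D where C: "\<And>x. norm (partials bs g x) \<le> C"
    and D: "\<And>x. norm (of_real (norm x ^ (2 * m)) * partials bs g x) \<le> D"
    using ft_test_bounded[OF p] ft_test_bounded[OF ft_flat_tests_norm_power[OF p, of m]] by metis
  have "norm x ^ m * norm (partials bs g x) \<le> C + D" for x
  proof -
    have "norm x ^ m \<le> 1 + norm x ^ (2 * m)"
    proof (cases "norm x \<le> 1")
      case True
      then show ?thesis using power_le_one[of "norm x" m] by (simp add: add_increasing2)
    next
      case False
      then have "norm x ^ m \<le> norm x ^ (2 * m)" by (intro power_increasing) auto
      then show ?thesis by simp
    qed
    then have "norm x ^ m * norm (partials bs g x) \<le> (1 + norm x ^ (2 * m)) * norm (partials bs g x)"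
      by (intro mult_right_mono) auto
    also have "\<dots> \<le> C + D"
      using C[of x] D[of x] by (simp add: norm_mult norm_power distrib_right)
    finally show ?thesis .
  qed
  then show "\<exists>C. \<forall>x. norm x ^ m * norm (partials bs g x) \<le> C" by blast
qed

lemma lborel_prod_of_coordinates:
  fixes f :: "'a::euclidean_space \<Rightarrow> real \<Rightarrow> complex"
  assumes "\<And>b. b \<in> Basis \<Longrightarrow> integrable lborel (f b)"
  shows "integrable lborel (\<lambda>x. \<Prod>b\<in>Basis. f b (x \<bullet> b))"
    and "(LINT x|lborel. (\<Prod>b\<in>Basis. f b (x \<bullet> b))) = (\<Prod>b\<in>Basis. (LINT t|lborel. f b t))"
proof -
  interpret product_sigma_finite "\<lambda>_::'a. lborel :: real measure" ..
  have [measurable]: "\<And>b. b \<in> Basis \<Longrightarrow> f b \<in> borel_measurable borel"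
    using assms by auto
  have eq: "(\<Prod>b\<in>Basis. f b ((\<Sum>c\<in>Basis. g c *\<^sub>R c) \<bullet> b)) = (\<Prod>b\<in>Basis. f b (g b))" for g :: "'a \<Rightarrow> real"
    by (intro prod.cong refl) simp
  have m: "(\<lambda>x::'a. \<Prod>b\<in>Basis. f b (x \<bullet> b)) \<in> borel_measurable borel"
    by (rule borel_measurable_prod) measurable
  show "integrable lborel (\<lambda>x. \<Prod>b\<in>Basis. f b (x \<bullet> b))"
    by (subst lborel_eq, subst integrable_distr_eq)
      (use m in \<open>auto simp: eq intro!: product_integrable_prod assms\<close>)
  show "(LINT x|lborel. (\<Prod>b\<in>Basis. f b (x \<bullet> b))) = (\<Prod>b\<in>Basis. (LINT t|lborel. f b t))"
    by (subst lborel_eq, subst integral_distr)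
      (use m in \<open>auto simp: eq intro!: product_integral_prod assms\<close>)
qed

lemma ft_flat_tests_weight:
  assumes "g \<in> ft ` flat_tests a" "finite B" "B \<subseteq> Basis"
  shows "(\<lambda>x. (\<Prod>b\<in>B. of_real (1 + (x \<bullet> b)\<^sup>2)) * g x) \<in> ft ` flat_tests a"
  using assms(2,3)
proof (induction rule: finite_induct)
  case (insert b B)
  let ?g = "\<lambda>x. (\<Prod>b\<in>B. of_real (1 + (x \<bullet> b)\<^sup>2)) * g x"
  have "(\<lambda>x. ?g x + of_real (x \<bullet> b) * (of_real (x \<bullet> b) * ?g x)) \<in> ft ` flat_tests a"
    using insert by (intro ft_flat_tests_add ft_flat_tests_inner) auto
  also have "(\<lambda>x. ?g x + of_real (x \<bullet> b) * (of_real (x \<bullet> b) * ?g x))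
      = (\<lambda>x. (\<Prod>b\<in>insert b B. of_real (1 + (x \<bullet> b)\<^sup>2)) * g x)"
    using insert by (auto simp: power2_eq_square algebra_simps)
  finally show ?case .
qed (use assms in simp)

text \<open>The product of all \<open>1 + x\<^sub>b\<^sup>2\<close> times the transform is again a transform, hence bounded; and the
  reciprocal of that product is an integrable function of \<open>x\<close>, coordinate by coordinate.\<close>
lemma ft_integrable:
  assumes "g \<in> ft ` flat_tests a"
  shows "integrable lborel g"
proof -
  have [measurable]: "g \<in> borel_measurable borel"
    using deriv_closed_imp_smooth[OF deriv_closed_ft_flat_tests assms] by (rule smooth_measurable)
  obtain C where C: "\<And>x. norm ((\<Prod>b\<in>Basis. of_real (1 + (x \<bullet> b)\<^sup>2)) * g x) \<le> C"
    using ft_test_bounded[OF ft_flat_tests_weight[OF assms finite_Basis order_refl]] by blast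
  have "integrable lborel (\<lambda>t::real. inverse (1 + t\<^sup>2))"
    using integrable_inverse_1_plus_square by (simp add: set_integrable_def)
  then have "integrable lborel (\<lambda>t::real. of_real (inverse (1 + t\<^sup>2)) :: complex)"
    by (rule integrable_of_real)
  from lborel_prod_of_coordinates(1)[OF this]
  have int: "integrable lborel (\<lambda>x::'a. \<Prod>b\<in>Basis. of_real (inverse (1 + (x \<bullet> b)\<^sup>2)) :: complex)" .
  show ?thesis
  proof (rule Bochner_Integration.integrable_bound)
    show "integrable lborel (\<lambda>x::'a. of_real C * (\<Prod>b\<in>Basis. of_real (inverse (1 + (x \<bullet> b)\<^sup>2)) :: complex))"
      using int by simp
    have "norm (g x) \<le> C * (\<Prod>b\<in>Basis. inverse (1 + (x \<bullet> b)\<^sup>2))" for x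
    proof -
      let ?w = "\<Prod>b\<in>Basis. 1 + (x \<bullet> b)\<^sup>2"
      have pos: "0 < ?w" by (intro prod_pos) (auto intro: add_pos_nonneg)
      have "norm ((\<Prod>b\<in>Basis. of_real (1 + (x \<bullet> b)\<^sup>2)) * g x) = ?w * norm (g x)"
        using pos unfolding of_real_prod[symmetric] norm_mult norm_of_real by simp
      then have "norm (g x) \<le> C * inverse ?w"
        using C[of x] pos by (simp add: field_simps)
      then show ?thesis by (simp add: prod_inversef[unfolded o_def])
    qed
    moreover have "norm (of_real C * (\<Prod>b\<in>Basis. of_real (inverse (1 + (x \<bullet> b)\<^sup>2)) :: complex))
        = \<bar>C * (\<Prod>b\<in>Basis. inverse (1 + (x \<bullet> b)\<^sup>2))\<bar>" for x :: 'a
      by (simp only: norm_of_real flip: of_real_prod of_real_mult)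
    ultimately show "AE x in lborel. norm (g x)
        \<le> norm (of_real C * (\<Prod>b\<in>Basis. of_real (inverse (1 + (x \<bullet> b)\<^sup>2)) :: complex))"
      by (smt (verit) AE_I2)
  qed measurable
qed

section \<open>Gaussians and Fourier inversion\<close>

definition gauss :: "'a::euclidean_space \<Rightarrow> complex" where
  "gauss x = of_real (exp (- (norm x)\<^sup>2 / 2))"

lemma gauss_prod: "gauss x = (\<Prod>b\<in>Basis. of_real (exp (- (x \<bullet> b)\<^sup>2 / 2)))"
proof -
  have "- (norm x)\<^sup>2 / 2 = (\<Sum>b\<in>Basis. - (x \<bullet> b)\<^sup>2 / 2)"
    unfolding power2_norm_eq_inner
    by (subst euclidean_inner) (simp add: sum_negf sum_divide_distrib power2_eq_square)
  then show ?thesis by (simp add: gauss_def exp_sum)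
qed

lemma gauss_measurable [measurable]: "gauss \<in> borel_measurable borel"
  unfolding gauss_def by measurable

lemma character_prod: "character y x = (\<Prod>b\<in>Basis. iexp ((y \<bullet> b) * (x \<bullet> b)))"
  unfolding character_def
  by (subst euclidean_inner) (simp add: exp_sum sum_distrib_left mult_ac)

text \<open>The characteristic function of the standard normal distribution, without the normalization.\<close>
lemma gauss_real_transform:
  shows "integrable lborel (\<lambda>x::real. iexp (t * x) * of_real (exp (- x\<^sup>2 / 2)))"
    and "(LINT x|lborel. iexp (t * x) * of_real (exp (- x\<^sup>2 / 2))) = of_real (sqrt (2 * pi) * exp (- t\<^sup>2 / 2))"
proof -
  have eq: "std_normal_density x *\<^sub>R iexp (t * x) = of_real (1 / sqrt (2 * pi)) * (iexp (t * x) * of_real (exp (- x\<^sup>2 / 2)))" for x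
    by (simp add: std_normal_density_def scaleR_conv_of_real)
  have "integrable lborel (\<lambda>x. of_real (std_normal_density x) :: complex)"
    using integrable_normal_density[of 1 0] by (intro integrable_of_real) auto
  then have "integrable lborel (\<lambda>x. iexp (t * x) * of_real (std_normal_density x))"
    by (rule Bochner_Integration.integrable_bound) (auto simp: norm_mult)
  then have "integrable lborel (\<lambda>x. of_real (sqrt (2 * pi)) * (iexp (t * x) * of_real (std_normal_density x)))"
    by simp
  then show "integrable lborel (\<lambda>x::real. iexp (t * x) * of_real (exp (- x\<^sup>2 / 2)))"
    by (rule back_subst[of "integrable lborel"]) (auto simp: std_normal_density_def)
  have "of_real (exp (- t\<^sup>2 / 2)) = (LINT x|std_normal_distribution. iexp (t * x))"
    using fun_cong[OF char_std_normal_distribution, of t] by (simp add: char_def)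
  also have "\<dots> = (LINT x|lborel. std_normal_density x *\<^sub>R iexp (t * x))"
    by (subst integral_density) (auto simp: normal_density_nonneg)
  also have "\<dots> = of_real (1 / sqrt (2 * pi)) * (LINT x|lborel. iexp (t * x) * of_real (exp (- x\<^sup>2 / 2)))"
    unfolding eq by (rule integral_mult_right_zero)
  finally show "(LINT x|lborel. iexp (t * x) * of_real (exp (- x\<^sup>2 / 2))) = of_real (sqrt (2 * pi) * exp (- t\<^sup>2 / 2))"
    by (simp add: field_simps)
qed

lemma gauss_transform:
  shows "integrable lborel (\<lambda>x::'a::euclidean_space. character y x * gauss x)"
    and "(LINT x|lborel. character y x * gauss x) = of_real (sqrt (2 * pi) ^ DIM('a)) * gauss (y::'a)"
proof -
  have eq: "character y x * gauss x = (\<Prod>b\<in>Basis. iexp ((y \<bullet> b) * (x \<bullet> b)) * of_real (exp (- (x \<bullet> b)\<^sup>2 / 2)))" for x :: 'a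
    unfolding character_prod gauss_prod by (simp only: prod.distrib)
  note P = lborel_prod_of_coordinates[where f = "\<lambda>b t. iexp ((y \<bullet> b) * t) * of_real (exp (- t\<^sup>2 / 2))"]
  show "integrable lborel (\<lambda>x::'a. character y x * gauss x)"
    unfolding eq using P(1) gauss_real_transform(1) by blast
  have "(LINT x|lborel. character y x * gauss x) = (\<Prod>b\<in>Basis. of_real (sqrt (2 * pi) * exp (- (y \<bullet> b)\<^sup>2 / 2)))"
    unfolding eq by (subst P(2)[OF gauss_real_transform(1)]) (simp only: gauss_real_transform(2))
  also have "\<dots> = of_real (sqrt (2 * pi) ^ DIM('a)) * gauss y"
    unfolding gauss_prod by (simp only: of_real_mult prod.distrib) simp
  finally show "(LINT x|lborel. character y x * gauss x) = of_real (sqrt (2 * pi) ^ DIM('a)) * gauss (y::'a)" .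
qed

lemma integrable_gauss: "integrable lborel (gauss :: 'a::euclidean_space \<Rightarrow> complex)"
  using gauss_transform(1)[of 0] by simp

lemma integral_gauss: "(LINT x::'a::euclidean_space|lborel. gauss x) = of_real (sqrt (2 * pi) ^ DIM('a))"
  using gauss_transform(2)[of "0::'a"] by (simp add: gauss_def)

lemma lborel_Fubini_dominated:
  fixes K :: "'a::euclidean_space \<Rightarrow> 'b::euclidean_space \<Rightarrow> complex"
  assumes [measurable]: "case_prod K \<in> borel_measurable (lborel \<Otimes>\<^sub>M lborel)"
    and g: "integrable lborel g" and h: "integrable lborel h"
    and le: "\<And>x y. norm (K x y) \<le> norm (g x :: complex) * norm (h y :: complex)"
  shows "(LINT x|lborel. LINT y|lborel. K x y) = (LINT y|lborel. LINT x|lborel. K x y)"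
proof -
  have [measurable]: "g \<in> borel_measurable borel" "h \<in> borel_measurable borel"
    using g h by auto
  have "integrable (lborel \<Otimes>\<^sub>M lborel) (\<lambda>(x, y). norm (g x) * norm (h y))"
    by (rule lborel_pair.Fubini_integrable) (use g h in \<open>auto simp: integrable_norm\<close>)
  then have "integrable (lborel \<Otimes>\<^sub>M lborel) (case_prod K)"
    by (rule Bochner_Integration.integrable_bound) (use le in \<open>auto simp: abs_mult\<close>)
  from lborel_pair.Fubini_integral[OF this] show ?thesis by simp
qed

lemma gauss_transform_scaled:
  fixes y :: "'a::euclidean_space"
  assumes "0 < e"
  shows "(LINT x|lborel. character y x * gauss (e *\<^sub>R x))
     = of_real (sqrt (2 * pi) ^ DIM('a) / e ^ DIM('a)) * gauss (y /\<^sub>R e)"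
proof -
  have "(e *\<^sub>R x) \<bullet> (y /\<^sub>R e) = x \<bullet> y" for x
    using assms by simp
  then have "(LINT x|lborel. character y x * gauss (e *\<^sub>R x))
      = (LINT x|lborel. character (y /\<^sub>R e) (e *\<^sub>R x) * gauss (e *\<^sub>R x))"
    by (simp only: character_def)
  also have "\<dots> = (LINT x|lborel. character (y /\<^sub>R e) x * gauss x) /\<^sub>R e ^ DIM('a)"
    by (rule lborel_integral_scale(1)[OF assms, where f = "\<lambda>x. character (y /\<^sub>R e) x * gauss x"])
  also have "\<dots> = of_real (sqrt (2 * pi) ^ DIM('a) / e ^ DIM('a)) * gauss (y /\<^sub>R e)"
    unfolding gauss_transform(2) by (simp add: scaleR_conv_of_real field_simps)
  finally show ?thesis .
qed

text \<open>The factor \<open>exp (- |\<epsilon> x|\<^sup>2 / 2)\<close> makes the double integral absolutely convergent. After the exchange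
  of integrals, the inner one is the explicit transform of a Gaussian and concentrates at \<open>k\<^sub>0\<close> as
  \<open>\<epsilon> \<rightarrow> 0\<close>.\<close>
lemma ft_inversion:
  fixes f :: "'a::euclidean_space \<Rightarrow> complex"
  assumes int: "integrable lborel f" and cont: "continuous_on UNIV f" and bound: "\<And>k. norm (f k) \<le> M"
    and ftint: "integrable lborel (ft f)"
  shows "(LINT x|lborel. character (- k\<^sub>0) x * ft f x) = of_real ((2 * pi) ^ DIM('a)) * f k\<^sub>0"
proof -
  let ?c = "of_real (sqrt (2 * pi) ^ DIM('a)) :: complex"
  let ?e = "\<lambda>n. 1 / real (Suc n)"
  have [measurable]: "f \<in> borel_measurable borel" using cont by (rule borel_measurable_continuous_onI)
  have [measurable]: "ft f \<in> borel_measurable borel" using ftint by auto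
  have e0: "?e \<longlonglongrightarrow> 0" using lim_1_over_n[THEN LIMSEQ_Suc] by simp
  have gauss_cont: "continuous_on UNIV (gauss :: 'a \<Rightarrow> complex)"
    unfolding gauss_def by (intro continuous_intros) auto
  have gauss_le: "norm (gauss x) \<le> 1" for x :: 'a
    by (simp add: gauss_def)
  have smeared: "(LINT x|lborel. character (- k\<^sub>0) x * gauss (e *\<^sub>R x) * ft f x)
      = ?c * (LINT u|lborel. f (k\<^sub>0 + e *\<^sub>R u) * gauss u)" if e: "0 < e" for e
  proof -
    have intg: "integrable lborel (\<lambda>x::'a. gauss (e *\<^sub>R x))"
      using lborel_integral_scale(2)[OF e, of gauss] integrable_gauss by blast
    have "(LINT x|lborel. character (- k\<^sub>0) x * gauss (e *\<^sub>R x) * ft f x)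
        = (LINT x|lborel. LINT k|lborel. character (- k\<^sub>0) x * gauss (e *\<^sub>R x) * (character x k * f k))"
      unfolding ft_def by simp
    also have "\<dots> = (LINT k|lborel. LINT x|lborel. character (- k\<^sub>0) x * gauss (e *\<^sub>R x) * (character x k * f k))"
    proof (rule lborel_Fubini_dominated[OF _ intg int])
      show "(\<lambda>(x, k). character (- k\<^sub>0) x * gauss (e *\<^sub>R x) * (character x k * f k)) \<in> borel_measurable (lborel \<Otimes>\<^sub>M lborel)"
        unfolding character_def by measurable
    qed (auto simp: norm_mult)
    also have "\<dots> = (LINT k|lborel. f k * (LINT x|lborel. character (k - k\<^sub>0) x * gauss (e *\<^sub>R x)))"
    proof (rule Bochner_Integration.integral_cong[OF refl])
      fix k
      have "character (- k\<^sub>0) x * gauss (e *\<^sub>R x) * (character x k * f k) = f k * (character (k - k\<^sub>0) x * gauss (e *\<^sub>R x))" for x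
        using character_add[of k "- k\<^sub>0" x] by (simp add: character_commute[of x k] mult_ac)
      then show "(LINT x|lborel. character (- k\<^sub>0) x * gauss (e *\<^sub>R x) * (character x k * f k))
          = f k * (LINT x|lborel. character (k - k\<^sub>0) x * gauss (e *\<^sub>R x))"
        by (simp only: integral_mult_right_zero)
    qed
    also have "\<dots> = (LINT k|lborel. ?c * (f k * gauss ((k - k\<^sub>0) /\<^sub>R e))) /\<^sub>R e ^ DIM('a)"
      unfolding gauss_transform_scaled[OF e]
      by (subst integral_scaleR_right[symmetric]) (simp add: scaleR_conv_of_real field_simps)
    also have "\<dots> = (LINT u|lborel. ?c * (f (k\<^sub>0 + e *\<^sub>R u) * gauss u))"
      using lborel_integral_affine_euclidean(1)[of e "\<lambda>k. ?c * (f k * gauss ((k - k\<^sub>0) /\<^sub>R e))" k\<^sub>0] e by simp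
    finally show ?thesis by simp
  qed
  have lim1: "(\<lambda>n. LINT x|lborel. character (- k\<^sub>0) x * gauss (?e n *\<^sub>R x) * ft f x)
      \<longlonglongrightarrow> (LINT x|lborel. character (- k\<^sub>0) x * ft f x)"
  proof (rule integral_dominated_convergence[where w = "\<lambda>x. norm (ft f x)"])
    show "AE x in lborel. (\<lambda>n. character (- k\<^sub>0) x * gauss (?e n *\<^sub>R x) * ft f x) \<longlonglongrightarrow> character (- k\<^sub>0) x * ft f x"
    proof (intro AE_I2)
      fix x :: 'a
      have "(\<lambda>n. gauss (?e n *\<^sub>R x)) \<longlonglongrightarrow> gauss (0 *\<^sub>R x)"
        by (rule continuous_on_tendsto_compose[OF gauss_cont]) (intro tendsto_intros e0 | simp)+
      then have "(\<lambda>n. gauss (?e n *\<^sub>R x)) \<longlonglongrightarrow> 1" by (simp add: gauss_def)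
      then show "(\<lambda>n. character (- k\<^sub>0) x * gauss (?e n *\<^sub>R x) * ft f x) \<longlonglongrightarrow> character (- k\<^sub>0) x * ft f x"
        by (auto intro!: tendsto_eq_intros)
    qed
    show "AE x in lborel. norm (character (- k\<^sub>0) x * gauss (?e n *\<^sub>R x) * ft f x) \<le> norm (ft f x)" for n
      using gauss_le by (auto simp: norm_mult intro!: mult_left_le_one_le)
  qed (use ftint in auto)
  have lim2: "(\<lambda>n. LINT u|lborel. f (k\<^sub>0 + ?e n *\<^sub>R u) * gauss u) \<longlonglongrightarrow> (LINT u|lborel. f k\<^sub>0 * gauss (u::'a))"
  proof (rule integral_dominated_convergence[where w = "\<lambda>u::'a. M * norm (gauss u)"])
    show "AE u in lborel. (\<lambda>n. f (k\<^sub>0 + ?e n *\<^sub>R u) * gauss u) \<longlonglongrightarrow> f k\<^sub>0 * gauss u"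
    proof (intro AE_I2 tendsto_mult tendsto_const)
      fix u :: 'a
      have "(\<lambda>n. f (k\<^sub>0 + ?e n *\<^sub>R u)) \<longlonglongrightarrow> f (k\<^sub>0 + 0 *\<^sub>R u)"
        by (rule continuous_on_tendsto_compose[OF cont]) (intro tendsto_intros e0 | simp)+
      then show "(\<lambda>n. f (k\<^sub>0 + ?e n *\<^sub>R u)) \<longlonglongrightarrow> f k\<^sub>0" by simp
    qed
    show "AE u in lborel. norm (f (k\<^sub>0 + ?e n *\<^sub>R u) * gauss u) \<le> M * norm (gauss u)" for n
      using bound by (auto simp: norm_mult intro!: mult_right_mono)
  qed (use integrable_gauss in auto)
  have "(\<lambda>n. ?c * (LINT u|lborel. f (k\<^sub>0 + ?e n *\<^sub>R u) * gauss u)) \<longlonglongrightarrow> (LINT x|lborel. character (- k\<^sub>0) x * ft f x)"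
    using lim1 smeared by simp
  moreover have "(\<lambda>n. ?c * (LINT u|lborel. f (k\<^sub>0 + ?e n *\<^sub>R u) * gauss u)) \<longlonglongrightarrow> ?c * (f k\<^sub>0 * ?c)"
    using tendsto_mult_left[OF lim2, of ?c] by (simp add: integral_gauss)
  ultimately have "(LINT x|lborel. character (- k\<^sub>0) x * ft f x) = ?c * (f k\<^sub>0 * ?c)"
    by (rule LIMSEQ_unique)
  also have "\<dots> = of_real ((sqrt (2 * pi) * sqrt (2 * pi)) ^ DIM('a)) * f k\<^sub>0"
    unfolding power_mult_distrib by simp
  finally show ?thesis by simp
qed

lemma ft_inversion_test:
  fixes f :: "'a::euclidean_space \<Rightarrow> complex"
  assumes "f \<in> test_functions"
  shows "(LINT x|lborel. character (- k) x * ft f x) = of_real ((2 * pi) ^ DIM('a)) * f k"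
proof -
  obtain M where M: "\<And>k. norm (f k) \<le> M" using test_functions_bounded[OF assms] by blast
  have "ft f \<in> ft ` flat_tests 0" using assms by (auto simp: flat_tests_nonpos)
  then show ?thesis
    using assms by (intro ft_inversion[OF _ _ M] ft_integrable test_functions_integrable
        smooth_continuous test_functions_smooth)
qed

text \<open>A moment of \<open>g = ft f\<close> is the integral of the transform of a derivative of \<open>f\<close>. By inversion, it is a
  multiple of the value of that derivative at the origin, where \<open>f\<close> vanishes identically.\<close>
lemma ft_flat_tests_in_Phi:
  assumes "0 < a" "g \<in> ft ` flat_tests a"
  shows "g \<in> Phi"
  unfolding Phi_def
proof (intro CollectI conjI allI impI)
  show "g \<in> schwartz" by (rule ft_in_schwartz[OF assms(2)])
  fix bs :: "'a list" assume "set bs \<subseteq> Basis"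
  from ft_flat_tests_monomial[OF assms(2) this] obtain f where f: "f \<in> flat_tests a"
    "(\<lambda>x. of_real (prod_list (map (\<lambda>b. x \<bullet> b) bs)) * g x) = ft f" by auto
  then show "(LINT x|lborel. of_real (prod_list (map (\<lambda>b. x \<bullet> b) bs)) * g x) = 0"
    using ft_inversion_test[OF flat_tests_subset[OF f(1)], of 0] assms(1)
    by (simp add: flat_tests_def)
qed

section \<open>Orthogonality to the Lizorkin space\<close>

text \<open>The single property of \<open>L\<^sup>p\<close> (with finite \<open>p\<close>) and of \<open>C\<^sub>0\<close> on which the uniqueness theorem rests. It
  excludes the nonzero polynomials, which are orthogonal to the Lizorkin space.\<close>
definition small_plus_integrable :: "('a::euclidean_space \<Rightarrow> complex) \<Rightarrow> bool" where
  "small_plus_integrable f \<longleftrightarrow> f \<in> borel_measurable borel \<and>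
     (\<forall>\<delta>>0. \<exists>g. integrable lborel g \<and> (\<forall>x. 0 \<le> g x \<and> norm (f x) \<le> \<delta> + g x))"

lemma small_plus_integrable_measurable: "small_plus_integrable f \<Longrightarrow> f \<in> borel_measurable borel"
  by (simp add: small_plus_integrable_def)

lemma small_plus_integrableE:
  assumes "small_plus_integrable f" "0 < \<delta>"
  obtains g where "integrable lborel g" "\<And>x. 0 \<le> g x" "\<And>x. norm (f x) \<le> \<delta> + g x"
  using assms unfolding small_plus_integrable_def by blast

lemma Lsp_top_bdd:
  assumes f: "f \<in> Lsp top"
  shows "bdd_above (range (\<lambda>x. norm (f x)))"
proof -
  have cont: "continuous_on UNIV f" and lim: "(f \<longlongrightarrow> 0) at_infinity"
    using f by (auto simp: Lsp_def)
  have "\<forall>\<^sub>F x in at_infinity. norm (f x) < 1"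
    using tendstoD[OF lim, of 1] by simp
  then obtain R where R: "\<And>x. R \<le> norm x \<Longrightarrow> norm (f x) < 1"
    by (auto simp: eventually_at_infinity)
  have "compact (f ` cball 0 R)"
    using cont by (intro compact_continuous_image) (auto intro: continuous_on_subset)
  then have "bounded (f ` cball 0 R)" by (rule compact_imp_bounded)
  then obtain M where M: "\<forall>y\<in>f ` cball 0 R. norm y \<le> M"
    unfolding bounded_iff by blast
  have "norm (f x) \<le> max 1 M" for x
    using R[of x] M by (cases "R \<le> norm x") (auto simp: le_max_iff_disj)
  then show ?thesis by (intro bdd_aboveI2)
qed

text \<open>For finite \<open>p\<close>, a value \<open>|f| > \<delta>\<close> is at most \<open>\<delta>\<^sup>1\<^sup>-\<^sup>p |f|\<^sup>p\<close>. For \<open>C\<^sub>0\<close>, the set \<open>|f| \<ge> \<delta>\<close> is bounded.\<close>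
lemma Lsp_small_plus_integrable:
  assumes "f \<in> Lsp p" "1 \<le> p"
  shows "small_plus_integrable f"
proof (cases "p = top")
  case True
  then have cont: "continuous_on UNIV f" and lim: "(f \<longlongrightarrow> 0) at_infinity"
    using assms by (auto simp: Lsp_def)
  show ?thesis
    unfolding small_plus_integrable_def
  proof (intro conjI allI impI)
    show "f \<in> borel_measurable borel" using cont by (rule borel_measurable_continuous_onI)
    fix \<delta> :: real assume "0 < \<delta>"
    then have "\<forall>\<^sub>F x in at_infinity. norm (f x) < \<delta>"
      using tendstoD[OF lim, of \<delta>] by simp
    then obtain R where R: "\<And>x. R \<le> norm x \<Longrightarrow> norm (f x) < \<delta>"
      by (auto simp: eventually_at_infinity)
    obtain M where M: "\<And>x. norm (f x) \<le> M"
      using Lsp_top_bdd[of f] assms(1) True by (auto simp: bdd_above_def)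
    have M0: "0 \<le> M" using order_trans[OF norm_ge_zero M] .
    show "\<exists>g. integrable lborel g \<and> (\<forall>x. 0 \<le> g x \<and> norm (f x) \<le> \<delta> + g x)"
    proof (intro exI[of _ "\<lambda>x. M * indicator (cball 0 R) x"] conjI allI)
      show "integrable lborel (\<lambda>x. M * indicator (cball 0 R) x :: real)"
        by (intro integrable_mult_right integrable_real_indicator emeasure_lborel_cball_finite) simp_all
      show "0 \<le> M * indicator (cball 0 R) x" for x :: 'a using M0 by simp
      show "norm (f x) \<le> \<delta> + M * indicator (cball 0 R) x" for x
        using M[of x] R[of x] \<open>0 < \<delta>\<close> by (auto simp: indicator_def intro: less_imp_le)
    qed
  qed
next
  case False
  define r where "r = enn2real p"
  have r: "1 \<le> r"
    using enn2real_ge_1[OF assms(2)] False by (simp add: r_def top.not_eq_extremum)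
  have f: "f \<in> borel_measurable borel" "integrable lborel (\<lambda>x. norm (f x) powr r)"
    using assms False by (auto simp: Lsp_def r_def)
  show ?thesis
    unfolding small_plus_integrable_def
  proof (intro conjI f allI impI)
    fix \<delta> :: real assume d: "0 < \<delta>"
    show "\<exists>g. integrable lborel g \<and> (\<forall>x. 0 \<le> g x \<and> norm (f x) \<le> \<delta> + g x)"
    proof (intro exI[of _ "\<lambda>x. \<delta> powr (1 - r) * norm (f x) powr r"] conjI allI)
      show "integrable lborel (\<lambda>x. \<delta> powr (1 - r) * norm (f x) powr r)" using f by simp
      show "norm (f x) \<le> \<delta> + \<delta> powr (1 - r) * norm (f x) powr r" for x
      proof (cases "norm (f x) \<le> \<delta>")
        case True
        then show ?thesis by (simp add: add_increasing2)
      next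
        case False
        then have "1 \<le> (norm (f x) / \<delta>) powr (r - 1)"
          using d r by (intro ge_one_powr_ge_zero) auto
        then have "norm (f x) \<le> norm (f x) * (norm (f x) / \<delta>) powr (r - 1)"
          by (simp add: mult_le_cancel_left1)
        also have "\<dots> = \<delta> powr (1 - r) * norm (f x) powr r"
          using d False by (simp add: powr_divide powr_diff)
        finally show ?thesis using d by simp
      qed
    qed simp
  qed
qed

lemma small_plus_integrable_diff:
  assumes "small_plus_integrable f" "small_plus_integrable h"
  shows "small_plus_integrable (\<lambda>x. f x - h x)"
  unfolding small_plus_integrable_def
proof (intro conjI allI impI)
  show "(\<lambda>x. f x - h x) \<in> borel_measurable borel"
    using assms[THEN small_plus_integrable_measurable] by simp
  fix \<delta> :: real assume "0 < \<delta>"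
  then obtain u v where "integrable lborel u" "\<And>x. 0 \<le> u x" "\<And>x. norm (f x) \<le> \<delta> / 2 + u x"
    and "integrable lborel v" "\<And>x. 0 \<le> v x" "\<And>x. norm (h x) \<le> \<delta> / 2 + v x"
    using small_plus_integrableE[OF assms(1), of "\<delta> / 2"] small_plus_integrableE[OF assms(2), of "\<delta> / 2"]
    by (metis half_gt_zero)
  moreover have "norm (f x - h x) \<le> norm (f x) + norm (h x)" for x
    by (rule norm_triangle_ineq4)
  ultimately show "\<exists>g. integrable lborel g \<and> (\<forall>x. 0 \<le> g x \<and> norm (f x - h x) \<le> \<delta> + g x)"
    by (intro exI[of _ "\<lambda>x. u x + v x"]) (auto, smt (verit, ccfv_SIG) field_sum_of_halves)
qed

lemma small_plus_integrable_mult: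
  assumes f: "small_plus_integrable f" and K: "integrable lborel K" and M: "\<And>x. norm (K x) \<le> M"
  shows "integrable lborel (\<lambda>x. f x * K x)"
proof -
  obtain g where g: "integrable lborel g" "\<And>x. 0 \<le> g x" "\<And>x. norm (f x) \<le> 1 + g x"
    using small_plus_integrableE[OF f, of 1] by auto
  have [measurable]: "f \<in> borel_measurable borel" "K \<in> borel_measurable borel"
    using f K by (auto dest: small_plus_integrable_measurable)
  have "norm (f x * K x) \<le> norm (K x) + M * g x" for x
  proof -
    have "norm (f x * K x) \<le> (1 + g x) * norm (K x)"
      unfolding norm_mult by (intro mult_right_mono g) simp
    also have "\<dots> \<le> norm (K x) + M * g x"
      using mult_right_mono[OF M[of x] g(2)[of x]] by (simp add: algebra_simps)
    finally show ?thesis .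
  qed
  then have *: "norm (f x * K x) \<le> norm (norm (K x) + M * g x)" for x
    by (smt (verit) real_norm_def)
  have "integrable lborel (\<lambda>x. norm (K x) + M * g x)"
    using K g(1) by simp
  then show ?thesis
    by (rule Bochner_Integration.integrable_bound) (use * in auto)
qed

text \<open>Boxes form a generator of the Borel sets that is stable under intersections, so the integrals over all
  Borel subsets of a large box vanish as well.\<close>
lemma AE_zero_if_box_integrals_zero:
  fixes f :: "'a::euclidean_space \<Rightarrow> complex"
  assumes int: "\<And>a b. integrable lborel (\<lambda>x. indicator (box a b) x *\<^sub>R f x)"
    and zero: "\<And>a b. (LINT x|lborel. indicator (box a b) x *\<^sub>R f x) = 0"
  shows "AE x in lborel. f x = 0"
proof -
  have IS: "Int_stable (range (\<lambda>(a, b). box a b :: 'a set))"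
    by (auto simp: Int_stable_def box_Int_box)
  have PW: "range (\<lambda>(a, b). box a b :: 'a set) \<subseteq> Pow UNIV" by simp
  let ?Q = "\<lambda>n::nat. box (- (real n *\<^sub>R One)) (real n *\<^sub>R One) :: 'a set"
  have "AE x in lborel. indicator (?Q n) x *\<^sub>R f x = 0" for n
  proof (rule sigma_finite_measure.density_zero[OF sigma_finite_lborel])
    let ?f = "\<lambda>x. indicator (?Q n) x *\<^sub>R f x"
    show intQ: "integrable lborel ?f" by (rule int)
    have si: "set_integrable lborel A ?f" if "A \<in> sets borel" for A
      unfolding set_integrable_def using integrable_mult_indicator[OF _ intQ, of A] that by simp
    fix A :: "'a set" assume "A \<in> sets lborel"
    then have "A \<in> sigma_sets UNIV (range (\<lambda>(a, b). box a b))"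
      by (simp add: borel_eq_box)
    then show "set_lebesgue_integral lborel A ?f = 0"
    proof (induction rule: sigma_sets_induct_disjoint[OF IS PW, consumes 1, case_names basic empty compl union])
      case (basic A)
      then obtain a b where "A = box a b" by auto
      moreover obtain c d where "box a b \<inter> ?Q n = box c d" by (simp add: box_Int_box)
      then have "indicator (box a b) x *\<^sub>R ?f x = indicator (box c d) x *\<^sub>R f x" for x
        by (auto simp: indicator_def)
      ultimately show ?case using zero[of c d] by (simp only: set_lebesgue_integral_def)
    next
      case empty
      then show ?case by (simp add: set_lebesgue_integral_def)
    next
      case (compl A)
      have A: "A \<in> sets borel" using compl(1) by (simp add: borel_eq_box)
      have "set_lebesgue_integral lborel (UNIV - A) ?f = (LINT x|lborel. ?f x - indicator A x *\<^sub>R ?f x)"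
        unfolding set_lebesgue_integral_def
        by (intro Bochner_Integration.integral_cong) (auto simp: indicator_def)
      also have "\<dots> = (LINT x|lborel. ?f x) - set_lebesgue_integral lborel A ?f"
        using si[OF A] intQ unfolding set_lebesgue_integral_def set_integrable_def by simp
      finally show ?case using compl(2) zero by simp
    next
      case (union A)
      have A: "A i \<in> sets borel" for i using union(2) by (auto simp: borel_eq_box)
      have "set_lebesgue_integral lborel (\<Union>i. A i) ?f = (\<Sum>i. set_lebesgue_integral lborel (A i) ?f)"
        using union(1) A
        by (intro lebesgue_integral_countable_add si) (auto simp: disjoint_family_on_def)
      then show ?case using union(3) by simp
    qed
  qed
  then have "\<forall>n. AE x in lborel. indicator (?Q n) x *\<^sub>R f x = 0"
    by (rule allI)
  then have "AE x in lborel. \<forall>n. indicator (?Q n) x *\<^sub>R f x = 0"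
    unfolding AE_all_countable .
  then show ?thesis
  proof eventually_elim
    case (elim x)
    obtain n where "x \<in> ?Q n" using UN_box_eq_UNIV by blast
    then show ?case using elim[rule_format, of n] by simp
  qed
qed

lemma ft_character_rescale:
  fixes x y :: "'a::euclidean_space"
  assumes "0 < e"
  shows "ft (\<lambda>k. character (- y) k * rescale e f k) x = ft f ((x - y) /\<^sub>R e) /\<^sub>R e ^ DIM('a)"
proof -
  have "character x k * (character (- y) k * rescale e f k) = character ((x - y) /\<^sub>R e) (e *\<^sub>R k) * f (e *\<^sub>R k)" for k
  proof -
    have "(e *\<^sub>R k) \<bullet> ((x - y) /\<^sub>R e) = k \<bullet> (x + - y)" using assms by simp
    then have "character ((x - y) /\<^sub>R e) (e *\<^sub>R k) = character x k * character (- y) k"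
      unfolding character_add[symmetric] by (simp only: character_def)
    then show ?thesis by (simp add: rescale_def)
  qed
  then show ?thesis
    unfolding ft_def
    using lborel_integral_scale(1)[OF assms, of "\<lambda>k. character ((x - y) /\<^sub>R e) k * f k"] by simp
qed

text \<open>Replacing the scale \<open>e\<close> of the kernel by a large scale \<open>s\<close> does not change the integral, because the
  two kernels differ by the transform of a test function that vanishes near the origin. For the part of
  \<open>f\<close> below \<open>\<delta>\<close>, the integral at scale \<open>s\<close> is bounded by \<open>\<delta>\<close> times the \<open>L\<^sup>1\<close> norm of the kernel; for the
  integrable part, by the supremum of the kernel, which is of order \<open>s\<^sup>-\<^sup>d\<close>.\<close>
lemma orthogonal_imp_mollification_zero:
  fixes f :: "'a::euclidean_space \<Rightarrow> complex"
  assumes f: "small_plus_integrable f"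
    and orth: "\<And>a \<eta>. 0 < a \<Longrightarrow> \<eta> \<in> flat_tests a \<Longrightarrow> (LINT x|lborel. f x * ft \<eta> x) = 0"
    and e: "0 < e"
  shows "(LINT z|lborel. f (y + e *\<^sub>R z) * ft cutoff z) = 0"
proof -
  let ?K = "ft cutoff :: 'a \<Rightarrow> complex"
  define Ks where "Ks s x = ?K ((x - y) /\<^sub>R s) /\<^sub>R s ^ DIM('a)" for s :: real and x
  have cut: "(cutoff :: 'a \<Rightarrow> complex) \<in> flat_tests 0"
    using cutoff_in_test_functions by (simp add: flat_tests_nonpos)
  have K: "integrable lborel ?K" using cut by (intro ft_integrable) auto
  note [measurable] = borel_measurable_integrable[OF K, simplified] small_plus_integrable_measurable[OF f]
  obtain M where M: "\<And>x. norm (?K x) \<le> M" using norm_ft_le by blast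
  have M0: "0 \<le> M" using order_trans[OF norm_ge_zero M] .
  have Ks_int: "integrable lborel (Ks s)" "(LINT x|lborel. norm (Ks s x)) = (LINT x|lborel. norm (?K x))"
    and Ks_le: "norm (Ks s x) \<le> M / s ^ DIM('a)" if "0 < s" for s x
  proof -
    have eq: "Ks s = (\<lambda>x. (\<lambda>x. ?K x /\<^sub>R s ^ DIM('a)) (- (y /\<^sub>R s) + (1 / s) *\<^sub>R x))"
      using that by (auto simp: Ks_def scaleR_diff_right divide_inverse)
    show "integrable lborel (Ks s)"
      unfolding eq using lborel_integral_affine_euclidean(2)[of "1 / s" "\<lambda>x. ?K x /\<^sub>R s ^ DIM('a)" "- (y /\<^sub>R s)"] K that
      by simp
    show "(LINT x|lborel. norm (Ks s x)) = (LINT x|lborel. norm (?K x))"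
      unfolding eq using lborel_integral_affine_euclidean(1)[of "1 / s" "\<lambda>x. norm (?K x /\<^sub>R s ^ DIM('a))" "- (y /\<^sub>R s)"] that
      by (simp add: power_one_over field_simps)
    show "norm (Ks s x) \<le> M / s ^ DIM('a)"
      using M that by (simp add: Ks_def divide_inverse mult.commute)
  qed
  have Ks_ft: "ft (\<lambda>k. character (- y) k * rescale s cutoff k) = Ks s" if "0 < s" for s
    by (rule ext) (simp add: ft_character_rescale[OF that] Ks_def)
  have fK: "integrable lborel (\<lambda>x. f x * Ks s x)" if "0 < s" for s
    using Ks_le[OF that] by (intro small_plus_integrable_mult[OF f Ks_int(1)[OF that]])
  have same: "(LINT x|lborel. f x * Ks e x) = (LINT x|lborel. f x * Ks s x)" if s: "0 < s" for s
  proof -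
    let ?u = "\<lambda>k. character (- y) k * rescale e cutoff k"
    let ?v = "\<lambda>k. (- 1) * (character (- y) k * rescale s cutoff k)"
    \<comment> \<open>For \<open>|k| < ?a\<close>, both cutoffs are equal to \<open>1\<close> and cancel.\<close>
    let ?a = "min (1 / e) (1 / s)"
    have t: "?u \<in> test_functions" "?v \<in> test_functions"
      by (intro test_functions_mult test_functions_rescale cutoff_in_test_functions smooth_character
          smooth_const e s)+
    have z: "?u k + ?v k = 0" if "norm k < ?a" for k
      using that e s by (simp add: rescale_def cutoff_eq_1 field_simps)
    have "(\<lambda>k. ?u k + ?v k) \<in> flat_tests ?a"
      unfolding flat_tests_def mem_Collect_eq by (intro conjI allI impI test_functions_add[OF t] z)
    moreover have "0 < ?a" using e s by simp
    ultimately have "(LINT x|lborel. f x * ft (\<lambda>k. ?u k + ?v k) x) = 0" by (rule orth[rotated])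
    moreover have "ft ?v x = - ft (\<lambda>k. character (- y) k * rescale s cutoff k) x" for x
      unfolding ft_def by simp
    ultimately have "(LINT x|lborel. f x * Ks e x - f x * Ks s x) = 0"
      using ft_add[OF t] Ks_ft[OF e] Ks_ft[OF s] by (simp add: right_diff_distrib)
    then show ?thesis using fK[OF e] fK[OF s] by simp
  qed
  let ?A = "LINT x|lborel. norm (?K x)"
  have small: "norm (LINT x|lborel. f x * Ks e x) \<le> \<delta> * (?A + 1)" if d: "0 < \<delta>" for \<delta>
  proof -
    obtain g where g: "integrable lborel g" "\<And>x. 0 \<le> g x" "\<And>x. norm (f x) \<le> \<delta> + g x"
      using small_plus_integrableE[OF f d] by auto
    let ?B = "M * (LINT x|lborel. g x)"
    \<comment> \<open>Then \<open>s ^ d \<ge> s\<close> and \<open>?B / s \<le> \<delta>\<close>.\<close>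
    define s where "s = max 1 (?B / \<delta>)"
    have s: "1 \<le> s" "0 < s" by (auto simp: s_def)
    have "norm (LINT x|lborel. f x * Ks s x) \<le> (LINT x|lborel. norm (f x * Ks s x))"
      by (rule integral_norm_bound)
    also have "\<dots> \<le> (LINT x|lborel. \<delta> * norm (Ks s x) + M / s ^ DIM('a) * g x)"
    proof (rule integral_mono)
      show "integrable lborel (\<lambda>x. norm (f x * Ks s x))" using fK[OF s(2)] by (rule integrable_norm)
      show "integrable lborel (\<lambda>x. \<delta> * norm (Ks s x) + M / s ^ DIM('a) * g x)"
        using Ks_int(1)[OF s(2)] g(1) by simp
      fix x
      have "norm (f x * Ks s x) \<le> (\<delta> + g x) * norm (Ks s x)"
        unfolding norm_mult by (intro mult_right_mono g) simp
      also have "\<dots> \<le> \<delta> * norm (Ks s x) + M / s ^ DIM('a) * g x"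
        using mult_right_mono[OF Ks_le[OF s(2), of x] g(2)[of x]] by (simp add: algebra_simps)
      finally show "norm (f x * Ks s x) \<le> \<delta> * norm (Ks s x) + M / s ^ DIM('a) * g x" .
    qed
    also have "\<dots> = \<delta> * ?A + ?B / s ^ DIM('a)"
      using Ks_int[OF s(2)] g(1) by simp
    also have "\<dots> \<le> \<delta> * ?A + \<delta>"
    proof -
      have "?B \<le> \<delta> * s" using d by (simp add: s_def max_def field_simps)
      also have "\<dots> \<le> \<delta> * s ^ DIM('a)"
        using d s self_le_power[of s "DIM('a)"] by (intro mult_left_mono) auto
      finally show ?thesis using s by (simp add: field_simps)
    qed
    finally show ?thesis using same[OF s(2)] by (simp add: distrib_left)
  qed
  have A0: "0 \<le> ?A" by simp
  have "norm (LINT x|lborel. f x * Ks e x) \<le> 0"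
  proof (rule field_le_epsilon)
    fix \<epsilon> :: real assume "0 < \<epsilon>"
    then show "norm (LINT x|lborel. f x * Ks e x) \<le> 0 + \<epsilon>"
      using small[of "\<epsilon> / (?A + 1)"] A0 by (simp add: add_nonneg_eq_0_iff)
  qed
  then have "(LINT x|lborel. f x * Ks e x) = 0" by simp
  moreover have "(LINT z|lborel. f (y + e *\<^sub>R z) * ?K z) = (LINT x|lborel. f x * Ks e x)"
    using lborel_integral_affine_euclidean(1)[of e "\<lambda>x. f x * ?K ((x - y) /\<^sub>R e)" y] e
    by (simp add: Ks_def)
  ultimately show ?thesis by simp
qed

lemma small_plus_integrable_translate:
  assumes "small_plus_integrable f"
  shows "small_plus_integrable (\<lambda>y. f (w + y))"
  unfolding small_plus_integrable_def
proof (intro conjI allI impI)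
  show "(\<lambda>y. f (w + y)) \<in> borel_measurable borel"
    using small_plus_integrable_measurable[OF assms] by measurable
  fix \<delta> :: real assume "0 < \<delta>"
  then obtain g where "integrable lborel g" "\<And>x. 0 \<le> g x" "\<And>x. norm (f x) \<le> \<delta> + g x"
    using small_plus_integrableE[OF assms] by metis
  then show "\<exists>g. integrable lborel g \<and> (\<forall>x. 0 \<le> g x \<and> norm (f (w + x)) \<le> \<delta> + g x)"
    using lborel_integral_affine_euclidean(2)[of 1 g w] by (intro exI[of _ "\<lambda>x. g (w + x)"]) auto
qed

text \<open>Let \<open>h w\<close> be the integral of \<open>f\<close> over a box shifted by \<open>w\<close>. Integrating the previous lemma over the box
  shows that the integral of \<open>K z * h (e z)\<close> over \<open>z\<close> vanishes for all \<open>e > 0\<close>. Since \<open>h\<close> is bounded and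
  continuous at \<open>0\<close>, letting \<open>e\<close> tend to \<open>0\<close> gives \<open>h 0 = 0\<close>.\<close>
theorem orthogonal_imp_AE_zero:
  fixes f :: "'a::euclidean_space \<Rightarrow> complex"
  assumes f: "small_plus_integrable f"
    and orth: "\<And>a \<eta>. 0 < a \<Longrightarrow> \<eta> \<in> flat_tests a \<Longrightarrow> (LINT x|lborel. f x * ft \<eta> x) = 0"
  shows "AE x in lborel. f x = 0"
proof (rule AE_zero_if_box_integrals_zero)
  fix a b :: 'a
  let ?Q = "box a b" and ?K = "ft cutoff :: 'a \<Rightarrow> complex"
  note [measurable] = small_plus_integrable_measurable[OF f]
  have cut: "(cutoff :: 'a \<Rightarrow> complex) \<in> flat_tests 0"
    using cutoff_in_test_functions by (simp add: flat_tests_nonpos)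
  have K: "integrable lborel ?K" using cut by (intro ft_integrable) auto
  note [measurable] = borel_measurable_integrable[OF K, simplified]
  obtain g where g: "integrable lborel g" "\<And>x. 0 \<le> g x" "\<And>x. norm (f x) \<le> 1 + g x"
    using small_plus_integrableE[OF f, of 1] by auto
  have loc: "integrable lborel (\<lambda>y. indicator S y *\<^sub>R f (w + y))"
    if "S \<in> sets borel" "emeasure lborel S < \<infinity>" for S w
  proof -
    have "integrable lborel (\<lambda>y. f (w + y) * of_real (indicator S y))"
      using that by (intro small_plus_integrable_mult[where M = 1] small_plus_integrable_translate f
          integrable_of_real integrable_real_indicator) (auto simp: indicator_def)
    then show ?thesis by (simp add: scaleR_conv_of_real mult.commute)
  qed
  show int: "integrable lborel (\<lambda>x. indicator ?Q x *\<^sub>R f x)"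
    using loc[of ?Q 0, OF _ emeasure_lborel_box_finite] by simp
  define h where "h w = (LINT y|lborel. indicator ?Q y *\<^sub>R f (y + w))" for w
  have h_int: "integrable lborel (\<lambda>y. indicator ?Q y *\<^sub>R f (y + w))" for w
    using loc[of ?Q w, OF _ emeasure_lborel_box_finite] by (simp add: add.commute)
  define A where "A = measure lborel ?Q + (LINT y|lborel. g y)"
  have h_le: "(LINT y|lborel. norm (indicator ?Q y *\<^sub>R f (y + w))) \<le> A" for w
  proof -
    have gw: "integrable lborel (\<lambda>y. g (y + w))" "(LINT y|lborel. g (y + w)) = (LINT y|lborel. g y)"
      using lborel_integral_affine_euclidean[of 1 g w] g(1) by (auto simp: add.commute)
    have iQ: "integrable lborel (indicator ?Q :: 'a \<Rightarrow> real)"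
      by (intro integrable_real_indicator emeasure_lborel_box_finite) auto
    have "(LINT y|lborel. norm (indicator ?Q y *\<^sub>R f (y + w))) \<le> (LINT y|lborel. indicator ?Q y + g (y + w))"
      using g(2,3) by (intro integral_mono integrable_norm h_int Bochner_Integration.integrable_add gw iQ)
        (auto simp: indicator_def)
    also have "\<dots> = A"
      using gw iQ by (simp add: A_def)
    finally show ?thesis .
  qed
  have h_norm: "norm (h w) \<le> A" for w
    unfolding h_def by (rule order_trans[OF integral_norm_bound h_le])
  have h_zero: "(LINT z|lborel. ?K z * h (e *\<^sub>R z)) = 0" if e: "0 < e" for e
  proof -
    define F where "F z y = ?K z * (indicator ?Q y *\<^sub>R f (y + e *\<^sub>R z))" for z y
    have F_measurable: "case_prod F \<in> borel_measurable (lborel \<Otimes>\<^sub>M lborel)"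
      unfolding F_def by measurable
    have F_int: "integrable lborel (F z)" for z
      unfolding F_def by (intro integrable_mult_right h_int)
    have F_le: "norm (LINT y|lborel. norm (F z y)) \<le> norm (A * norm (?K z))" for z
    proof -
      have "(LINT y|lborel. norm (F z y)) = norm (?K z) * (LINT y|lborel. norm (indicator ?Q y *\<^sub>R f (y + e *\<^sub>R z)))"
        unfolding F_def norm_mult[of "?K z"] by (rule integral_mult_right_zero)
      also have "\<dots> \<le> norm (?K z) * A"
        by (intro mult_left_mono h_le) simp
      finally have le: "(LINT y|lborel. norm (F z y)) \<le> A * norm (?K z)"
        by (simp only: mult.commute)
      have nn: "0 \<le> (LINT y|lborel. norm (F z y))"
        by (intro Bochner_Integration.integral_nonneg) simp
      show ?thesis
        unfolding real_norm_def abs_of_nonneg[OF nn] using order_trans[OF le abs_ge_self] .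
    qed
    have "integrable (lborel \<Otimes>\<^sub>M lborel) (case_prod F)"
    proof (rule lborel_pair.Fubini_integrable[OF F_measurable])
      show "AE z in lborel. integrable lborel (\<lambda>y. case_prod F (z, y))"
        using F_int by simp
      have m: "(\<lambda>z. LINT y|lborel. norm (case_prod F (z, y))) \<in> borel_measurable lborel"
        using measurable_compose[OF F_measurable borel_measurable_norm]
        by (intro lborel.borel_measurable_lebesgue_integral) (simp add: case_prod_unfold)
      have i: "integrable lborel (\<lambda>z. A * norm (?K z))" using K by simp
      show "integrable lborel (\<lambda>z. LINT y|lborel. norm (case_prod F (z, y)))"
        by (rule Bochner_Integration.integrable_bound[OF i m]) (use F_le in simp)
    qed
    then have "(LINT y|lborel. LINT z|lborel. F z y) = (LINT z|lborel. LINT y|lborel. F z y)"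
      by (rule lborel_pair.Fubini_integral)
    also have "\<dots> = (LINT z|lborel. ?K z * h (e *\<^sub>R z))"
      unfolding F_def h_def integral_mult_right_zero ..
    finally have "(LINT z|lborel. ?K z * h (e *\<^sub>R z)) = (LINT y|lborel. LINT z|lborel. F z y)" ..
    also have "\<dots> = (LINT y|lborel. indicator ?Q y *\<^sub>R (LINT z|lborel. f (y + e *\<^sub>R z) * ?K z))"
    proof (intro Bochner_Integration.integral_cong refl)
      fix y
      have "F z y = indicator ?Q y *\<^sub>R (f (y + e *\<^sub>R z) * ?K z)" for z
        by (simp add: F_def)
      then show "(LINT z|lborel. F z y) = indicator ?Q y *\<^sub>R (LINT z|lborel. f (y + e *\<^sub>R z) * ?K z)"
        by (simp only: integral_scaleR_right)
    qed
    also have "\<dots> = 0"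
      using orthogonal_imp_mollification_zero[OF f orth e] by simp
    finally show ?thesis .
  qed
  let ?e = "\<lambda>n. 1 / real (Suc n)"
  have e0: "?e \<longlonglongrightarrow> 0" using lim_1_over_n[THEN LIMSEQ_Suc] by simp
  have h_lim: "(\<lambda>n. h (?e n *\<^sub>R z)) \<longlonglongrightarrow> h 0" for z
  proof -
    have shift: "h w = (LINT y|lborel. indicator ?Q (y - w) *\<^sub>R f y)" for w
      unfolding h_def
      using lborel_integral_affine_euclidean(1)[of 1 "\<lambda>y. indicator ?Q (y - w) *\<^sub>R f y" w]
      by (simp add: add.commute)
    obtain \<rho> where \<rho>: "\<And>x. x \<in> ?Q \<Longrightarrow> norm x \<le> \<rho>"
      using bounded_box[of a b] by (auto simp: bounded_iff)
    \<comment> \<open>A ball that contains all translates of the box by multiples of \<open>z\<close> with factors in \<open>[0, 1]\<close>.\<close>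
    let ?S = "cball (0::'a) (\<rho> + norm z)"
    have ez: "(\<lambda>n. y - ?e n *\<^sub>R z) \<longlonglongrightarrow> y" for y
    proof -
      have "(\<lambda>n. y - ?e n *\<^sub>R z) \<longlonglongrightarrow> y - 0 *\<^sub>R z" by (intro tendsto_intros e0)
      then show ?thesis by simp
    qed
    have "(\<lambda>n. LINT y|lborel. indicator ?Q (y - ?e n *\<^sub>R z) *\<^sub>R f y) \<longlonglongrightarrow> (LINT y|lborel. indicator ?Q (y - 0) *\<^sub>R f y)"
    proof (rule integral_dominated_convergence[where w = "\<lambda>y. norm (indicator ?S y *\<^sub>R f y)"])
      show "integrable lborel (\<lambda>y. norm (indicator ?S y *\<^sub>R f y))"
        using loc[of ?S 0, OF _ emeasure_lborel_cball_finite] by (intro integrable_norm) simp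
      \<comment> \<open>Off the boundary of the box, a null set, the indicators are eventually constant.\<close>
      have "AE y in lborel. y \<notin> cbox a b - box a b"
        using null_sets_cbox_Diff_box by (intro AE_not_in)
      then show "AE y in lborel. (\<lambda>n. indicator ?Q (y - ?e n *\<^sub>R z) *\<^sub>R f y) \<longlonglongrightarrow> indicator ?Q (y - 0) *\<^sub>R f y"
      proof eventually_elim
        case (elim y)
        show ?case
        proof (rule tendsto_eventually)
          show "\<forall>\<^sub>F n in sequentially. indicator ?Q (y - ?e n *\<^sub>R z) *\<^sub>R f y = indicator ?Q (y - 0) *\<^sub>R f y"
          proof (cases "y \<in> ?Q")
            case True
            have "\<forall>\<^sub>F n in sequentially. y - ?e n *\<^sub>R z \<in> ?Q"
              by (rule topological_tendstoD[OF ez open_box True])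
            then show ?thesis by eventually_elim (use True in simp)
          next
            case False
            then have "y \<in> - cbox a b" using elim by auto
            then have "\<forall>\<^sub>F n in sequentially. y - ?e n *\<^sub>R z \<in> - cbox a b"
              by (intro topological_tendstoD[OF ez]) (auto intro: closed_cbox)
            then show ?thesis
              by eventually_elim (use False box_subset_cbox[of a b] in \<open>auto simp: indicator_def\<close>)
          qed
        qed
      qed
      have "norm (y::'a) \<le> \<rho> + norm z" if "y - ?e n *\<^sub>R z \<in> ?Q" for n y
      proof -
        have "norm (?e n *\<^sub>R z) \<le> norm z" by (simp add: mult_left_le_one_le field_simps)
        then show ?thesis using \<rho>[OF that] norm_triangle_sub[of y "?e n *\<^sub>R z"] by linarith
      qed
      then show "AE y in lborel. norm (indicator ?Q (y - ?e n *\<^sub>R z) *\<^sub>R f y) \<le> norm (indicator ?S y *\<^sub>R f y)" for n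
        by (auto simp: indicator_def)
    qed measurable
    then show ?thesis by (simp add: shift)
  qed
  have "(\<lambda>n. LINT z|lborel. ?K z * h (?e n *\<^sub>R z)) \<longlonglongrightarrow> (LINT z|lborel. ?K z * h 0)"
  proof (rule integral_dominated_convergence[where w = "\<lambda>z. A * norm (?K z)"])
    show "integrable lborel (\<lambda>z. A * norm (?K z))" using K by simp
    show "AE z in lborel. (\<lambda>n. ?K z * h (?e n *\<^sub>R z)) \<longlonglongrightarrow> ?K z * h 0"
      by (intro AE_I2 tendsto_intros h_lim)
    have "norm (?K z * h w) \<le> A * norm (?K z)" for z w
      using mult_right_mono[OF h_norm[of w], of "norm (?K z)"] by (simp add: norm_mult mult.commute)
    then show "AE z in lborel. norm (?K z * h (?e n *\<^sub>R z)) \<le> A * norm (?K z)" for n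
      by simp
  qed (unfold h_def, measurable)
  then have "(LINT z|lborel. ?K z * h 0) = 0"
    using h_zero by (simp add: LIMSEQ_const_iff)
  moreover have "(LINT z|lborel. ?K z) = of_real ((2 * pi) ^ DIM('a))"
    using ft_inversion_test[OF cutoff_in_test_functions, of "0::'a"] by (simp add: cutoff_eq_1)
  ultimately have "h 0 = 0" by simp
  then show "(LINT x|lborel. indicator ?Q x *\<^sub>R f x) = 0" by (simp add: h_def)
qed

section \<open>Uniqueness of representatives and injectivity of fractional derivatives\<close>

abbreviation (input) fourier_factor :: "'a::euclidean_space itself \<Rightarrow> complex" where
  "fourier_factor T \<equiv> of_real ((2 * pi) powr (- real DIM('a) / 2))"

lemma fourier_eq_ft: "fourier \<phi> k = fourier_factor TYPE('a) * ft \<phi> (- k)"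
  for \<phi> :: "'a::euclidean_space \<Rightarrow> complex"
  by (simp add: fourier_def ft_def character_def inner_commute)

lemma inv_fourier_eq_ft: "inv_fourier \<psi> x = fourier_factor TYPE('a) * ft \<psi> x"
  for \<psi> :: "'a::euclidean_space \<Rightarrow> complex"
  by (simp add: inv_fourier_def ft_def character_def)

text \<open>The transpose of \<open>Dpow s\<close>: the two reflections and the two Fourier transforms in the definition of
  \<open>Dpow\<close> combine to this multiplier operator on \<open>\<Phi>\<close>.\<close>
definition D_test :: "real \<Rightarrow> ('a::euclidean_space \<Rightarrow> complex) \<Rightarrow> 'a \<Rightarrow> complex" where
  "D_test s \<phi> = inv_fourier (\<lambda>k. of_real (norm k powr s) * fourier \<phi> k)"

lemma Dpow_eq_D_test: "Dpow s u \<phi> = u (D_test s \<phi>)"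
  by (simp add: Dpow_def D_test_def inv_fourier_dual_def mult_abs_def fourier_dual_def reflect_def[abs_def])

text \<open>The preimage is the transform of \<open>|k|\<^sup>-\<^sup>s \<eta>\<close>, which is again a test function that vanishes near the
  origin.\<close>
lemma ft_flat_eq_D_test:
  fixes \<eta> :: "'a::euclidean_space \<Rightarrow> complex"
  assumes a: "0 < a" and \<eta>: "\<eta> \<in> flat_tests a"
  shows "\<exists>\<phi>\<in>Phi. D_test s \<phi> = ft \<eta>"
proof -
  let ?u = "\<lambda>k. of_real (norm k powr - s) * \<eta> k"
  let ?c = "fourier_factor TYPE('a)"
  have u: "?u \<in> flat_tests a"
    using \<eta> a test_functions_norm_powr[of \<eta> a "- s"] by (auto simp: flat_tests_def)
  have c: "?c * (?c * of_real ((2 * pi) ^ DIM('a))) = 1"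
  proof -
    have "(2 * pi) powr (- real DIM('a) / 2) * ((2 * pi) powr (- real DIM('a) / 2) * (2 * pi) powr real DIM('a)) = 1"
      by (simp flip: powr_add)
    then have "(2 * pi) powr (- real DIM('a) / 2) * ((2 * pi) powr (- real DIM('a) / 2) * (2 * pi) ^ DIM('a)) = 1"
      by (simp add: powr_realpow)
    then have "complex_of_real ((2 * pi) powr (- real DIM('a) / 2) * ((2 * pi) powr (- real DIM('a) / 2) * (2 * pi) ^ DIM('a))) = 1"
      by (simp only: of_real_1)
    then show ?thesis by (simp only: of_real_mult)
  qed
  have four: "fourier (ft ?u) k = ?c * of_real ((2 * pi) ^ DIM('a)) * ?u k" for k
    unfolding fourier_eq_ft using ft_inversion_test[OF flat_tests_subset[OF u], of k]
    by (simp add: ft_def)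
  have cancel: "of_real (norm k powr s) * ?u k = \<eta> k" for k
  proof (cases "k = 0")
    case True
    then show ?thesis using \<eta> a by (simp add: flat_tests_def)
  next
    case False
    then have "norm k powr s * norm k powr - s = 1" by (simp flip: powr_add)
    then have "complex_of_real (norm k powr s * norm k powr - s) = 1" by (simp only: of_real_1)
    then show ?thesis by (simp only: of_real_mult mult.assoc[symmetric] mult_1)
  qed
  have eq: "(\<lambda>k. of_real (norm k powr s) * fourier (ft ?u) k)
      = (\<lambda>k. (?c * of_real ((2 * pi) ^ DIM('a))) * \<eta> k)"
    by (rule ext) (simp only: four mult.left_commute[of "of_real (norm _ powr s)" "?c * of_real ((2 * pi) ^ DIM('a))"] cancel)
  have "D_test s (ft ?u) x = ft \<eta> x" for x
  proof -
    have "D_test s (ft ?u) x = ?c * ft (\<lambda>k. (?c * of_real ((2 * pi) ^ DIM('a))) * \<eta> k) x"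
      unfolding D_test_def eq inv_fourier_eq_ft ..
    also have "ft (\<lambda>k. (?c * of_real ((2 * pi) ^ DIM('a))) * \<eta> k) x = (?c * of_real ((2 * pi) ^ DIM('a))) * ft \<eta> x"
      unfolding ft_def by (subst integral_mult_right_zero[symmetric]) (simp only: mult.left_commute)
    also have "?c * (?c * of_real ((2 * pi) ^ DIM('a)) * ft \<eta> x) = (?c * (?c * of_real ((2 * pi) ^ DIM('a)))) * ft \<eta> x"
      by (rule mult.assoc[symmetric])
    finally show ?thesis unfolding c by simp
  qed
  then have "D_test s (ft ?u) = ft \<eta>" by (rule ext)
  moreover have "ft ?u \<in> Phi" using ft_flat_tests_in_Phi[OF a] u by blast
  ultimately show ?thesis by blast
qed

lemma ft_bounded_integrable:
  assumes "\<eta> \<in> flat_tests a"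
  shows "integrable lborel (ft \<eta>)" "\<exists>M. \<forall>x. norm (ft \<eta> x) \<le> M"
  using ft_integrable[of "ft \<eta>" a] assms norm_ft_le by blast+

text \<open>The injectivity of the embedding of \<open>L\<^sup>q\<close> and \<open>C\<^sub>0\<close> into \<open>\<Phi>'\<close>.\<close>
lemma Lsp_representative_unique:
  fixes g h :: "'a::euclidean_space \<Rightarrow> complex"
  assumes q: "1 \<le> q" and g: "g \<in> Lsp q" "represents g u" and h: "h \<in> Lsp q" "represents h u"
  shows "AE x in lborel. g x = h x"
proof -
  note sg = Lsp_small_plus_integrable[OF g(1) q] and sh = Lsp_small_plus_integrable[OF h(1) q]
  have "AE x in lborel. g x - h x = 0"
  proof (rule orthogonal_imp_AE_zero[OF small_plus_integrable_diff[OF sg sh]])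
    fix a :: real and \<eta> :: "'a \<Rightarrow> complex" assume a: "0 < a" and \<eta>: "\<eta> \<in> flat_tests a"
    have "ft \<eta> \<in> Phi" using ft_flat_tests_in_Phi[OF a] \<eta> by blast
    then have "functional_of g (ft \<eta>) = functional_of h (ft \<eta>)"
      using g(2) h(2) by (simp add: represents_def)
    moreover obtain M where "\<And>x. norm (ft \<eta> x) \<le> M" using ft_bounded_integrable[OF \<eta>] by blast
    then have "integrable lborel (\<lambda>x. g x * ft \<eta> x)" "integrable lborel (\<lambda>x. h x * ft \<eta> x)"
      using small_plus_integrable_mult[OF sg] small_plus_integrable_mult[OF sh] ft_bounded_integrable[OF \<eta>] by blast+
    ultimately show "(LINT x|lborel. (g x - h x) * ft \<eta> x) = 0"
      by (simp add: functional_of_def left_diff_distrib)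
  qed
  then show ?thesis by simp
qed

lemma Dpow_injective:
  fixes f :: "'a::euclidean_space \<Rightarrow> complex"
  assumes f: "f \<in> Lsp p" "1 \<le> p" and g: "represents g (Dpow n (functional_of f))" "AE x in lborel. g x = 0"
  shows "AE x in lborel. f x = 0"
proof (rule orthogonal_imp_AE_zero[OF Lsp_small_plus_integrable[OF f]])
  fix a :: real and \<eta> :: "'a \<Rightarrow> complex" assume "0 < a" "\<eta> \<in> flat_tests a"
  then obtain \<phi> where \<phi>: "\<phi> \<in> Phi" "D_test n \<phi> = ft \<eta>" using ft_flat_eq_D_test by blast
  have "functional_of g \<phi> = 0"
    unfolding functional_of_def using g(2) by (intro integral_eq_zero_AE) auto
  then have "functional_of f (ft \<eta>) = 0"
    using bspec[OF g(1)[unfolded represents_def Dpow_eq_D_test] \<phi>(1)] \<phi>(2) by simp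
  then show "(LINT x|lborel. f x * ft \<eta> x) = 0" by (simp add: functional_of_def)
qed

lemma AE_eq_imp_eq_of_continuous:
  fixes g h :: "'a::euclidean_space \<Rightarrow> complex"
  assumes "continuous_on UNIV g" "continuous_on UNIV h" "AE x in lborel. g x = h x"
  shows "g = h"
proof -
  let ?S = "{x. g x \<noteq> h x}"
  have "open ?S" using assms by (intro open_Collect_neq) auto
  moreover have "?S \<in> null_sets lborel"
  proof -
    have "AE x in lborel. x \<notin> ?S" using assms(3) by simp
    then show ?thesis using AE_iff_null_sets[of ?S lborel] borel_open[OF \<open>open ?S\<close>] by simp
  qed
  then have "negligible ?S"
    by (simp add: negligible_iff_null_sets null_sets_completionI)
  ultimately have "?S = {}" using open_not_negligible[of ?S] by blast
  then show ?thesis by auto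
qed

lemma Lsp_finite_measurable: "f \<in> Lsp p \<Longrightarrow> p \<noteq> top \<Longrightarrow> f \<in> borel_measurable borel"
  by (simp add: Lsp_def)

lemma Lnorm_cong_AE:
  assumes "g \<in> Lsp q" "h \<in> Lsp q" "AE x in lborel. g x = h x"
  shows "Lnorm q g = Lnorm q h"
proof (cases "q = top")
  case True
  then have "g = h" using assms by (intro AE_eq_imp_eq_of_continuous) (auto simp: Lsp_def)
  then show ?thesis by simp
next
  case False
  have [measurable]: "g \<in> borel_measurable borel" "h \<in> borel_measurable borel"
    using assms False by (auto intro: Lsp_finite_measurable)
  have "(LINT x|lborel. norm (g x) powr enn2real q) = (LINT x|lborel. norm (h x) powr enn2real q)"
  proof (rule integral_cong_AE)
    show "AE x in lborel. norm (g x) powr enn2real q = norm (h x) powr enn2real q"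
      using assms(3) by eventually_elim simp
  qed measurable
  then show ?thesis using False by (simp add: Lnorm_def)
qed

lemma Lnorm_dual_eq:
  assumes "1 \<le> q" "g \<in> Lsp q" "represents g u"
  shows "Lnorm_dual q u = Lnorm q g"
proof -
  let ?h = "SOME g. g \<in> Lsp q \<and> represents g u"
  have h: "?h \<in> Lsp q \<and> represents ?h u"
    by (rule someI[of "\<lambda>g. g \<in> Lsp q \<and> represents g u", OF conjI]) (use assms in auto)
  show ?thesis
    unfolding Lnorm_dual_def
    by (rule Lnorm_cong_AE[OF conjunct1[OF h] assms(2)
          Lsp_representative_unique[OF assms(1) conjunct1[OF h] conjunct2[OF h] assms(2,3)]])
qed

lemma Lnorm_nonneg:
  assumes "f \<in> Lsp p"
  shows "0 \<le> Lnorm p f"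
proof (cases "p = top")
  case True
  have "norm (f 0) \<le> (SUP x. norm (f x))"
    using Lsp_top_bdd[of f] assms True by (intro cSUP_upper) auto
  from order_trans[OF norm_ge_zero this] show ?thesis using True by (simp add: Lnorm_def)
qed (simp add: Lnorm_def)

lemma Lnorm_eq_0_imp_AE_zero:
  assumes "f \<in> Lsp p" "1 \<le> p" "Lnorm p f = 0"
  shows "AE x in lborel. f x = 0"
proof (cases "p = top")
  case True
  have "norm (f x) \<le> (SUP x. norm (f x))" for x
    using Lsp_top_bdd[of f] assms True by (intro cSUP_upper) auto
  then have "norm (f x) \<le> 0" for x using assms(3) True by (simp add: Lnorm_def)
  then show ?thesis by simp
next
  case False
  then have "integrable lborel (\<lambda>x. norm (f x) powr enn2real p)"
    "(LINT x|lborel. norm (f x) powr enn2real p) = 0"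
    using assms by (auto simp: Lsp_def Lnorm_def)
  then have "AE x in lborel. norm (f x) powr enn2real p = 0"
    by (subst (asm) integral_nonneg_eq_0_iff_AE) auto
  then show ?thesis by eventually_elim simp
qed

section \<open>Dilations\<close>

lemma Lsp_rescale:
  fixes f :: "'a::euclidean_space \<Rightarrow> complex"
  assumes f: "f \<in> Lsp p" and l: "0 < l"
  shows "rescale l f \<in> Lsp p"
proof (cases "p = top")
  case True
  then have cont: "continuous_on UNIV f" and lim: "(f \<longlongrightarrow> 0) at_infinity"
    using f by (auto simp: Lsp_def)
  have "continuous_on UNIV (rescale l f)"
    unfolding rescale_def by (intro continuous_on_compose2[OF cont]) (auto intro: continuous_intros)
  moreover have "filterlim (\<lambda>x::'a. l *\<^sub>R x) at_infinity at_infinity"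
    unfolding filterlim_at_infinity[OF order_refl] eventually_at_infinity
  proof (intro allI impI)
    fix r :: real
    show "\<exists>b. \<forall>x::'a. b \<le> norm x \<longrightarrow> r \<le> norm (l *\<^sub>R x)"
      using l by (intro exI[of _ "r / l"]) (auto simp: field_simps)
  qed
  then have "(rescale l f \<longlongrightarrow> 0) at_infinity"
    unfolding rescale_def by (rule filterlim_compose[OF lim])
  ultimately show ?thesis using True by (simp add: Lsp_def)
next
  case False
  have [measurable]: "f \<in> borel_measurable borel" using f False by (rule Lsp_finite_measurable)
  have "integrable lborel (\<lambda>x. norm (f x) powr enn2real p)"
    using f False by (simp add: Lsp_def)
  then have "integrable lborel (\<lambda>x. norm (rescale l f x) powr enn2real p)"
    using lborel_integral_scale(2)[OF l, of "\<lambda>x. norm (f x) powr enn2real p"] by (simp add: rescale_def)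
  moreover have "rescale l f \<in> borel_measurable borel"
    unfolding rescale_def by measurable
  ultimately show ?thesis using False by (simp add: Lsp_def)
qed

lemma Lsp_cmult:
  assumes "f \<in> Lsp p"
  shows "(\<lambda>x. of_real s * f x) \<in> Lsp p"
proof (cases "p = top")
  case True
  then show ?thesis using assms
    by (auto simp: Lsp_def intro!: continuous_intros tendsto_mult_right_zero)
next
  case False
  then show ?thesis using assms
    by (auto simp: Lsp_def norm_mult powr_mult intro!: borel_measurable_times)
qed

lemma Lnorm_rescale:
  fixes f :: "'a::euclidean_space \<Rightarrow> complex"
  assumes l: "0 < l" and p: "1 \<le> p"
  shows "Lnorm p (rescale l f) = l powr (- (real DIM('a) * recip p)) * Lnorm p f"
proof (cases "p = top")
  case True
  have "range (\<lambda>x. norm (f (l *\<^sub>R x))) = range (\<lambda>x. norm (f x))"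
  proof -
    have "norm (f x) = norm (f (l *\<^sub>R (x /\<^sub>R l)))" for x using l by simp
    then show ?thesis by blast
  qed
  then show ?thesis using True l by (simp add: Lnorm_def rescale_def)
next
  case False
  define P where "P = enn2real p"
  have P: "1 \<le> P" "recip p = 1 / P"
    using enn2real_ge_1[OF p] recip_finite[OF p] False by (auto simp: P_def top.not_eq_extremum)
  have "(LINT x|lborel. norm (f (l *\<^sub>R x)) powr P) = l powr (- real DIM('a)) * (LINT x|lborel. norm (f x) powr P)"
    using lborel_integral_scale(1)[OF l, of "\<lambda>x. norm (f x) powr P"] l
    by (simp add: powr_minus powr_realpow)
  then show ?thesis
    using False l P by (simp add: Lnorm_def rescale_def powr_mult powr_powr flip: P_def)
qed

lemma Lnorm_cmult:
  assumes f: "f \<in> Lsp p" and p: "1 \<le> p" and s: "0 < s"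
  shows "Lnorm p (\<lambda>x. of_real s * f x) = s * Lnorm p f"
proof (cases "p = top")
  case True
  have bdd: "bdd_above (range (\<lambda>x. norm (f x)))" using f True Lsp_top_bdd by auto
  have up: "norm (f x) \<le> (SUP x. norm (f x))" for x using bdd by (intro cSUP_upper) auto
  have bdd': "bdd_above (range (\<lambda>x. s * norm (f x)))"
    using up s by (intro bdd_aboveI2[of _ _ "s * (SUP x. norm (f x))"]) auto
  have "(SUP x. s * norm (f x)) = s * (SUP x. norm (f x))"
  proof (rule antisym)
    show "(SUP x. s * norm (f x)) \<le> s * (SUP x. norm (f x))"
      using up s by (intro cSUP_least) auto
    have "s * norm (f x) \<le> (SUP x. s * norm (f x))" for x
      by (rule cSUP_upper[OF UNIV_I bdd'])
    then have "(SUP x. norm (f x)) \<le> (SUP x. s * norm (f x)) / s"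
      using s by (intro cSUP_least) (auto simp: field_simps)
    then show "s * (SUP x. norm (f x)) \<le> (SUP x. s * norm (f x))"
      using s by (simp add: field_simps)
  qed
  then show ?thesis using True s by (simp add: Lnorm_def norm_mult)
next
  case False
  then have "1 \<le> enn2real p" "recip p = 1 / enn2real p"
    using enn2real_ge_1[OF p] recip_finite[OF p] by (auto simp: top.not_eq_extremum)
  then show ?thesis
    using False s by (simp add: Lnorm_def norm_mult powr_mult powr_powr)
qed

lemma schwartz_rescale:
  assumes "\<phi> \<in> schwartz" "0 < l"
  shows "rescale l \<phi> \<in> schwartz"
  unfolding schwartz_def
proof (intro CollectI conjI allI impI)
  have s: "smooth \<phi>" using assms by (simp add: schwartz_def)
  then show "smooth (rescale l \<phi>)" by (rule smooth_rescale)
  fix bs :: "'a list" and m :: nat assume bs: "set bs \<subseteq> Basis"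
  then obtain C where C: "\<And>x. norm x ^ m * norm (partials bs \<phi> x) \<le> C"
    using assms unfolding schwartz_def by blast
  have "norm x ^ m * norm (partials bs (rescale l \<phi>) x) \<le> l ^ length bs / l ^ m * C" for x
  proof -
    have "norm x ^ m * norm (partials bs (rescale l \<phi>) x)
        = l ^ length bs / l ^ m * (norm (l *\<^sub>R x) ^ m * norm (partials bs \<phi> (l *\<^sub>R x)))"
      using assms(2) by (simp add: partials_rescale[OF s bs] norm_mult norm_power power_mult_distrib)
    also have "\<dots> \<le> l ^ length bs / l ^ m * C"
      using assms(2) by (intro mult_left_mono C) auto
    finally show ?thesis .
  qed
  then show "\<exists>C. \<forall>x. norm x ^ m * norm (partials bs (rescale l \<phi>) x) \<le> C" by blast
qed

lemma Phi_rescale: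
  assumes "\<phi> \<in> Phi" "0 < l"
  shows "rescale l \<phi> \<in> Phi"
  unfolding Phi_def
proof (intro CollectI conjI allI impI)
  show "rescale l \<phi> \<in> schwartz" using assms by (intro schwartz_rescale) (auto simp: Phi_def)
  fix bs :: "'a list" assume bs: "set bs \<subseteq> Basis"
  let ?m = "\<lambda>x. of_real (prod_list (map (\<lambda>b. x \<bullet> b) bs)) :: complex"
  have hom: "prod_list (map (\<lambda>b. (c *\<^sub>R x) \<bullet> b) bs) = c ^ length bs * prod_list (map (\<lambda>b. x \<bullet> b) bs)" for c and x :: 'a
    by (induction bs) auto
  have "?m x * rescale l \<phi> x = of_real (1 / l ^ length bs) * (?m (l *\<^sub>R x) * \<phi> (l *\<^sub>R x))" for x
    using assms(2) unfolding hom by (simp add: rescale_def)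
  then have "(LINT x|lborel. ?m x * rescale l \<phi> x)
      = of_real (1 / l ^ length bs) * (LINT x|lborel. ?m (l *\<^sub>R x) * \<phi> (l *\<^sub>R x))"
    by (simp only: integral_mult_right_zero)
  also have "\<dots> = 0"
    using lborel_integral_scale(1)[OF assms(2), of "\<lambda>x. ?m x * \<phi> x"] assms(1) bs by (simp add: Phi_def)
  finally show "(LINT x|lborel. ?m x * rescale l \<phi> x) = 0" .
qed

lemma functional_of_rescale:
  fixes f :: "'a::euclidean_space \<Rightarrow> complex"
  assumes "0 < l"
  shows "functional_of (rescale l f) \<phi> = functional_of f (rescale (1 / l) \<phi>) /\<^sub>R l ^ DIM('a)"
  unfolding functional_of_def
  using lborel_integral_scale(1)[OF assms, of "\<lambda>x. f x * \<phi> ((1 / l) *\<^sub>R x)"] assms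
  by (simp add: rescale_def)

lemma ft_rescale:
  fixes f :: "'a::euclidean_space \<Rightarrow> complex"
  assumes "0 < m"
  shows "ft (rescale m f) x = ft f (x /\<^sub>R m) /\<^sub>R m ^ DIM('a)"
  using ft_character_rescale[OF assms, of 0 f x] by simp

lemma D_test_rescale:
  fixes \<phi> :: "'a::euclidean_space \<Rightarrow> complex"
  assumes m: "0 < m"
  shows "D_test s (rescale m \<phi>) = (\<lambda>x. of_real (m powr s) * rescale m (D_test s \<phi>) x)"
proof
  fix x
  let ?c = "fourier_factor TYPE('a)"
  let ?\<psi> = "\<lambda>k. of_real (norm k powr s) * fourier \<phi> k"
  let ?M = "of_real (m ^ DIM('a)) :: complex" and ?ms = "of_real (m powr s) :: complex"
  have M0: "?M \<noteq> 0" "?ms \<noteq> 0" using m by auto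
  have four: "fourier (rescale m \<phi>) k = fourier \<phi> ((1 / m) *\<^sub>R k) / ?M" for k
  proof -
    have "(- k) /\<^sub>R m = - ((1 / m) *\<^sub>R k)" by (simp add: inverse_eq_divide)
    then have "fourier (rescale m \<phi>) k = ?c * (of_real (inverse (m ^ DIM('a))) * ft \<phi> (- ((1 / m) *\<^sub>R k)))"
      by (simp only: fourier_eq_ft ft_rescale[OF m] scaleR_conv_of_real)
    then show ?thesis by (simp only: fourier_eq_ft of_real_inverse divide_inverse mult_ac)
  qed
  have nrm: "norm ((1 / m) *\<^sub>R k) powr s = norm k powr s / m powr s" for k :: 'a
    using m by (simp add: powr_divide)
  have "of_real (norm k powr s) * fourier (rescale m \<phi>) k = (?ms / ?M) * rescale (1 / m) ?\<psi> k" for k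
  proof -
    have "of_real (norm k powr s) * (X / ?M) = (?ms / ?M) * (of_real (norm k powr s) / ?ms * X)" for X
      using M0 by (simp add: divide_simps)
    then show ?thesis by (simp only: four rescale_def nrm of_real_divide)
  qed
  then have "ft (\<lambda>k. of_real (norm k powr s) * fourier (rescale m \<phi>) k) x
      = ft (\<lambda>k. (?ms / ?M) * rescale (1 / m) ?\<psi> k) x"
    by (simp only:)
  also have "\<dots> = (?ms / ?M) * ft (rescale (1 / m) ?\<psi>) x"
    unfolding ft_def by (subst integral_mult_right_zero[symmetric]) (simp only: mult.left_commute)
  also have "ft (rescale (1 / m) ?\<psi>) x = ft ?\<psi> (m *\<^sub>R x) * ?M"
  proof -
    have "ft (rescale (1 / m) ?\<psi>) x = ft ?\<psi> (x /\<^sub>R (1 / m)) /\<^sub>R (1 / m) ^ DIM('a)"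
      using m by (intro ft_rescale) simp
    also have "x /\<^sub>R (1 / m) = m *\<^sub>R x" by simp
    also have "inverse ((1 / m) ^ DIM('a)) = m ^ DIM('a)" by (simp add: power_one_over)
    finally show ?thesis by (simp only: scaleR_conv_of_real mult.commute[of _ ?M])
  qed
  also have "(?ms / ?M) * (ft ?\<psi> (m *\<^sub>R x) * ?M) = ?ms * ft ?\<psi> (m *\<^sub>R x)"
    using M0 by simp
  finally have "ft (\<lambda>k. of_real (norm k powr s) * fourier (rescale m \<phi>) k) x = ?ms * ft ?\<psi> (m *\<^sub>R x)" .
  then show "D_test s (rescale m \<phi>) x = ?ms * rescale m (D_test s \<phi>) x"
    by (simp only: D_test_def inv_fourier_eq_ft rescale_def mult.left_commute)
qed

lemma functional_of_cmult_right: "functional_of f (\<lambda>x. c * \<phi> x) = c * functional_of f \<phi>"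
  unfolding functional_of_def by (subst integral_mult_right_zero[symmetric]) (simp add: mult.left_commute)

lemma functional_of_cmult_left: "functional_of (\<lambda>x. c * f x) \<phi> = c * functional_of f \<phi>"
  unfolding functional_of_def by (subst integral_mult_right_zero[symmetric]) (simp add: mult.assoc)

text \<open>Homogeneity of \<open>D\<^sup>n\<close>: by duality, it follows from the homogeneity of the multiplier \<open>|k|\<^sup>n\<close> in
  \<open>D_test_rescale\<close>.\<close>
lemma represents_Dpow_rescale:
  fixes f :: "'a::euclidean_space \<Rightarrow> complex"
  assumes l: "0 < l" and rep: "represents g (Dpow n (functional_of f))"
  shows "represents (\<lambda>x. of_real (l powr n) * rescale l g x) (Dpow n (functional_of (rescale l f)))"
  unfolding represents_def Dpow_eq_D_test
proof
  fix \<phi> :: "'a \<Rightarrow> complex" assume \<phi>: "\<phi> \<in> Phi"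
  have l': "0 < 1 / l" using l by simp
  have "l powr n * (1 / l) powr n = 1" using l by (simp add: powr_divide)
  then have "complex_of_real (l powr n * (1 / l) powr n) = 1" by (simp only: of_real_1)
  then have ll: "complex_of_real (l powr n) * of_real ((1 / l) powr n) = 1" by (simp only: of_real_mult)
  have "functional_of f (D_test n (rescale (1 / l) \<phi>)) = functional_of g (rescale (1 / l) \<phi>)"
    using rep Phi_rescale[OF \<phi> l'] by (simp add: represents_def Dpow_eq_D_test)
  then have "of_real ((1 / l) powr n) * functional_of f (rescale (1 / l) (D_test n \<phi>)) = functional_of g (rescale (1 / l) \<phi>)"
    unfolding D_test_rescale[OF l'] functional_of_cmult_right .
  from this[symmetric] have rep': "functional_of f (rescale (1 / l) (D_test n \<phi>)) = of_real (l powr n) * functional_of g (rescale (1 / l) \<phi>)"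
    by (simp only: mult.assoc[symmetric] ll mult_1)
  show "functional_of (rescale l f) (D_test n \<phi>) = functional_of (\<lambda>x. of_real (l powr n) * rescale l g x) \<phi>"
    unfolding functional_of_cmult_left functional_of_rescale[OF l] rep' by simp
qed

lemma Lsp_D_representative:
  assumes "f \<in> Lsp_D p q n" "1 \<le> q"
  obtains g where "g \<in> Lsp q" "represents g (Dpow n (functional_of f))" "Dnorm q n f = Lnorm q g"
proof -
  obtain g where g: "g \<in> Lsp q" "represents g (Dpow n (functional_of f))"
    using assms(1) by (auto simp: Lsp_D_def in_Lsp_def)
  then show ?thesis
    using that Lnorm_dual_eq[OF assms(2) g] by (simp add: Dnorm_def)
qed

lemma Dnorm_nonneg: "f \<in> Lsp_D p q n \<Longrightarrow> 1 \<le> q \<Longrightarrow> 0 \<le> Dnorm q n f"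
  by (erule (1) Lsp_D_representative) (simp add: Lnorm_nonneg)

lemma Lnorm_pos:
  assumes "f \<in> Lsp_D p q n" "1 \<le> p" "\<not> (AE x in lborel. f x = 0)"
  shows "0 < Lnorm p f"
  using assms Lnorm_eq_0_imp_AE_zero[of f p] Lnorm_nonneg[of f p] by (auto simp: Lsp_D_def less_le)

text \<open>Injectivity of \<open>D\<^sup>n\<close> in terms of norms: the ratio in the definition of the optimal dilation has a
  positive denominator.\<close>
lemma Dnorm_pos:
  assumes "f \<in> Lsp_D p q n" "1 \<le> p" "1 \<le> q" "\<not> (AE x in lborel. f x = 0)"
  shows "0 < Dnorm q n f"
proof -
  obtain g where g: "g \<in> Lsp q" "represents g (Dpow n (functional_of f))" "Dnorm q n f = Lnorm q g"
    using Lsp_D_representative[OF assms(1,3)] by blast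
  have "Lnorm q g \<noteq> 0"
    using Dpow_injective[OF _ assms(2) g(2)] Lnorm_eq_0_imp_AE_zero[OF g(1) assms(3)] assms(1,4)
    by (auto simp: Lsp_D_def)
  then show ?thesis using g Lnorm_nonneg[OF g(1)] by simp
qed

lemma
  fixes f :: "'a::euclidean_space \<Rightarrow> complex"
  assumes f: "f \<in> Lsp_D p q n" and q: "1 \<le> q" and l: "0 < l"
  shows Lsp_D_rescale: "rescale l f \<in> Lsp_D p q n"
    and Dnorm_rescale: "Dnorm q n (rescale l f) = l powr (n - real DIM('a) * recip q) * Dnorm q n f"
proof -
  obtain g where g: "g \<in> Lsp q" "represents g (Dpow n (functional_of f))" "Dnorm q n f = Lnorm q g"
    using Lsp_D_representative[OF f q] by blast
  let ?g = "\<lambda>x. of_real (l powr n) * rescale l g x"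
  note rep = represents_Dpow_rescale[OF l g(2)]
  have gL: "?g \<in> Lsp q" by (intro Lsp_cmult Lsp_rescale g l)
  then show "rescale l f \<in> Lsp_D p q n"
    using rep f l by (auto simp: Lsp_D_def in_Lsp_def intro: Lsp_rescale)
  have "Dnorm q n (rescale l f) = Lnorm q ?g"
    unfolding Dnorm_def by (rule Lnorm_dual_eq[OF q gL rep])
  also have "\<dots> = l powr n * (l powr (- (real DIM('a) * recip q)) * Lnorm q g)"
    using l by (simp add: Lnorm_cmult[OF Lsp_rescale[OF g(1) l] q] Lnorm_rescale[OF l q])
  also have "\<dots> = l powr (n - real DIM('a) * recip q) * Lnorm q g"
    using l by (simp add: powr_diff powr_minus field_simps)
  finally show "Dnorm q n (rescale l f) = l powr (n - real DIM('a) * recip q) * Dnorm q n f"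
    using g(3) by simp
qed

lemma rescale_not_AE_zero:
  fixes f :: "'a::euclidean_space \<Rightarrow> complex"
  assumes "f \<in> Lsp_D p q n" "1 \<le> p" "0 < l" "\<not> (AE x in lborel. f x = 0)"
  shows "\<not> (AE x in lborel. rescale l f x = 0)"
proof
  assume ae: "AE x in lborel. rescale l f x = 0"
  have f: "f \<in> Lsp p" using assms(1) by (simp add: Lsp_D_def)
  have "Lnorm p (rescale l f) = Lnorm p (\<lambda>x. of_real 0 * f x)"
    using ae by (intro Lnorm_cong_AE Lsp_rescale Lsp_cmult f assms(3)) auto
  also have "\<dots> = 0"
    using assms(2) by (cases "p = top") (auto simp: Lnorm_def)
  finally show False
    using Lnorm_rescale[OF assms(3,2), of f] Lnorm_pos[OF assms(1,2,4)] assms(3) by simp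
qed

section \<open>The two inequalities\<close>

text \<open>Towards the formal value of the optimal dilation, \<open>l\<^sup>e\<close> tends to \<open>0\<close> if \<open>\<theta> = 0\<close> and to \<open>\<infinity>\<close> if
  \<open>\<theta> = 1\<close>.\<close>
lemma tendsto_powr_formal_limit:
  assumes "\<theta> = 0 \<or> \<theta> = 1" "e \<noteq> 0"
  shows "((\<lambda>l::real. l powr (if \<theta> = 0 then e else - e)) \<longlongrightarrow> 0) (formal_limit \<theta> e)"
    and "\<forall>\<^sub>F l in formal_limit \<theta> e. 0 < l"
proof -
  let ?s = "if \<theta> = 0 then e else - e"
  have s0: "?s \<noteq> 0" using assms(2) by simp
  have fl: "formal_limit \<theta> e = (if 0 < ?s then at_right 0 else at_top)"
    using assms by (auto simp: formal_limit_def)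
  have pos: "((\<lambda>l::real. l powr ?s) \<longlongrightarrow> 0) (at_right 0)" if "0 < ?s"
    using that by (intro tendsto_eq_intros | force simp: eventually_at_filter)+
  have neg: "((\<lambda>l::real. l powr ?s) \<longlongrightarrow> 0) at_top" if "?s < 0"
    by (rule tendsto_neg_powr[OF that filterlim_ident])
  show "((\<lambda>l::real. l powr ?s) \<longlongrightarrow> 0) (formal_limit \<theta> e)"
    unfolding fl using pos neg s0 by (cases "0 < ?s") simp_all
  show "\<forall>\<^sub>F l in formal_limit \<theta> e. 0 < l"
    unfolding fl by (simp add: eventually_at_right_less eventually_gt_at_top)
qed

locale gn_exponents =
  fixes T :: "'a::euclidean_space itself" and p q r t :: ennreal and n j \<theta> :: real
  assumes p: "1 \<le> p" and q: "1 \<le> q" and r: "1 \<le> r" and t: "1 \<le> t" and \<theta>: "0 \<le> \<theta>" "\<theta> \<le> 1"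
    and recip_r: "recip r = (1 - \<theta>) * recip p + \<theta> * recip q - (\<theta> * n - j) / real DIM('a)"
begin

text \<open>Dilation by \<open>l\<close> multiplies the quotient of \<open>\<parallel>D\<^sup>n f\<parallel>\<^sub>q\<close> by \<open>\<parallel>f\<parallel>\<^sub>p\<close> by \<open>l powr e\<close>.\<close>
definition e :: real where "e = scaling_exponent TYPE('a) p q n"
abbreviation "\<kappa> \<equiv> conv_factor \<theta> t"
definition G :: real where "G = GN_const TYPE('a) p q r j n \<theta>"
definition S :: real where "S = S_const TYPE('a) p q r j n t"

text \<open>The power of \<open>l\<close> by which dilation by \<open>l\<close> multiplies \<open>\<parallel>D\<^sup>j f\<parallel>\<^sub>r\<close>.\<close>
definition D_exponent :: real where "D_exponent = j - real DIM('a) * recip r"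

lemma \<kappa>_pos: "0 < \<kappa>"
  using conv_factor_pos[OF \<theta> t] .

text \<open>This is the relation that defines \<open>r\<close>, seen from the dilations: relative to \<open>\<parallel>D\<^sup>j f\<parallel>\<^sub>r\<close>, the two norms on the
  right-hand side scale with exponents \<open>- \<theta> e\<close> and \<open>(1 - \<theta>) e\<close>.\<close>
lemma exponents:
  "- (real DIM('a) * recip p) = D_exponent + - \<theta> * e"
  "n - real DIM('a) * recip q = D_exponent + (1 - \<theta>) * e"
proof -
  have "real DIM('a) * recip r = (1 - \<theta>) * (real DIM('a) * recip p) + \<theta> * (real DIM('a) * recip q) - (\<theta> * n - j)"
    unfolding recip_r by (simp add: field_simps)
  then show "- (real DIM('a) * recip p) = D_exponent + - \<theta> * e"
    "n - real DIM('a) * recip q = D_exponent + (1 - \<theta>) * e"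
    by (simp_all add: D_exponent_def e_def scaling_exponent_def algebra_simps)
qed

lemma S_rhs_rescale:
  fixes f :: "'a \<Rightarrow> complex"
  assumes f: "f \<in> Lsp_D p q n" and l: "0 < l"
  shows "S_rhs p q n t (rescale l f)
    = l powr D_exponent * tsum t ((l powr e) powr - \<theta> * Lnorm p f) ((l powr e) powr (1 - \<theta>) * Dnorm q n f)"
proof -
  have "Lnorm p (rescale l f) = l powr D_exponent * ((l powr e) powr - \<theta> * Lnorm p f)"
    unfolding Lnorm_rescale[OF l p] exponents(1) powr_add powr_powr by (simp add: mult.commute)
  moreover have "Dnorm q n (rescale l f) = l powr D_exponent * ((l powr e) powr (1 - \<theta>) * Dnorm q n f)"
    unfolding Dnorm_rescale[OF f q l] exponents(2) powr_add powr_powr by (simp add: mult.commute)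
  moreover have "0 \<le> Lnorm p f" using f Lnorm_nonneg by (auto simp: Lsp_D_def)
  ultimately show ?thesis
    unfolding S_rhs_def using Dnorm_nonneg[OF f q] l by (simp add: tsum_mult_left[OF _ _ _ t])
qed

lemma S_rhs_nonneg:
  fixes f :: "'a \<Rightarrow> complex"
  assumes "f \<in> Lsp_D p q n"
  shows "0 \<le> S_rhs p q n t f"
  using assms Lnorm_nonneg by (auto simp: S_rhs_def Lsp_D_def intro: tsum_nonneg)

lemma GN_rhs_nonneg: "0 \<le> GN_rhs p q n \<theta> f"
  by (simp add: GN_rhs_def rpow_nonneg)

lemma GN_rhs_le_S_rhs:
  fixes f :: "'a \<Rightarrow> complex"
  assumes "f \<in> Lsp_D p q n"
  shows "GN_rhs p q n \<theta> f \<le> \<kappa> * S_rhs p q n t f"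
  unfolding GN_rhs_def S_rhs_def
  using assms Lnorm_nonneg Dnorm_nonneg[OF assms q] \<theta> t
  by (intro rpow_mult_le_tsum) (auto simp: Lsp_D_def)

lemma GN_bound_imp_S_bound:
  assumes "GN_bound TYPE('a) p q r j n \<theta> C"
  shows "S_bound TYPE('a) p q r j n t (\<kappa> * C)"
  unfolding S_bound_def
proof (intro conjI allI impI)
  have C: "0 \<le> C" using assms by (simp add: GN_bound_def)
  then show "0 \<le> \<kappa> * C" using \<kappa>_pos by simp
  fix f :: "'a \<Rightarrow> complex" assume f: "f \<in> Lsp_D p q n"
  then have "Dnorm r j f \<le> C * GN_rhs p q n \<theta> f" using assms by (simp add: GN_bound_def)
  also have "\<dots> \<le> C * (\<kappa> * S_rhs p q n t f)" by (intro mult_left_mono GN_rhs_le_S_rhs f C)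
  finally show "Dnorm r j f \<le> \<kappa> * C * S_rhs p q n t f" by (simp add: mult_ac)
qed

text \<open>Since \<open>e \<noteq> 0\<close>, every \<open>\<mu> > 0\<close> is of the form \<open>l\<^sup>e\<close>; the Sobolev inequality for all dilates of \<open>f\<close> is
  therefore a one-parameter family of bounds for \<open>\<parallel>D\<^sup>j f\<parallel>\<^sub>r\<close>.\<close>
lemma S_bound_imp_GN_bound:
  assumes incl: "(Lsp_D p q n :: ('a \<Rightarrow> complex) set) \<subseteq> Lsp_D p r j"
    and e: "e \<noteq> 0" and C: "S_bound TYPE('a) p q r j n t C"
  shows "GN_bound TYPE('a) p q r j n \<theta> (C / \<kappa>)"
  unfolding GN_bound_def
proof (intro conjI allI impI)
  have C0: "0 \<le> C" using C by (simp add: S_bound_def)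
  then show "0 \<le> C / \<kappa>" using \<kappa>_pos by simp
  fix f :: "'a \<Rightarrow> complex" assume f: "f \<in> Lsp_D p q n"
  then have f': "f \<in> Lsp_D p r j" using incl by blast
  have "\<kappa> * Dnorm r j f \<le> C * (rpow (Lnorm p f) (1 - \<theta>) * rpow (Dnorm q n f) \<theta>)"
  proof (rule scaling_family_imp_product_bound[OF _ C0 _ Dnorm_nonneg[OF f q] \<theta> t])
    show "0 \<le> Lnorm p f" using f Lnorm_nonneg by (auto simp: Lsp_D_def)
    fix \<mu> :: real assume \<mu>: "0 < \<mu>"
    define l where "l = \<mu> powr (1 / e)"
    have l: "0 < l" "l powr e = \<mu>" using \<mu> e by (auto simp: l_def powr_powr)
    have "Dnorm r j (rescale l f) \<le> C * S_rhs p q n t (rescale l f)"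
      using C Lsp_D_rescale[OF f q l(1)] by (simp add: S_bound_def)
    then have "l powr D_exponent * Dnorm r j f
        \<le> l powr D_exponent * (C * tsum t (\<mu> powr - \<theta> * Lnorm p f) (\<mu> powr (1 - \<theta>) * Dnorm q n f))"
      unfolding Dnorm_rescale[OF f' r l(1)] S_rhs_rescale[OF f l(1)] l(2) D_exponent_def[symmetric]
      by (simp only: mult.left_commute)
    then show "Dnorm r j f \<le> C * tsum t (\<mu> powr - \<theta> * Lnorm p f) (\<mu> powr (1 - \<theta>) * Dnorm q n f)"
      using l(1) by (simp add: mult_le_cancel_left_pos)
  qed
  then show "Dnorm r j f \<le> C / \<kappa> * GN_rhs p q n \<theta> f"
    using \<kappa>_pos by (simp add: GN_rhs_def field_simps)
qed

lemma GN_const_sharp: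
  assumes "GN TYPE('a) p q r j n \<theta>"
  shows "GN_bound TYPE('a) p q r j n \<theta> G"
    and "GN_bound TYPE('a) p q r j n \<theta> C \<Longrightarrow> G \<le> C"
proof -
  obtain C\<^sub>0 where "GN_bound TYPE('a) p q r j n \<theta> C\<^sub>0" using assms by (auto simp: GN_def)
  note L = LEAST_sharp_constant[where A = "Lsp_D p q n :: ('a \<Rightarrow> complex) set" and c = "Dnorm r j"
      and m = "GN_rhs p q n \<theta>", folded GN_bound_def[of "TYPE('a)"] GN_const_def[of "TYPE('a)"] G_def,
      OF this GN_rhs_nonneg]
  show "GN_bound TYPE('a) p q r j n \<theta> G" by (rule L(1))
  show "GN_bound TYPE('a) p q r j n \<theta> C \<Longrightarrow> G \<le> C" by (rule L(2))
qed

lemma S_const_sharp: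
  assumes "Sob TYPE('a) p q r j n t"
  shows "S_bound TYPE('a) p q r j n t S"
    and "S_bound TYPE('a) p q r j n t C \<Longrightarrow> S \<le> C"
proof -
  obtain C\<^sub>0 where "S_bound TYPE('a) p q r j n t C\<^sub>0" using assms by (auto simp: Sob_def)
  note L = LEAST_sharp_constant[where A = "Lsp_D p q n :: ('a \<Rightarrow> complex) set" and c = "Dnorm r j"
      and m = "S_rhs p q n t", folded S_bound_def[of "TYPE('a)"] S_const_def[of "TYPE('a)"] S_def,
      OF this S_rhs_nonneg]
  show "S_bound TYPE('a) p q r j n t S" by (rule L(1))
  show "S_bound TYPE('a) p q r j n t C \<Longrightarrow> S \<le> C" by (rule L(2))
qed

lemma GN_imp_Sob:
  assumes "GN TYPE('a) p q r j n \<theta>"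
  shows "Sob TYPE('a) p q r j n t" "S \<le> \<kappa> * G"
proof -
  have b: "S_bound TYPE('a) p q r j n t (\<kappa> * G)"
    by (rule GN_bound_imp_S_bound[OF GN_const_sharp(1)[OF assms]])
  then show s: "Sob TYPE('a) p q r j n t" using assms by (auto simp: Sob_def GN_def)
  show "S \<le> \<kappa> * G" by (rule S_const_sharp(2)[OF s b])
qed

lemma Sob_imp_GN:
  assumes "Sob TYPE('a) p q r j n t" "e \<noteq> 0"
  shows "GN TYPE('a) p q r j n \<theta>" "S = \<kappa> * G"
proof -
  have incl: "(Lsp_D p q n :: ('a \<Rightarrow> complex) set) \<subseteq> Lsp_D p r j"
    using assms(1) by (simp add: Sob_def)
  have b: "GN_bound TYPE('a) p q r j n \<theta> (S / \<kappa>)"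
    by (rule S_bound_imp_GN_bound[OF incl assms(2) S_const_sharp(1)[OF assms(1)]])
  then show g: "GN TYPE('a) p q r j n \<theta>" using incl by (auto simp: GN_def)
  have "G \<le> S / \<kappa>" by (rule GN_const_sharp(2)[OF g b])
  then have "\<kappa> * G \<le> S" using \<kappa>_pos by (simp add: field_simps)
  then show "S = \<kappa> * G" using GN_imp_Sob(2)[OF g] by simp
qed

text \<open>For \<open>\<theta> = 0\<close> let \<open>x = \<parallel>f\<parallel>\<^sub>p\<close> and \<open>y = \<parallel>D\<^sup>n f\<parallel>\<^sub>q\<close>, for \<open>\<theta> = 1\<close> the other way round. After division by the
  common power of \<open>l\<close>, the right-hand side of the Sobolev inequality lies between \<open>x\<close> and
  \<open>x + v l * y\<close>, where \<open>v l\<close> tends to \<open>0\<close>.\<close>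
lemma GN_maximizer_limit:
  fixes f :: "'a \<Rightarrow> complex"
  assumes e: "e \<noteq> 0" and GN: "GN TYPE('a) p q r j n \<theta>" and max: "GN_maximizer p q r j n \<theta> f"
    and endpt: "\<theta> = 0 \<or> \<theta> = 1"
  shows "((\<lambda>l. Dnorm r j (rescale l f) / S_rhs p q n t (rescale l f)) \<longlongrightarrow> S) (formal_limit \<theta> e)"
proof -
  have f: "f \<in> Lsp_D p q n" and nz: "\<not> (AE x in lborel. f x = 0)"
    and eq: "Dnorm r j f = G * GN_rhs p q n \<theta> f"
    using max by (auto simp: GN_maximizer_def G_def)
  have f': "f \<in> Lsp_D p r j" using f GN by (auto simp: GN_def)
  have a: "0 < Lnorm p f" using Lnorm_pos[OF f p nz] .
  have b: "0 < Dnorm q n f" using Dnorm_pos[OF f p q nz] .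
  have S: "S = G" using Sob_imp_GN(2)[OF GN_imp_Sob(1)[OF GN] e] conv_factor_endpoint[OF endpt] by simp
  define v where "v l = l powr (if \<theta> = 0 then e else - e)" for l :: real
  define x y where "x = (if \<theta> = 0 then Lnorm p f else Dnorm q n f)" and "y = (if \<theta> = 0 then Dnorm q n f else Lnorm p f)"
  have xy: "0 < x" "0 < y" using a b by (auto simp: x_def y_def)
  have rhs: "GN_rhs p q n \<theta> f = x"
    using endpt a b by (auto simp: GN_rhs_def rpow_def x_def)
  note lim = tendsto_powr_formal_limit[OF endpt e, folded v_def]
  have ratio: "Dnorm r j (rescale l f) / S_rhs p q n t (rescale l f)
      = G * x / (if \<theta> = 0 then tsum t x (v l * y) else tsum t (v l * y) x)" if l: "0 < l" for l
  proof -
    have "Dnorm r j (rescale l f) = l powr D_exponent * (G * x)"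
      unfolding Dnorm_rescale[OF f' r l] eq rhs D_exponent_def ..
    moreover have "S_rhs p q n t (rescale l f)
        = l powr D_exponent * (if \<theta> = 0 then tsum t x (v l * y) else tsum t (v l * y) x)"
      unfolding S_rhs_rescale[OF f l] using endpt l by (auto simp: v_def x_def y_def powr_powr)
    ultimately show ?thesis using l by simp
  qed
  have "((\<lambda>l. if \<theta> = 0 then tsum t x (v l * y) else tsum t (v l * y) x) \<longlongrightarrow> x) (formal_limit \<theta> e)"
  proof (rule tendsto_sandwich)
    have vpos: "0 \<le> v l * y" for l using xy by (simp add: v_def)
    show "\<forall>\<^sub>F l in formal_limit \<theta> e. x \<le> (if \<theta> = 0 then tsum t x (v l * y) else tsum t (v l * y) x)"
      using tsum_ge_max[OF _ vpos t, of x] tsum_ge_max[OF vpos _ t, of x] xy by (intro always_eventually) auto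
    show "\<forall>\<^sub>F l in formal_limit \<theta> e. (if \<theta> = 0 then tsum t x (v l * y) else tsum t (v l * y) x) \<le> x + v l * y"
      using tsum_le_add[OF _ vpos t, of x] tsum_le_add[OF vpos _ t, of x] xy
      by (intro always_eventually) (auto simp: add.commute)
    show "((\<lambda>l. x + v l * y) \<longlongrightarrow> x) (formal_limit \<theta> e)"
      using tendsto_add[OF tendsto_const[of x] tendsto_mult_right[OF lim(1), of y]] by simp
  qed simp
  then have "((\<lambda>l. G * x / (if \<theta> = 0 then tsum t x (v l * y) else tsum t (v l * y) x)) \<longlongrightarrow> G * x / x) (formal_limit \<theta> e)"
    using xy by (intro tendsto_divide tendsto_const) auto
  then have "((\<lambda>l. G * x / (if \<theta> = 0 then tsum t x (v l * y) else tsum t (v l * y) x)) \<longlongrightarrow> S) (formal_limit \<theta> e)"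
    using xy S by simp
  then show ?thesis
  proof (rule Lim_transform_eventually)
    show "\<forall>\<^sub>F l in formal_limit \<theta> e. G * x / (if \<theta> = 0 then tsum t x (v l * y) else tsum t (v l * y) x)
        = Dnorm r j (rescale l f) / S_rhs p q n t (rescale l f)"
      using lim(2) by eventually_elim (simp only: ratio)
  qed
qed

text \<open>The scale is chosen such that the mean inequality is an equality for the dilated function; the product
  inequality remains an equality under dilations.\<close>
lemma GN_maximizer_rescaled:
  fixes f :: "'a \<Rightarrow> complex"
  assumes e: "e \<noteq> 0" and GN: "GN TYPE('a) p q r j n \<theta>" and max: "GN_maximizer p q r j n \<theta> f"
    and inner: "0 < \<theta> \<and> \<theta> < 1 \<or> t = top"
  shows "S_maximizer p q r j n t (rescale (opt_scale p q n \<theta> t f) f)"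
proof -
  have f: "f \<in> Lsp_D p q n" and nz: "\<not> (AE x in lborel. f x = 0)"
    and eq: "Dnorm r j f = G * GN_rhs p q n \<theta> f"
    using max by (auto simp: GN_maximizer_def G_def)
  have f': "f \<in> Lsp_D p r j" using f GN by (auto simp: GN_def)
  have a: "0 < Lnorm p f" using Lnorm_pos[OF f p nz] .
  have b: "0 < Dnorm q n f" using Dnorm_pos[OF f p q nz] .
  define \<mu> where "\<mu> = rpow (\<theta> / (1 - \<theta>)) (recip t) * (Lnorm p f / Dnorm q n f)"
  note opt = rpow_mult_eq_tsum[OF a b \<theta> t inner, folded \<mu>_def]
  define l where "l = opt_scale p q n \<theta> t f"
  have l: "0 < l" "l powr e = \<mu>"
  proof -
    have "l = \<mu> powr (1 / e)" by (simp only: l_def opt_scale_def \<mu>_def e_def)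
    then show "0 < l" "l powr e = \<mu>" using opt(1) e by (simp_all add: powr_powr)
  qed
  have rhs: "GN_rhs p q n \<theta> f = Lnorm p f powr (1 - \<theta>) * Dnorm q n f powr \<theta>"
    using a b by (simp add: GN_rhs_def rpow_def)
  have "Dnorm r j (rescale l f) = l powr D_exponent * (G * (\<kappa> * tsum t (\<mu> powr - \<theta> * Lnorm p f) (\<mu> powr (1 - \<theta>) * Dnorm q n f)))"
    unfolding Dnorm_rescale[OF f' r l(1)] eq rhs opt(2) D_exponent_def ..
  also have "\<dots> = (\<kappa> * G) * S_rhs p q n t (rescale l f)"
    unfolding S_rhs_rescale[OF f l(1)] l(2) by (simp only: mult_ac)
  also have "\<kappa> * G = S" using Sob_imp_GN(2)[OF GN_imp_Sob(1)[OF GN] e] by simp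
  finally show ?thesis
    unfolding S_maximizer_def l_def[symmetric] S_def[symmetric]
    using Lsp_D_rescale[OF f q l(1)] rescale_not_AE_zero[OF f p l(1) nz] by simp
qed

text \<open>The Sobolev inequality with constant \<open>\<kappa> G\<close> arises by chaining the product inequality and the mean
  inequality; if the chain is an equality, then so is its first link.\<close>
lemma S_maximizer_imp_GN_maximizer:
  fixes f :: "'a \<Rightarrow> complex"
  assumes e: "e \<noteq> 0" and Sob: "Sob TYPE('a) p q r j n t" and max: "S_maximizer p q r j n t f"
  shows "GN_maximizer p q r j n \<theta> f"
proof -
  have f: "f \<in> Lsp_D p q n" and nz: "\<not> (AE x in lborel. f x = 0)"
    and eq: "Dnorm r j f = S * S_rhs p q n t f"
    using max by (auto simp: S_maximizer_def S_def)
  note GN = Sob_imp_GN[OF Sob e]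
  have bound: "GN_bound TYPE('a) p q r j n \<theta> G" by (rule GN_const_sharp(1)[OF GN(1)])
  then have le: "Dnorm r j f \<le> G * GN_rhs p q n \<theta> f" and G0: "0 \<le> G"
    using f by (auto simp: GN_bound_def)
  have "G * GN_rhs p q n \<theta> f \<le> G * (\<kappa> * S_rhs p q n t f)"
    by (intro mult_left_mono GN_rhs_le_S_rhs f G0)
  also have "\<dots> = Dnorm r j f" unfolding eq GN(2) by (simp only: mult_ac)
  finally show ?thesis using le f nz by (simp add: GN_maximizer_def G_def)
qed

end

text \<open>The two shapes of the third claim are \<open>GN_maximizer_limit\<close> and \<open>GN_maximizer_rescaled\<close>: outside the
  limit case, either \<open>\<theta>\<close> is interior or \<open>t = \<infinity>\<close>, and then the optimal dilation is a positive number.\<close>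
theorem proposition3p8:
  fixes p q r t :: ennreal and n j \<theta> :: real
  assumes "1 \<le> p" and "1 \<le> q" and "1 \<le> t" and "0 \<le> \<theta>" and "\<theta> \<le> 1" and "0 \<le> n" and "0 \<le> j"
    and "0 \<le> (1 - \<theta>) * recip p + \<theta> * recip q - (\<theta> * n - j) / real DIM('a::euclidean_space)"
    and "(1 - \<theta>) * recip p + \<theta> * recip q - (\<theta> * n - j) / real DIM('a) \<le> 1"
    and "1 \<le> r"
    and "recip r = (1 - \<theta>) * recip p + \<theta> * recip q - (\<theta> * n - j) / real DIM('a)"
  shows
    "(GN TYPE('a) p q r j n \<theta> \<longrightarrow>
        Sob TYPE('a) p q r j n t \<and>
        S_const TYPE('a) p q r j n t \<le> conv_factor \<theta> t * GN_const TYPE('a) p q r j n \<theta>)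
     \<and> (scaling_exponent TYPE('a) p q n \<noteq> 0 \<longrightarrow>
          (GN TYPE('a) p q r j n \<theta> \<longleftrightarrow> Sob TYPE('a) p q r j n t) \<and>
          (GN TYPE('a) p q r j n \<theta> \<longrightarrow>
             S_const TYPE('a) p q r j n t = conv_factor \<theta> t * GN_const TYPE('a) p q r j n \<theta>))
     \<and> (scaling_exponent TYPE('a) p q n \<noteq> 0 \<longrightarrow> GN TYPE('a) p q r j n \<theta> \<longrightarrow>
          (\<forall>f :: 'a \<Rightarrow> complex. GN_maximizer p q r j n \<theta> f \<longrightarrow>
             (if t < top \<and> (\<theta> = 0 \<or> \<theta> = 1)
              then ((\<lambda>l. Dnorm r j (rescale l f) / S_rhs p q n t (rescale l f))
                      \<longlongrightarrow> S_const TYPE('a) p q r j n t)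
                     (formal_limit \<theta> (scaling_exponent TYPE('a) p q n))
              else S_maximizer p q r j n t (rescale (opt_scale p q n \<theta> t f) f))))
     \<and> (scaling_exponent TYPE('a) p q n \<noteq> 0 \<longrightarrow> Sob TYPE('a) p q r j n t \<longrightarrow>
          (\<forall>f :: 'a \<Rightarrow> complex. S_maximizer p q r j n t f \<longrightarrow> GN_maximizer p q r j n \<theta> f))"
proof -
  interpret gn_exponents "TYPE('a)" p q r t n j \<theta>
    by unfold_locales (use assms in auto)
  have "if t < top \<and> (\<theta> = 0 \<or> \<theta> = 1)
      then ((\<lambda>l. Dnorm r j (rescale l f) / S_rhs p q n t (rescale l f))
              \<longlongrightarrow> S_const TYPE('a) p q r j n t) (formal_limit \<theta> (scaling_exponent TYPE('a) p q n))
      else S_maximizer p q r j n t (rescale (opt_scale p q n \<theta> t f) f)"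
    if "scaling_exponent TYPE('a) p q n \<noteq> 0" "GN TYPE('a) p q r j n \<theta>" "GN_maximizer p q r j n \<theta> f"
    for f :: "'a \<Rightarrow> complex"
  proof (cases "t < top \<and> (\<theta> = 0 \<or> \<theta> = 1)")
    case True
    then show ?thesis using GN_maximizer_limit[unfolded e_def S_def, OF that]
      unfolding if_P[OF True] by simp
  next
    case False
    then have "0 < \<theta> \<and> \<theta> < 1 \<or> t = top"
      using assms(4,5) by (auto simp: top.not_eq_extremum)
    then show ?thesis using GN_maximizer_rescaled[unfolded e_def, OF that]
      unfolding if_not_P[OF False] by simp
  qed
  then show ?thesis
    using GN_imp_Sob Sob_imp_GN S_maximizer_imp_GN_maximizer
    unfolding e_def G_def S_def by blast
qed

end
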